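(* Let $d\ge 2$ be an integer, let $\alpha\in\overline{\mathbb Q}$, let $K=\mathbb Q(\alpha)$, and let $\ell$ be the number of non-archimedean places $|\cdot|_v$ of $K$ with $|\alpha|_v\notin\{0,1\}$. For $\lambda\in\overline{\mathbb Q}$ let $\mathbf f_\lambda(z)=\frac{z^d+\lambda}{z}$. Then for every $\lambda\in\overline{\mathbb Q}$, $$\left|\widehat h_{\mathbf f_\lambda}(\alpha)-\widehat h_{\mathbf f}(\alpha)\cdot h(\lambda)\right|<3d\,(1+\ell+2h(\alpha)).$$
   Context: $h$ denotes the absolute logarithmic Weil height on $\overline{\mathbb Q}$ (with $x$ identified with $[x:1]\in\mathbb P^1$). For $\lambda\in\overline{\mathbb Q}$, $\widehat h_{\mathbf f_\lambda}(\alpha)=\lim_{n\to\infty}h(\mathbf f_\lambda^n(\alpha))/d^n$. On the generic fiber, $\mathbf f_t(z)=\frac{z^d+t}{z}\in\overline{\mathbb Q}(t)(z)$, and $\widehat h_{\mathbf f}(\alpha)=\lim_{n\to\infty}\deg_t(\mathbf f_t^n(\alpha))/d^n$, where $\alpha$ is viewed as a constant element of $\overline{\mathbb Q}(t)$ and the degree of a rational function is the maximum of the degrees of numerator and denominator in lowest terms. *)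

theory Defs
  imports Complex_Main "HOL-Computational_Algebra.Computational_Algebra" "HOL-Computational_Algebra.Field_as_Ring"
begin

text \<open>Qbar is modelled as the algebraic complex numbers (library predicate algebraic).\<close>

text \<open>Absolute logarithmic Weil height of an algebraic number x, via the Mahler measure of
  its minimal polynomial p over the integers (irreducible in Z[X], hence primitive and
  separable): h(x) = (log |lead p| + sum over complex roots z of p of log max(1,|z|)) / deg p.\<close>
definition min_int_poly :: "complex \<Rightarrow> int poly" where
  "min_int_poly x = (SOME p. irreducible p \<and> degree p > 0 \<and> poly (map_poly of_int p) x = 0)"

definition weil_height :: "complex \<Rightarrow> real" where
  "weil_height x = (let p = min_int_poly x in
     (ln \<bar>real_of_int (lead_coeff p)\<bar> +
      (\<Sum>z\<in>{z. poly (map_poly of_int p) z = (0::complex)}. ln (max 1 (cmod z))))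
     / real (degree p))"

text \<open>Points of P^1(Qbar): Some z is [z:1], None is the point at infinity [1:0].
  Height of the point at infinity is 0.\<close>
definition height_P1 :: "complex option \<Rightarrow> real" where
  "height_P1 P = (case P of None \<Rightarrow> 0 | Some z \<Rightarrow> weil_height z)"

text \<open>The map f_lambda(z) = (z^d + lambda)/z acting on P^1 (in lowest terms; for lambda = 0
  this is z^(d-1), which fixes 0 and infinity).\<close>
definition fmap :: "nat \<Rightarrow> complex \<Rightarrow> complex option \<Rightarrow> complex option" where
  "fmap d lam P = (case P of None \<Rightarrow> None
     | Some z \<Rightarrow> (if z \<noteq> 0 then Some ((z ^ d + lam) / z)
                  else if lam = 0 then Some 0 else None))"

definition canon_height :: "nat \<Rightarrow> complex \<Rightarrow> complex \<Rightarrow> real" where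
  "canon_height d lam a = lim (\<lambda>n. height_P1 ((fmap d lam ^^ n) (Some a)) / real d ^ n)"

text \<open>Generic fiber: points of P^1(Qbar(t)) as pairs [P:Q] of polynomials in t, not both 0.
  Homogeneous lift of f_t: [P:Q] |-> [P^d + t Q^d : P Q^(d-1)].\<close>
definition gen_step :: "nat \<Rightarrow> complex poly \<times> complex poly \<Rightarrow> complex poly \<times> complex poly" where
  "gen_step d PQ = (fst PQ ^ d + [:0, 1:] * snd PQ ^ d, fst PQ * snd PQ ^ (d - 1))"

definition rat_deg :: "complex poly \<times> complex poly \<Rightarrow> nat" where
  "rat_deg PQ = (let g = gcd (fst PQ) (snd PQ) in
     max (degree (fst PQ div g)) (degree (snd PQ div g)))"

definition generic_canon_height :: "nat \<Rightarrow> complex \<Rightarrow> real" where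
  "generic_canon_height d a = lim (\<lambda>n. real (rat_deg ((gen_step d ^^ n) ([:a:], 1))) / real d ^ n)"

definition simple_ext :: "complex \<Rightarrow> complex set" where
  "simple_ext a = {poly p a / poly q a | p q. (\<forall>i. coeff p i \<in> \<rat>) \<and> (\<forall>i. coeff q i \<in> \<rat>)
                     \<and> poly q a \<noteq> 0}"

text \<open>Non-archimedean absolute values on K (values outside K are irrelevant).\<close>
definition nonarch_abs :: "complex set \<Rightarrow> (complex \<Rightarrow> real) \<Rightarrow> bool" where
  "nonarch_abs K v \<longleftrightarrow>
     (\<forall>x\<in>K. v x \<ge> 0 \<and> (v x = 0 \<longleftrightarrow> x = 0)) \<and>
     (\<forall>x\<in>K. \<forall>y\<in>K. v (x * y) = v x * v y) \<and>
     (\<forall>x\<in>K. \<forall>y\<in>K. v (x + y) \<le> max (v x) (v y)) \<and>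
     (\<exists>x\<in>K. x \<noteq> 0 \<and> v x \<noteq> 1)"

definition abs_equiv :: "complex set \<Rightarrow> ((complex \<Rightarrow> real) \<times> (complex \<Rightarrow> real)) set" where
  "abs_equiv K = {(v, w). \<exists>c>0. \<forall>x\<in>K. w x = v x powr c}"

definition num_bad_places :: "complex \<Rightarrow> nat" where
  "num_bad_places a = card ({v. nonarch_abs (simple_ext a) v \<and> v a \<notin> {0, 1}}
                            // abs_equiv (simple_ext a))"

end

theory Submission
  imports Defs
begin

text \<open>
  Write \<open>[A\<^sub>n : B\<^sub>n]\<close> for the homogeneous lift of the \<open>n\<close>-th iterate of \<open>\<alpha>\<close>.  On the generic fibre
  the degrees give \<open>1/d\<close> as the canonical height of \<open>\<alpha> \<noteq> 0\<close>, so the canonical height at \<open>\<lambda>\<close> has to be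
  compared with \<open>h(\<lambda>)/d\<close>.  For every prime \<open>p\<close> fix one extension of the \<open>p\<close>-adic absolute value to the
  algebraic numbers, and put \<open>\<alpha>\<close> and \<open>\<lambda>\<close> into a field generated by a single \<open>\<theta>\<close>.  By Gauss's lemma
  and the product formula, heights are averages over the conjugates of \<open>\<theta>\<close> of sums of
  \<open>log max(\<bar>A\<^sub>n\<bar>, \<bar>B\<^sub>n\<bar>)\<close> over the places \<open>p \<le> \<infinity>\<close>, and only finitely many places contribute,
  independently of \<open>n\<close>.  At each place the limit of \<open>log max(\<bar>A\<^sub>n\<bar>, \<bar>B\<^sub>n\<bar>) / d\<^sup>n\<close> differs from
  \<open>log max(1, \<bar>\<lambda>\<bar>) / d\<close> by at most \<open>d \<cdot> \<bar>log \<bar>\<alpha>\<bar>\<bar>\<close>, plus \<open>3 log 2\<close> at the archimedean place.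
  Summing the local errors gives \<open>3 log 2 + 2 d h(\<alpha>)\<close>.
\<close>

section \<open>Integer polynomials and conjugates\<close>

text \<open>The error must not depend on \<lambda>, and this shapes the local estimate: following
  max(|A_n|, |B_n|) directly loses a power of |\<lambda>|. Write L = |\<lambda>| and r = |\<alpha>|
  at one place. If L is at most a constant times max(r, 1/r)^d, then log L is itself controlled by d
  |log r| and the loss is affordable. If L is larger and d >= 3, the first iterate already lies in
  the basin of infinity, and from there on only constants are lost. For d = 2 the loss vanishes. The
  factor 1/d appears because \<lambda> enters with the first iterate, after which only d^(n-1) of
  the growth d^n remains; for the same reason the generic degrees are d^(n-1). The local errors d
  |log r| add up because |log r| = 2 log max(1, r) - log r, where the product formula removes the
  last term and the other one gives 2 h(\<alpha>). All of this takes logarithms of |\<alpha>| and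
  |\<lambda>|, so the values 0 are treated separately. Strictness comes from log 2 < 1.\<close>

abbreviation cpoly :: "int poly \<Rightarrow> complex poly" where
  "cpoly \<equiv> map_poly of_int"

text \<open>Rationality is a predicate on complex polynomials, so that evaluation at conjugates
  needs no change of coefficient ring.\<close>

definition rat_poly :: "complex poly \<Rightarrow> bool" where
  "rat_poly p \<longleftrightarrow> (\<forall>i. coeff p i \<in> \<rat>)"


lemma cpoly_mult: "cpoly (p * q) = cpoly p * cpoly q"
  by (rule poly_eqI) (simp add: coeff_map_poly coeff_mult)

lemma cpoly_add: "cpoly (p + q) = cpoly p + cpoly q"
  by (rule poly_eqI) (simp add: coeff_map_poly)

lemma cpoly_smult: "cpoly (smult c p) = smult (of_int c) (cpoly p)"
  by (rule poly_eqI) (simp add: coeff_map_poly)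

lemma cpoly_pderiv: "cpoly (pderiv p) = pderiv (cpoly p)"
  by (rule poly_eqI) (simp add: coeff_map_poly coeff_pderiv)

lemma cpoly_prod_mset: "cpoly (prod_mset A) = prod_mset (image_mset cpoly A)"
  by (induction A) (simp_all add: cpoly_mult)

lemma degree_cpoly [simp]: "degree (cpoly p) = degree p"
  by (rule degree_map_poly) simp

lemma cpoly_eq_0_iff [simp]: "cpoly p = 0 \<longleftrightarrow> p = 0"
  by (simp add: map_poly_eq_0_iff)

lemma rat_poly_cpoly [simp]: "rat_poly (cpoly p)"
  by (simp add: rat_poly_def coeff_map_poly)

lemma rat_poly_pCons [simp]: "rat_poly (pCons a p) \<longleftrightarrow> a \<in> \<rat> \<and> rat_poly p"
  by (auto simp: rat_poly_def coeff_pCons split: nat.splits)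

lemma rat_poly_0 [simp]: "rat_poly 0"
  and rat_poly_1 [simp]: "rat_poly 1"
  by (simp_all add: rat_poly_def coeff_1)

lemma rat_poly_add [intro]: "rat_poly p \<Longrightarrow> rat_poly q \<Longrightarrow> rat_poly (p + q)"
  and rat_poly_diff [intro]: "rat_poly p \<Longrightarrow> rat_poly q \<Longrightarrow> rat_poly (p - q)"
  and rat_poly_mult [intro]: "rat_poly p \<Longrightarrow> rat_poly q \<Longrightarrow> rat_poly (p * q)"
  and rat_poly_smult [intro]: "c \<in> \<rat> \<Longrightarrow> rat_poly p \<Longrightarrow> rat_poly (smult c p)"
  by (auto simp: rat_poly_def coeff_mult intro!: Rats_sum)

lemma rat_poly_power [intro]: "rat_poly p \<Longrightarrow> rat_poly (p ^ n)"
  by (induction n) auto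

lemma rat_poly_pcompose [intro]: "rat_poly p \<Longrightarrow> rat_poly q \<Longrightarrow> rat_poly (pcompose p q)"
  by (induction p) (auto simp: pcompose_pCons)

lemma rat_poly_pderiv [intro]: "rat_poly p \<Longrightarrow> rat_poly (pderiv p)"
  by (auto simp: rat_poly_def coeff_pderiv)

lemma rat_poly_clear_denominators:
  assumes "rat_poly p"
  obtains c :: int and q where "c \<noteq> 0" "cpoly q = smult (of_int c) p"
proof -
  have "rat_poly p \<Longrightarrow> \<exists>c q. (c::int) \<noteq> 0 \<and> cpoly q = smult (of_int c) p"
  proof (induction p)
    case 0
    then show ?case by (intro exI[of _ 1] exI[of _ 0]) simp
  next
    case (pCons a p)
    then obtain c q where c: "c \<noteq> 0" "cpoly q = smult (of_int c) p" by auto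
    from pCons have "a \<in> \<rat>" by simp
    then obtain m n where a: "n \<noteq> 0" "a = of_int m / of_int n"
      by (elim Rats_cases') (metis of_int_0 less_irrefl)
    show ?case
      using a c by (intro exI[of _ "c * n"] exI[of _ "pCons (c * m) (smult n q)"])
        (simp add: map_poly_pCons cpoly_smult mult.commute)
  qed
  then show ?thesis using assms that by blast
qed

lemma algebraic_iff_rat_poly: "algebraic x \<longleftrightarrow> (\<exists>p. rat_poly p \<and> p \<noteq> 0 \<and> poly p x = 0)"
  by (simp add: algebraic_altdef rat_poly_def)

text \<open>Gauss's lemma is bypassed: by pseudo-division, an integer polynomial of least degree vanishing
  at \<open>x\<close> divides every other such polynomial up to an integer factor.\<close>
lemma irreducible_dvd_of_common_root:
  fixes P :: "int poly" and x :: complex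
  assumes P: "irreducible P" "degree P > 0" "poly (cpoly P) x = 0" and D: "poly (cpoly D) x = 0"
  shows "P dvd D"
proof -
  have prime: "prime_elem P" using P by (simp add: irreducible_imp_prime_elem)
  have P0: "P \<noteq> 0" using P by auto
  have not_dvd_const: "\<not> P dvd [:a:]" if "a \<noteq> 0" for a
    using P that by (auto dest!: dvd_imp_degree_le)
  define C where "C = arg_min degree (\<lambda>C. C \<noteq> 0 \<and> poly (cpoly C) x = 0)"
  have C: "C \<noteq> 0" "poly (cpoly C) x = 0"
    using arg_min_natI[of "\<lambda>C. C \<noteq> 0 \<and> poly (cpoly C) x = 0" P degree] P P0
    by (auto simp: C_def)
  have min: "degree C \<le> degree D" if "D \<noteq> 0" "poly (cpoly D) x = 0" for D
    using arg_min_nat_le[of "\<lambda>C. C \<noteq> 0 \<and> poly (cpoly C) x = 0" D degree] that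
    by (auto simp: C_def)
  have deg_C: "degree C > 0"
  proof (rule ccontr)
    assume "\<not> degree C > 0"
    then obtain c where "C = [:c:]" using degree_eq_zeroE by blast
    then show False using C by (simp add: map_poly_pCons)
  qed
  have ex: "\<exists>a Q. a \<noteq> 0 \<and> smult a D = C * Q" if "poly (cpoly D) x = 0" for D
  proof -
    obtain a q where aq: "a \<noteq> 0" "smult a D = C * q + pseudo_mod D C"
      using pseudo_mod(1)[OF C(1)] by blast
    have "poly (cpoly (smult a D)) x = 0" by (simp add: cpoly_smult that)
    then have "poly (cpoly (pseudo_mod D C)) x = 0"
      unfolding aq by (simp add: cpoly_add cpoly_mult C)
    then have "pseudo_mod D C = 0"
      using min[of "pseudo_mod D C"] pseudo_mod(2)[OF C(1), of D] by linarith
    then show ?thesis using aq by auto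
  qed
  have "P dvd C"
  proof -
    obtain a Q where aQ: "a \<noteq> 0" "smult a P = C * Q" using ex[OF P(3)] by blast
    have "P dvd C * Q" by (metis aQ(2) dvd_refl dvd_smult)
    then consider "P dvd C" | "P dvd Q" using prime prime_elem_dvd_mult_iff by blast
    then show ?thesis
    proof cases
      \<comment> \<open>If \<open>P\<close> divided the cofactor \<open>Q\<close>, cancelling
        \<open>P\<close> would make \<open>C\<close> a divisor of the nonzero constant
        \<open>a\<close>.\<close>
      case 2
      then obtain R where "Q = P * R" by blast
      then have "P * [:a:] = P * (C * R)" using aQ by (simp add: ac_simps)
      then have "[:a:] = C * R" using P0 by (metis mult_left_cancel)
      then have "degree C \<le> degree [:a:]"
        using aQ(1) by (metis dvd_imp_degree_le dvd_triv_left pCons_eq_0_iff)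
      then show ?thesis using deg_C by simp
    qed
  qed
  obtain a Q where aQ: "a \<noteq> 0" "smult a D = C * Q" using ex[OF D] by blast
  then have "P dvd [:a:] * D" using \<open>P dvd C\<close> by simp
  then show ?thesis using prime not_dvd_const[OF aQ(1)] prime_elem_dvd_mult_iff by blast
qed

text \<open>This takes the place of Galois automorphisms: rational relations cannot distinguish the
  roots of an irreducible polynomial. Clearing denominators reduces it to divisibility by
  \<open>P\<close>.\<close>

lemma irreducible_root_transfer:
  assumes P: "irreducible P" "degree P > 0" "poly (cpoly P) x = 0"
    and C: "rat_poly C" "poly C x = 0" and y: "poly (cpoly P) y = 0"
  shows "poly C y = 0"
proof -
  obtain c D where cD: "c \<noteq> 0" "cpoly D = smult (of_int c) C"
    using rat_poly_clear_denominators C by blast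
  have "P dvd D" by (rule irreducible_dvd_of_common_root[OF P]) (simp add: cD C)
  then obtain Q where "D = P * Q" by blast
  then have "poly (cpoly D) y = 0" by (simp add: cpoly_mult y)
  then show ?thesis using cD by simp
qed

text \<open>A common root of \<open>P\<close> and its derivative would make \<open>P\<close> divide
  a nonzero polynomial of smaller degree.\<close>

lemma irreducible_rsquarefree:
  assumes P: "irreducible P" "degree P > 0"
  shows "rsquarefree (cpoly P)"
  unfolding rsquarefree_roots
proof clarify
  fix y
  assume y: "poly (cpoly P) y = 0" "poly (pderiv (cpoly P)) y = 0"
  have "P dvd pderiv P"
    by (rule irreducible_dvd_of_common_root[OF P y(1)]) (simp add: cpoly_pderiv y)
  moreover have "pderiv P \<noteq> 0" using P by (simp add: pderiv_eq_0_iff)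
  ultimately show False
    using P by (auto dest!: dvd_imp_degree_le simp: degree_pderiv)
qed

text \<open>The choice in \<open>min_int_poly\<close> is legitimate because some prime factor of any
  annihilating integer polynomial vanishes at \<open>x\<close>.\<close>

lemma min_int_poly:
  assumes "algebraic x"
  shows "irreducible (min_int_poly x)" "degree (min_int_poly x) > 0"
    "poly (cpoly (min_int_poly x)) x = 0"
proof -
  obtain p where p: "p \<noteq> 0" "poly (cpoly p) x = 0" using algebraicE'[OF assms] by blast
  have "\<exists>q. q \<in># prime_factorization p \<and> poly (cpoly q) x = 0"
  proof -
    \<comment> \<open>The prime factors multiply to \<open>p\<close> only up to a unit, so the root
      is carried through \<open>normalize\<close>.\<close>
    have "poly (cpoly (normalize p)) x = 0"
    proof -
      have "p dvd normalize p" by simp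
      then obtain r where "normalize p = p * r" by blast
      then show ?thesis by (simp add: cpoly_mult p)
    qed
    moreover have "normalize p = normalize (prod_mset (prime_factorization p))"
      using prod_mset_prime_factorization_weak[OF p(1)] by simp
    moreover have "normalize (prod_mset (prime_factorization p)) dvd prod_mset (prime_factorization p)"
      by simp
    ultimately have "poly (cpoly (prod_mset (prime_factorization p))) x = 0"
      by (metis cpoly_mult dvd_def mult_zero_left poly_mult)
    then show ?thesis
      by (simp add: cpoly_prod_mset poly_prod_mset image_mset.compositionality o_def) auto
  qed
  then obtain q where q: "q \<in># prime_factorization p" "poly (cpoly q) x = 0" by blast
  then have "irreducible q" using in_prime_factors_imp_prime prime_elem_imp_irreducible by blast
  moreover have "degree q > 0"
  proof (rule ccontr)
    assume "\<not> degree q > 0"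
    then obtain c where "q = [:c:]" using degree_eq_zeroE by blast
    then have "q = 0" using q by (simp add: map_poly_pCons)
    then show False using \<open>irreducible q\<close> by simp
  qed
  ultimately have "\<exists>p. irreducible p \<and> degree p > 0 \<and> poly (cpoly p) x = 0" using q by blast
  from someI_ex[OF this] show "irreducible (min_int_poly x)" "degree (min_int_poly x) > 0"
    "poly (cpoly (min_int_poly x)) x = 0"
    unfolding min_int_poly_def by auto
qed

text \<open>A set without multiplicities is enough, as the roots are simple.\<close>

definition conjs :: "complex \<Rightarrow> complex set" where
  "conjs x = {y. poly (cpoly (min_int_poly x)) y = 0}"

lemma
  assumes "algebraic x"
  shows finite_conjs: "finite (conjs x)"
    and conjs_self: "x \<in> conjs x"
    and algebraic_conjs: "y \<in> conjs x \<Longrightarrow> algebraic y"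
    and conjs_transfer: "\<lbrakk>rat_poly C; poly C x = 0; y \<in> conjs x\<rbrakk> \<Longrightarrow> poly C y = 0"
    and conjs_transfer': "\<lbrakk>rat_poly C; poly C y = 0; y \<in> conjs x; z \<in> conjs x\<rbrakk> \<Longrightarrow> poly C z = 0"
    and min_int_poly_conjs:
      "cpoly (min_int_poly x) = smult (of_int (lead_coeff (min_int_poly x))) (\<Prod>y\<in>conjs x. [:- y, 1:])"
    and card_conjs: "card (conjs x) = degree (min_int_poly x)"
    and card_conjs_pos: "card (conjs x) > 0"
proof -
  note m = min_int_poly[OF assms]
  have nz: "min_int_poly x \<noteq> 0" using m by auto
  show fin: "finite (conjs x)" unfolding conjs_def by (rule poly_roots_finite) (simp add: nz)
  show "x \<in> conjs x" using m by (simp add: conjs_def)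
  show "algebraic y" if "y \<in> conjs x"
    unfolding algebraic_iff_rat_poly using that nz
    by (intro exI[of _ "cpoly (min_int_poly x)"]) (simp add: conjs_def)
  show tr: "poly C z = 0" if "rat_poly C" "poly C y = 0" "y \<in> conjs x" "z \<in> conjs x" for C y z
    by (rule irreducible_root_transfer[OF m(1,2), of y]) (use that in \<open>auto simp: conjs_def\<close>)
  then show "poly C y = 0" if "rat_poly C" "poly C x = 0" "y \<in> conjs x"
    using that \<open>x \<in> conjs x\<close> by blast
  show dec: "cpoly (min_int_poly x) = smult (of_int (lead_coeff (min_int_poly x))) (\<Prod>y\<in>conjs x. [:- y, 1:])"
    using complex_poly_decompose_rsquarefree[OF irreducible_rsquarefree[OF m(1,2)]]
    by (simp add: conjs_def coeff_map_poly)
  have "degree (min_int_poly x) = degree (cpoly (min_int_poly x))" by simp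
  also have "\<dots> = card (conjs x)"
    using nz by (subst dec) (simp add: degree_prod_sum_eq)
  finally show "card (conjs x) = degree (min_int_poly x)" by simp
  then show "card (conjs x) > 0" using m by simp
qed

section \<open>Power sums and primitive elements\<close>

lemma poly_as_sum_atMost:
  fixes p :: "'a::comm_semiring_1 poly"
  assumes "degree p \<le> n"
  shows "poly p x = (\<Sum>i\<le>n. coeff p i * x ^ i)"
  using assms unfolding poly_altdef by (intro sum.mono_neutral_left) (auto simp: coeff_eq_0)

text \<open>These are Horner's partial sums. The range is padded to a common bound \<open>n\<close>,
  so that the formula can be summed over all roots \<open>c\<close> of one polynomial and turned
  into power sums.\<close>

lemma coeff_synthetic_div:
  fixes p :: "'a::comm_semiring_1 poly"
  assumes "degree p \<le> n"
  shows "coeff (synthetic_div p c) k = (\<Sum>j\<le>n. coeff p (Suc k + j) * c ^ j)"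
  using assms
proof (induction p arbitrary: k n)
  case 0
  then show ?case by simp
next
  case (pCons a p)
  show ?case
  proof (cases "p = 0")
    case True
    then show ?thesis by (simp add: coeff_pCons split: nat.splits)
  next
    case False
    then have p: "degree p \<le> n" using pCons.prems by simp
    show ?thesis
    proof (cases k)
      case 0
      then show ?thesis by (simp add: coeff_pCons poly_as_sum_atMost[OF p])
    next
      case (Suc k')
      then show ?thesis using pCons.IH[OF p] by (simp add: coeff_pCons)
    qed
  qed
qed

text \<open>An indexed family instead of a set: expressions such as u + v over pairs of conjugates
  may take a value several times.\<close>

locale root_family =
  fixes I :: "'i set" and t :: "'i \<Rightarrow> complex"
  assumes fin: "finite I"
begin

definition "F = (\<Prod>i\<in>I. [:- t i, 1:])"
definition "Q i = (\<Prod>j\<in>I - {i}. [:- t j, 1:])"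
definition "psum k = (\<Sum>i\<in>I. t i ^ k)"

lemma degree_F: "degree F = card I"
  by (simp add: F_def degree_prod_sum_eq)

lemma coeff_F_top: "coeff F (card I) = 1"
  using lead_coeff_prod[of "\<lambda>i. [:- t i, 1:]" I] by (simp add: degree_F flip: F_def)

lemma F_nonzero: "F \<noteq> 0"
  using coeff_F_top by auto

lemma poly_F_root [simp]: "i \<in> I \<Longrightarrow> poly F (t i) = 0"
  unfolding F_def poly_prod by (rule prod_zero) (auto simp: fin)

lemma F_factor: "i \<in> I \<Longrightarrow> F = [:- t i, 1:] * Q i"
  by (simp add: F_def Q_def fin prod.remove)

lemma Q_eq: assumes "i \<in> I" shows "Q i = synthetic_div F (t i)"
proof -
  have "F + smult (t i) (Q i) = pCons 0 (Q i)"
    by (subst F_factor[OF assms]) simp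
  then show ?thesis using synthetic_div_unique by blast
qed

lemma coeff_Q: "i \<in> I \<Longrightarrow> coeff (Q i) k = (\<Sum>j\<le>card I. coeff F (Suc k + j) * t i ^ j)"
  unfolding Q_eq by (rule coeff_synthetic_div) (simp add: degree_F)

lemma pderiv_F: "pderiv F = (\<Sum>i\<in>I. Q i)"
  unfolding F_def Q_def pderiv_prod by (simp add: pderiv_pCons)

text \<open>Newton's identities: for \<open>r > 0\<close> compare the coefficients of degree
  \<open>r - 1\<close> in F' = sum of the \<open>Q i\<close>, and for \<open>r = 0\<close> add up
  the equations F(t i) = 0.\<close>

lemma newton: "of_nat r * coeff F r = (\<Sum>j\<le>card I. coeff F (r + j) * psum j)"
proof (cases r)
  case 0
  have "(\<Sum>j\<le>card I. coeff F j * psum j) = (\<Sum>i\<in>I. poly F (t i))"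
    unfolding psum_def sum_distrib_left by (subst sum.swap) (simp add: poly_altdef degree_F)
  then show ?thesis using 0 by simp
next
  case (Suc k)
  have "of_nat r * coeff F r = coeff (pderiv F) k" by (simp add: coeff_pderiv Suc)
  also have "\<dots> = (\<Sum>i\<in>I. \<Sum>j\<le>card I. coeff F (r + j) * t i ^ j)"
    by (simp add: pderiv_F coeff_sum coeff_Q Suc)
  also have "\<dots> = (\<Sum>j\<le>card I. coeff F (r + j) * psum j)"
    unfolding psum_def sum_distrib_left by (rule sum.swap)
  finally show ?thesis .
qed

text \<open>Since \<open>psum 0\<close> is the number of roots, Newton's identity for
  \<open>r\<close> determines \<open>coeff F r\<close> up to the factor \<open>r - card I\<close>.
  This is nonzero below the top degree, so the coefficients are found downwards from the leading
  one.\<close>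

lemma rat_poly_F:
  assumes "\<And>k. psum k \<in> \<rat>"
  shows "rat_poly F"
proof -
  have "coeff F (card I - k) \<in> \<rat>" if "k \<le> card I" for k
    using that
  proof (induction k rule: less_induct)
    case (less k)
    show ?case
    proof (cases "k = 0")
      case True
      then show ?thesis by (simp add: coeff_F_top)
    next
      case False
      define r where "r = card I - k"
      have r: "of_nat r \<noteq> (of_nat (card I) :: complex)" using False less.prems by (simp add: r_def)
      have *: "coeff F (r + Suc j) \<in> \<rat>" for j
      proof (cases "r + Suc j \<le> card I")
        case True
        then have "card I - (card I - (r + Suc j)) = r + Suc j" by simp
        then show ?thesis
          using less.IH[of "card I - (r + Suc j)"] less.prems False True by (simp add: r_def)
      next
        case False
        then show ?thesis by (simp add: coeff_eq_0 degree_F)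
      qed
      have "of_nat r * coeff F r = coeff F r * psum 0 + (\<Sum>j<card I. coeff F (r + Suc j) * psum (Suc j))"
        by (subst newton) (simp add: sum.atMost_shift)
      then have "(of_nat r - of_nat (card I)) * coeff F r = (\<Sum>j<card I. coeff F (r + Suc j) * psum (Suc j))"
        by (simp add: psum_def algebra_simps)
      then have "coeff F r = (\<Sum>j<card I. coeff F (r + Suc j) * psum (Suc j)) / (of_nat r - of_nat (card I))"
        using r by (simp add: field_simps)
      then show ?thesis unfolding r_def[symmetric]
        using * assms by (auto intro!: Rats_sum Rats_divide Rats_mult Rats_diff)
    qed
  qed
  then have "coeff F k \<in> \<rat>" if "k \<le> card I" for k
    using that by (metis diff_diff_cancel diff_le_self)
  then show ?thesis
    unfolding rat_poly_def by (metis Rats_0 coeff_eq_0 degree_F not_le)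
qed

text \<open>For \<open>k \<le> card I\<close> Newton's identity at \<open>card I - k\<close>
  contains \<open>psum k\<close> with the leading coefficient 1; for larger \<open>k\<close> the
  equations F(t i) = 0 are multiplied by powers of the roots and summed.\<close>

lemma psum_rat:
  assumes "rat_poly F"
  shows "psum k \<in> \<rat>"
proof (induction k rule: less_induct)
  case (less k)
  have co: "coeff F i \<in> \<rat>" for i using assms by (simp add: rat_poly_def)
  show ?case
  proof (cases "k \<le> card I")
    case True
    define r where "r = card I - k"
    have "of_nat r * coeff F r = (\<Sum>j\<le>card I. coeff F (r + j) * psum j)" by (rule newton)
    also have "\<dots> = (\<Sum>j\<le>k. coeff F (r + j) * psum j)"
      by (rule sum.mono_neutral_right) (use True in \<open>auto simp: r_def coeff_eq_0 degree_F\<close>)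
    also have "\<dots> = psum k + (\<Sum>j<k. coeff F (r + j) * psum j)"
      using True by (simp add: r_def coeff_F_top flip: lessThan_Suc_atMost)
    finally have "psum k = of_nat r * coeff F r - (\<Sum>j<k. coeff F (r + j) * psum j)" by simp
    then show ?thesis using less co by (auto intro!: Rats_sum Rats_diff Rats_mult)
  next
    case False
    have "0 = (\<Sum>i\<in>I. t i ^ (k - card I) * poly F (t i))" by simp
    also have "\<dots> = (\<Sum>j\<le>card I. coeff F j * psum (k - card I + j))"
      unfolding psum_def sum_distrib_left poly_altdef degree_F
      by (subst sum.swap) (simp add: power_add mult_ac)
    also have "\<dots> = psum k + (\<Sum>j<card I. coeff F j * psum (k - card I + j))"
      using False by (simp add: coeff_F_top flip: lessThan_Suc_atMost)
    finally have "psum k = - (\<Sum>j<card I. coeff F j * psum (k - card I + j))"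
      by (simp add: eq_neg_iff_add_eq_0)
    moreover have "(\<Sum>j<card I. coeff F j * psum (k - card I + j)) \<in> \<rat>"
      using less False co by (auto intro!: Rats_sum Rats_mult)
    ultimately show ?thesis by simp
  qed
qed

text \<open>This is the numerator in Lagrange interpolation of the values \<open>w i\<close>. The
  weights enter its coefficients only through weighted power sums.\<close>

lemma rat_poly_weighted_Q:
  assumes "rat_poly F" and w: "\<And>k. (\<Sum>i\<in>I. w i * t i ^ k) \<in> \<rat>"
  shows "rat_poly (\<Sum>i\<in>I. smult (w i) (Q i))"
  unfolding rat_poly_def
proof
  fix k
  have "coeff (\<Sum>i\<in>I. smult (w i) (Q i)) k
      = (\<Sum>i\<in>I. \<Sum>j\<le>card I. coeff F (Suc k + j) * (w i * t i ^ j))"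
    by (simp add: coeff_sum coeff_Q sum_distrib_left mult_ac)
  also have "\<dots> = (\<Sum>j\<le>card I. coeff F (Suc k + j) * (\<Sum>i\<in>I. w i * t i ^ j))"
    unfolding sum_distrib_left by (rule sum.swap)
  also have "\<dots> \<in> \<rat>"
    using assms(1) by (intro Rats_sum Rats_mult[OF _ w]) (simp add: rat_poly_def)
  finally show "coeff (\<Sum>i\<in>I. smult (w i) (Q i)) k \<in> \<rat>" .
qed

end

section \<open>Symmetric sums over conjugates and the ring of algebraic numbers\<close>

lemma conjs_psum_rat:
  assumes "algebraic x"
  shows "(\<Sum>y\<in>conjs x. y ^ k) \<in> \<rat>"
proof -
  interpret root_family "conjs x" "\<lambda>y. y" by unfold_locales (rule finite_conjs[OF assms])
  have nz: "lead_coeff (min_int_poly x) \<noteq> 0"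
    using min_int_poly[OF assms] by auto
  have "F = smult (inverse (of_int (lead_coeff (min_int_poly x)))) (cpoly (min_int_poly x))"
    using nz by (subst min_int_poly_conjs[OF assms]) (simp add: F_def)
  then have "rat_poly F" by (metis Rats_inverse Rats_of_int rat_poly_cpoly rat_poly_smult)
  then show ?thesis using psum_rat by (simp add: psum_def)
qed

lemma conjs_sum_rat:
  assumes "algebraic x" "rat_poly q"
  shows "(\<Sum>y\<in>conjs x. poly q y) \<in> \<rat>"
proof -
  have "(\<Sum>y\<in>conjs x. poly q y) = (\<Sum>k\<le>degree q. coeff q k * (\<Sum>y\<in>conjs x. y ^ k))"
    unfolding sum_distrib_left poly_altdef by (rule sum.swap)
  also have "\<dots> \<in> \<rat>"
    using assms by (intro Rats_sum Rats_mult conjs_psum_rat) (auto simp: rat_poly_def)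
  finally show ?thesis .
qed

text \<open>The binomial theorem separates u from v. The case \<open>e = 0\<close>,
  \<open>c = 1\<close> gives sums of algebraic numbers; \<open>e = 0\<close> and
  \<open>e = 1\<close> with general \<open>c\<close> give the two rational polynomials behind a
  primitive element.\<close>

lemma conjs_psum2_rat:
  assumes "algebraic x" "algebraic y"
  shows "(\<Sum>(u,v)\<in>conjs x \<times> conjs y. v ^ e * (u + of_nat c * v) ^ k) \<in> \<rat>"
proof -
  have "(\<Sum>(u,v)\<in>conjs x \<times> conjs y. v ^ e * (u + of_nat c * v) ^ k)
     = (\<Sum>u\<in>conjs x. \<Sum>v\<in>conjs y. \<Sum>m\<le>k. of_nat (k choose m) * of_nat c ^ (k - m) * (u ^ m * (v ^ (k - m) * v ^ e)))"
    by (subst sum.cartesian_product[symmetric])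
       (simp add: binomial_ring sum_distrib_left power_mult_distrib power_add mult_ac)
  also have "\<dots> = (\<Sum>u\<in>conjs x. \<Sum>m\<le>k. \<Sum>v\<in>conjs y. of_nat (k choose m) * of_nat c ^ (k - m) * (u ^ m * (v ^ (k - m) * v ^ e)))"
    by (rule sum.cong[OF refl], rule sum.swap)
  also have "\<dots> = (\<Sum>m\<le>k. \<Sum>u\<in>conjs x. \<Sum>v\<in>conjs y. of_nat (k choose m) * of_nat c ^ (k - m) * (u ^ m * (v ^ (k - m) * v ^ e)))"
    by (rule sum.swap)
  also have "\<dots> = (\<Sum>m\<le>k. of_nat (k choose m) * of_nat c ^ (k - m) * ((\<Sum>u\<in>conjs x. u ^ m) * (\<Sum>v\<in>conjs y. (v ^ (k - m) * v ^ e))))"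
    by (simp only: sum_product) (simp only: sum_distrib_left)
  also have "\<dots> \<in> \<rat>"
    using assms conjs_psum_rat[OF assms(2), of "k - m + e" for m, unfolded power_add]
    by (intro Rats_sum[of "{..k}"] Rats_mult conjs_psum_rat Rats_power) auto
  finally show ?thesis .
qed

lemma algebraic_of_psum_rat:
  fixes t :: "'i \<Rightarrow> complex"
  assumes "finite I" "\<And>k. (\<Sum>i\<in>I. t i ^ k) \<in> \<rat>" "i \<in> I"
  shows "algebraic (t i)"
proof -
  interpret root_family I t by unfold_locales (rule assms)
  have "rat_poly F" using assms rat_poly_F by (simp add: psum_def)
  then show ?thesis using F_nonzero poly_F_root[OF assms(3)] algebraic_iff_rat_poly by blast
qed

lemma algebraic_add:
  fixes x y :: complex
  assumes "algebraic x" "algebraic y"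
  shows "algebraic (x + y)"
  using algebraic_of_psum_rat[of "conjs x \<times> conjs y" "\<lambda>(u, v). u + v" "(x, y)"]
    conjs_psum2_rat[OF assms, of 0 1] finite_conjs conjs_self assms
  by (simp add: case_prod_unfold)

lemma algebraic_mult:
  fixes x y :: complex
  assumes "algebraic x" "algebraic y"
  shows "algebraic (x * y)"
proof -
  have "(\<Sum>(u,v)\<in>conjs x \<times> conjs y. (u * v) ^ k) \<in> \<rat>" for k
  proof -
    have "(\<Sum>(u,v)\<in>conjs x \<times> conjs y. (u * v) ^ k) = (\<Sum>u\<in>conjs x. u ^ k) * (\<Sum>v\<in>conjs y. v ^ k)"
      by (simp add: sum_product power_mult_distrib sum.cartesian_product)
    then show ?thesis using assms by (auto intro!: Rats_mult conjs_psum_rat)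
  qed
  then show ?thesis
    using algebraic_of_psum_rat[of "conjs x \<times> conjs y" "\<lambda>(u, v). u * v" "(x, y)"]
      finite_conjs conjs_self assms
    by (simp add: case_prod_unfold)
qed

lemma algebraic_power: "algebraic x \<Longrightarrow> algebraic (x ^ n)" for x :: complex
  by (induction n) (auto intro: algebraic_mult)

lemma algebraic_poly: "rat_poly q \<Longrightarrow> algebraic x \<Longrightarrow> algebraic (poly q x)"
  by (induction q) (auto intro: algebraic_add[OF rat_imp_algebraic algebraic_mult])

text \<open>An annihilating polynomial a + X q(X) with a nonzero gives 1/x = - q(x)/a. The
  convention \<open>inverse 0 = 0\<close> covers \<open>x = 0\<close>.\<close>

lemma inverse_eq_rat_poly:
  assumes "algebraic x"
  obtains q where "rat_poly q" "poly q x = inverse x"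
proof (cases "x = 0")
  case True
  then show ?thesis using that[of 0] by simp
next
  case False
  then obtain p where p: "coeff p 0 \<noteq> 0" "poly (cpoly p) x = 0"
    using algebraicE'_nonzero[OF assms] by metis
  obtain a q where aq: "p = pCons a q" by (cases p)
  then have "of_int a + x * poly (cpoly q) x = 0" using p by (simp add: map_poly_pCons)
  then have "poly (smult (- inverse (of_int a)) (cpoly q)) x = inverse x"
    using p aq False by (simp add: field_simps add_eq_0_iff)
  moreover have "rat_poly (smult (- inverse (of_int a)) (cpoly q))"
    by (intro rat_poly_smult) auto
  ultimately show ?thesis using that by blast
qed

text \<open>With \<open>\<theta> = x + c * y\<close> and the family of all \<open>u + c * v\<close> over conjugates \<open>(u, v)\<close>, the Lagrange-type
  polynomial \<open>G\<close> below satisfies \<open>y = G \<theta> / F' \<theta>\<close>.\<close>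
lemma primitive_element:
  assumes "algebraic x" "algebraic y"
  obtains \<theta> p q where "algebraic \<theta>" "rat_poly p" "rat_poly q" "x = poly p \<theta>" "y = poly q \<theta>"
proof -
  define I where "I = conjs x \<times> conjs y"
  have finI: "finite I" using finite_conjs assms by (simp add: I_def)
  \<comment> \<open>The values of c to be avoided: u + c v = u' + c v' with v and v' distinct forces
    this quotient. Pairs with v = v' only contribute the value 0.\<close>
  define B where "B = (\<lambda>((u, v), (u', v')). (u - u') / (v' - v)) ` (I \<times> I)"
  have "finite B" unfolding B_def using finI by simp
  moreover have "infinite (range (of_nat :: nat \<Rightarrow> complex))"
    using finite_imageD inj_of_nat by blast
  ultimately obtain c :: nat where c: "of_nat c \<notin> B"
    by (meson finite_subset image_subset_iff)
  define t where "t = (\<lambda>(u, v). u + of_nat c * v :: complex)"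
  have inj: "i = j" if "i \<in> I" "j \<in> I" "t i = t j" for i j
  proof (rule ccontr)
    assume "i \<noteq> j"
    obtain u v u' v' where ij: "i = (u, v)" "j = (u', v')" by fastforce
    have eq: "u - u' = of_nat c * (v' - v)" using that by (simp add: ij t_def algebra_simps)
    with \<open>i \<noteq> j\<close> have "v' - v \<noteq> 0" by (auto simp: ij)
    then have "of_nat c = (u - u') / (v' - v)" by (simp add: eq)
    also have "\<dots> \<in> B" unfolding B_def using that by (force simp: ij)
    finally show False using c by blast
  qed
  interpret root_family I t by unfold_locales (rule finI)
  have F: "rat_poly F"
    using conjs_psum2_rat[OF assms, of 0 c]
    by (intro rat_poly_F) (unfold psum_def, simp add: I_def t_def case_prod_unfold)
  define G where "G = (\<Sum>i\<in>I. smult (snd i) (Q i))"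
  have G: "rat_poly G" unfolding G_def
    using conjs_psum2_rat[OF assms, of 1 c]
    by (intro rat_poly_weighted_Q F) (simp add: I_def t_def case_prod_unfold)
  define \<theta> where "\<theta> = t (x, y)"
  have xy: "(x, y) \<in> I" using conjs_self assms by (simp add: I_def)
  have \<theta>: "algebraic \<theta>"
    using F F_nonzero poly_F_root[OF xy] algebraic_iff_rat_poly unfolding \<theta>_def by blast
  \<comment> \<open>At \<theta> every \<open>Q i\<close> but the one belonging to (x, y) has a
    vanishing factor, so F' and G each reduce to a single term.\<close>
  have Q0: "poly (Q i) \<theta> = 0" if "i \<in> I" "i \<noteq> (x, y)" for i
    unfolding Q_def poly_prod \<theta>_def using that xy finI by (intro prod_zero) auto
  have Q1: "poly (Q (x, y)) \<theta> \<noteq> 0"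
    unfolding Q_def poly_prod \<theta>_def using inj[OF xy] finI by (auto simp: prod_zero_iff)
  have "poly (pderiv F) \<theta> = poly (Q (x, y)) \<theta>"
    unfolding pderiv_F poly_sum using xy finI Q0 by (subst sum.remove[of _ "(x, y)"]) auto
  moreover have "poly G \<theta> = y * poly (Q (x, y)) \<theta>"
    unfolding G_def poly_sum using xy finI Q0 by (subst sum.remove[of _ "(x, y)"]) auto
  ultimately have y_eq: "y = poly G \<theta> * inverse (poly (pderiv F) \<theta>)" using Q1 by simp
  obtain r where r: "rat_poly r" "poly r (poly (pderiv F) \<theta>) = inverse (poly (pderiv F) \<theta>)"
    using inverse_eq_rat_poly algebraic_poly[OF rat_poly_pderiv[OF F] \<theta>] by blast
  define q where "q = G * pcompose r (pderiv F)"
  have "y = poly q \<theta>" using y_eq r by (simp add: q_def poly_pcompose)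
  moreover have "rat_poly q" unfolding q_def using G r F by auto
  moreover have "x = poly ([:0, 1:] - smult (of_nat c) q) \<theta>"
    by (simp add: \<open>y = poly q \<theta>\<close>[symmetric]) (simp add: \<theta>_def t_def)
  moreover have "rat_poly ([:0, 1:] - smult (of_nat c) q)"
    using \<open>rat_poly q\<close> by (intro rat_poly_diff rat_poly_smult) auto
  ultimately show ?thesis using that \<theta> by blast
qed

text \<open>A rational polynomial with a root in \<open>conjs x\<close> has all of \<open>conjs x\<close> as roots, so one copy of
  \<open>conjs x\<close> can be split off the family without losing rationality of the power sums.\<close>
lemma uniform_cover:
  assumes x: "algebraic x" and "finite I" and "\<And>k. (\<Sum>i\<in>I. t i ^ k) \<in> \<rat>" and "t ` I \<subseteq> conjs x"
  shows "\<exists>m::nat. \<forall>\<phi>. (\<Sum>i\<in>I. \<phi> (t i)) = real m * (\<Sum>y\<in>conjs x. \<phi> y)"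
  using assms(2-)
proof (induction "card I" arbitrary: I rule: less_induct)
  case less
  show ?case
  proof (cases "I = {}")
    case True
    then show ?thesis by (intro exI[of _ 0]) simp
  next
    case False
    then obtain i0 where i0: "i0 \<in> I" by blast
    interpret root_family I t by unfold_locales (rule less.prems)
    have F: "rat_poly F" using less.prems rat_poly_F by (simp add: psum_def)
    have "conjs x \<subseteq> t ` I"
    proof
      fix y assume y: "y \<in> conjs x"
      have "poly F y = 0"
        using conjs_transfer'[OF x F poly_F_root[OF i0] _ y] less.prems i0 by blast
      then show "y \<in> t ` I" unfolding F_def poly_prod using fin by (auto simp: prod_zero_iff)
    qed
    \<comment> \<open>\<open>I1\<close> selects one index above each conjugate; this is the copy of
      \<open>conjs x\<close> that is split off.\<close>
    then obtain I1 where I1: "I1 \<subseteq> I" "bij_betw t I1 (conjs x)"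
      unfolding subset_image_inj bij_betw_def by metis
    note sum_I1 = sum.reindex_bij_betw[OF I1(2)]
    have "card I1 > 0" using I1 card_conjs_pos[OF x] bij_betw_same_card by metis
    then have "card (I - I1) < card I"
      using I1(1) fin card_mono[OF fin I1(1)] by (simp add: card_Diff_subset finite_subset)
    moreover have "(\<Sum>i\<in>I - I1. t i ^ k) \<in> \<rat>" for k
      using I1 fin less.prems(2) sum_I1[of "\<lambda>y. y ^ k"] conjs_psum_rat[OF x, of k]
      by (simp add: sum_diff)
    ultimately obtain m where m: "\<And>\<phi>. (\<Sum>i\<in>I - I1. \<phi> (t i)) = real m * (\<Sum>y\<in>conjs x. \<phi> y)"
      using less.hyps[of "I - I1"] less.prems by blast
    have "(\<Sum>i\<in>I. \<phi> (t i)) = real (Suc m) * (\<Sum>y\<in>conjs x. \<phi> y)" for \<phi>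
      using sum.subset_diff[OF I1(1) fin, of "\<lambda>i. \<phi> (t i)"] m[of \<phi>] sum_I1[of \<phi>]
      by (simp add: algebra_simps)
    then show ?thesis by blast
  qed
qed

lemma poly_in_conjs:
  assumes \<theta>: "algebraic \<theta>" and q: "rat_poly q" and t: "t \<in> conjs \<theta>"
  shows "poly q t \<in> conjs (poly q \<theta>)"
proof -
  have "poly (pcompose (cpoly (min_int_poly (poly q \<theta>))) q) t = 0"
    by (rule conjs_transfer[OF \<theta> _ _ t])
      (use q min_int_poly(3)[OF algebraic_poly[OF q \<theta>]] in \<open>auto simp: poly_pcompose\<close>)
  then show ?thesis by (simp add: conjs_def poly_pcompose)
qed

text \<open>Here \<open>m\<close> is the degree of Q(\<theta>) over the field generated by
  \<open>poly q \<theta>\<close>. The quantification over all functions \<phi> allows sums of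
  heights and of logarithms to be moved to the conjugates of the one generator.\<close>

lemma conjs_cover:
  assumes \<theta>: "algebraic \<theta>" and q: "rat_poly q"
  obtains m :: nat where "\<And>\<phi>. (\<Sum>y\<in>conjs \<theta>. \<phi> (poly q y)) = real m * (\<Sum>y\<in>conjs (poly q \<theta>). \<phi> y)"
    "card (conjs \<theta>) = m * degree (min_int_poly (poly q \<theta>))"
proof -
  let ?x = "poly q \<theta>"
  have x: "algebraic ?x" by (rule algebraic_poly[OF q \<theta>])
  have "(\<Sum>y\<in>conjs \<theta>. poly q y ^ k) \<in> \<rat>" for k
    using conjs_sum_rat[OF \<theta> rat_poly_power[OF q, of k]] by simp
  moreover have "poly q ` conjs \<theta> \<subseteq> conjs ?x" using poly_in_conjs[OF \<theta> q] by blast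
  ultimately obtain m where m: "\<And>\<phi>. (\<Sum>y\<in>conjs \<theta>. \<phi> (poly q y)) = real m * (\<Sum>y\<in>conjs ?x. \<phi> y)"
    using uniform_cover[OF x finite_conjs[OF \<theta>], of "poly q"] by blast
  have "real (card (conjs \<theta>)) = real (m * degree (min_int_poly ?x))"
    using m[of "\<lambda>_. 1"] by (simp add: card_conjs[OF x])
  then show ?thesis using that m of_nat_eq_iff by blast
qed

section \<open>Extension of p-adic absolute values\<close>

text \<open>Rounding errors: below, a real exponent is approximated by a/n with an integer a, and
  the error of order 1/n disappears in the limit.\<close>

lemma
  assumes "n > 0"
  shows floor_plus_1_div_le: "real_of_int (\<lfloor>real n * s\<rfloor> + 1) / real n \<le> s + 1 / real n"
    and floor_plus_1_add_div_le:
      "real_of_int (\<lfloor>real n * s\<rfloor> + 1 + (\<lfloor>real n * t\<rfloor> + 1)) / real n \<le> s + t + 2 / real n"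
    and minus_ceiling_minus_1_div_le:
      "real_of_int (- (\<lceil>real n * s\<rceil> - 1)) / real n \<le> - s + 1 / real n"
proof -
  have le: "a / real n \<le> b" if "a \<le> b * real n" for a b
    using that assms by (simp add: divide_le_eq)
  have "real_of_int (\<lfloor>u\<rfloor> + 1) \<le> u + 1" "real_of_int (\<lfloor>u\<rfloor> + 1 + (\<lfloor>v\<rfloor> + 1)) \<le> u + v + 2"
    "real_of_int (- (\<lceil>u\<rceil> - 1)) \<le> - u + 1" for u v :: real
    by linarith+
  note * = this(1)[of "real n * s"] this(2)[of "real n * s" "real n * t"] this(3)[of "real n * s"]
  show "real_of_int (\<lfloor>real n * s\<rfloor> + 1) / real n \<le> s + 1 / real n"
    by (rule le, rule order_trans[OF *(1)]) (use assms in \<open>simp add: algebra_simps\<close>)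
  show "real_of_int (\<lfloor>real n * s\<rfloor> + 1 + (\<lfloor>real n * t\<rfloor> + 1)) / real n \<le> s + t + 2 / real n"
    by (rule le, rule order_trans[OF *(2)]) (use assms in \<open>simp add: algebra_simps\<close>)
  show "real_of_int (- (\<lceil>real n * s\<rceil> - 1)) / real n \<le> - s + 1 / real n"
    by (rule le, rule order_trans[OF *(3)]) (use assms in \<open>simp add: algebra_simps\<close>)
qed

text \<open>An extension of the \<open>p\<close>-adic absolute value to the algebraic numbers comes from a subring of
  the complex numbers that is maximal among those not containing \<open>1 / p\<close>: such a ring is a valuation ring.\<close>
definition subring_avoiding :: "complex \<Rightarrow> complex set \<Rightarrow> bool" where
  "subring_avoiding z R \<longleftrightarrow> 1 \<in> R \<and> (\<forall>x\<in>R. \<forall>y\<in>R. x - y \<in> R \<and> x * y \<in> R) \<and> z \<notin> R"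

locale avoiding_subring =
  fixes p :: nat and R :: "complex set"
  assumes prime_p: "prime p" and R: "subring_avoiding (inverse (of_nat p)) R"
begin

lemma one_R [simp]: "1 \<in> R"
  and diff_R: "x \<in> R \<Longrightarrow> y \<in> R \<Longrightarrow> x - y \<in> R"
  and mult_R: "x \<in> R \<Longrightarrow> y \<in> R \<Longrightarrow> x * y \<in> R"
  and inverse_p_notin: "inverse (of_nat p) \<notin> R"
  using R by (auto simp: subring_avoiding_def)

lemma zero_R [simp]: "0 \<in> R" using diff_R[of 1 1] by simp
lemma minus_R: "x \<in> R \<Longrightarrow> - x \<in> R" using diff_R[of 0 x] by simp
lemma add_R: "x \<in> R \<Longrightarrow> y \<in> R \<Longrightarrow> x + y \<in> R" using diff_R[OF _ minus_R, of x y] by simp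
lemma power_R: "x \<in> R \<Longrightarrow> x ^ n \<in> R" by (induction n) (auto intro: mult_R)
lemma sum_R: "(\<And>i. i \<in> A \<Longrightarrow> f i \<in> R) \<Longrightarrow> (\<Sum>i\<in>A. f i) \<in> R"
  by (induction A rule: infinite_finite_induct) (auto intro: add_R)
lemma of_nat_R: "of_nat n \<in> R" by (induction n) (auto intro: add_R)
lemma of_int_R: "of_int n \<in> R" by (cases n) (auto intro!: of_nat_R minus_R simp del: of_nat_Suc)

lemma p_pos: "p > 0" and p_gt_1: "p > 1"
  using prime_p prime_gt_0_nat prime_gt_1_nat by auto

end

text \<open>\<open>n\<close> counts the terms, so the polynomials in \<open>x\<close> have degree
  below \<open>n\<close>. The least \<open>n\<close> for which 1/p occurs measures the degree of a
  relation for 1/p.\<close>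

definition span_powers :: "complex set \<Rightarrow> complex \<Rightarrow> nat \<Rightarrow> complex set" where
  "span_powers R x n = {\<Sum>i<n. a i * x ^ i | a. \<forall>i. a i \<in> R}"

lemma span_powersI: "(\<And>i. a i \<in> R) \<Longrightarrow> (\<Sum>i<n. a i * x ^ i) \<in> span_powers R x n"
  unfolding span_powers_def by blast

section \<open>A maximal subring avoiding 1/p is a valuation ring\<close>

locale maximal_subring = avoiding_subring +
  assumes maximal: "\<And>S. subring_avoiding (inverse (of_nat p)) S \<Longrightarrow> R \<subseteq> S \<Longrightarrow> S = R"
begin

lemma span_add:
  assumes "u \<in> span_powers R x n" "v \<in> span_powers R x n" shows "u + v \<in> span_powers R x n"
proof -
  from assms obtain a b where "u = (\<Sum>i<n. a i * x ^ i)" "\<forall>i. a i \<in> R" "v = (\<Sum>i<n. b i * x ^ i)" "\<forall>i. b i \<in> R"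
    unfolding span_powers_def by blast
  then have "u + v = (\<Sum>i<n. (a i + b i) * x ^ i)" "\<forall>i. a i + b i \<in> R"
    by (auto simp: sum.distrib algebra_simps intro: add_R)
  then show ?thesis by (simp only: span_powersI)
qed

lemma span_scale:
  assumes "u \<in> span_powers R x n" "c \<in> R" shows "c * u \<in> span_powers R x n"
proof -
  from assms obtain a where "u = (\<Sum>i<n. a i * x ^ i)" "\<forall>i. a i \<in> R"
    unfolding span_powers_def by blast
  then have "c * u = (\<Sum>i<n. (c * a i) * x ^ i)" "\<forall>i. c * a i \<in> R"
    by (auto simp: sum_distrib_left mult_ac assms intro: mult_R)
  then show ?thesis by (simp only: span_powersI)
qed

lemma span_mono:
  assumes "u \<in> span_powers R x m" "m \<le> n" shows "u \<in> span_powers R x n"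
proof -
  from assms obtain a where a: "u = (\<Sum>i<m. a i * x ^ i)" "\<forall>i. a i \<in> R"
    unfolding span_powers_def by blast
  define b where "b i = (if i < m then a i else 0)" for i
  have "(\<Sum>i<n. b i * x ^ i) = (\<Sum>i<m. b i * x ^ i)"
    by (rule sum.mono_neutral_right) (use assms in \<open>auto simp: b_def\<close>)
  then have "u = (\<Sum>i<n. b i * x ^ i)" "\<forall>i. b i \<in> R" using a by (auto simp: b_def)
  then show ?thesis unfolding span_powers_def by blast
qed

lemma span_shift:
  assumes "u \<in> span_powers R x m" shows "x ^ k * u \<in> span_powers R x (m + k)"
proof -
  from assms obtain a where a: "u = (\<Sum>i<m. a i * x ^ i)" "\<forall>i. a i \<in> R"
    unfolding span_powers_def by blast
  define b where "b i = (if i < k then 0 else a (i - k))" for i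
  have "(\<Sum>i<m + k. b i * x ^ i) = (\<Sum>i\<in>{k..<m + k}. b i * x ^ i)"
    by (rule sum.mono_neutral_right) (auto simp: b_def)
  also have "\<dots> = (\<Sum>i<m. a i * x ^ (i + k))"
    using sum.shift_bounds_nat_ivl[of "\<lambda>i. b i * x ^ i" 0 k m] by (simp add: b_def atLeast0LessThan)
  finally have "x ^ k * u = (\<Sum>i<m + k. b i * x ^ i)"
    by (simp add: a sum_distrib_left power_add mult_ac)
  moreover have "\<forall>i. b i \<in> R" using a by (auto simp: b_def)
  ultimately show ?thesis unfolding span_powers_def by blast
qed

lemma span_top:
  assumes "u \<in> span_powers R x (Suc n)"
  obtains a v where "a \<in> R" "v \<in> span_powers R x n" "u = a * x ^ n + v"
proof -
  from assms obtain a where a: "u = (\<Sum>i<Suc n. a i * x ^ i)" "\<forall>i. a i \<in> R"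
    unfolding span_powers_def by blast
  then show ?thesis using that[of "a n" "\<Sum>i<n. a i * x ^ i"] unfolding span_powers_def by auto
qed

lemma power_in_span: "i < n \<Longrightarrow> x ^ i \<in> span_powers R x n"
proof -
  assume "i < n"
  then have "x ^ i = (\<Sum>j<n. (if j = i then 1 else 0) * x ^ j)"
    by (simp add: if_distrib[of "\<lambda>c. c * _"] cong: if_cong)
  also have "\<dots> \<in> span_powers R x n" by (rule span_powersI) simp
  finally show ?thesis .
qed

text \<open>The union of the spans is the ring R[x], which is strictly larger than \<open>R\<close>;
  by maximality it must contain 1/p.\<close>

lemma adjoin:
  assumes "x \<notin> R"
  obtains n where "inverse (of_nat p) \<in> span_powers R x n"
proof -
  define S where "S = (\<Union>n. span_powers R x n)"
  have mem: "\<exists>n. \<forall>m\<ge>n. u \<in> span_powers R x m" if "u \<in> S" for u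
    using that span_mono unfolding S_def by blast
  have mult: "u * v \<in> S" if u: "u \<in> span_powers R x n" and v: "v \<in> S" for u v n
  proof -
    from u obtain a where a: "u = (\<Sum>i<n. a i * x ^ i)" "\<forall>i. a i \<in> R"
      unfolding span_powers_def by blast
    obtain m where m: "v \<in> span_powers R x m" using v S_def by blast
    have "(\<Sum>i<k. a i * x ^ i) * v \<in> span_powers R x (m + k)" for k
    proof (induction k)
      case 0
      then show ?case using span_scale[OF m, of 0] by simp
    next
      case (Suc k)
      have "a k * (x ^ k * v) \<in> span_powers R x (m + k)"
        by (rule span_scale[OF span_shift[OF m]]) (use a in auto)
      then show ?case
        using span_mono[OF span_add[OF Suc], of "a k * (x ^ k * v)" "m + Suc k"]
        by (simp add: algebra_simps)
    qed
    then show ?thesis unfolding a S_def by blast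
  qed
  have "inverse (of_nat p) \<in> S"
  proof (rule ccontr)
    assume contra: "inverse (of_nat p) \<notin> S"
    have "subring_avoiding (inverse (of_nat p)) S"
      unfolding subring_avoiding_def
    proof (intro conjI ballI contra)
      show "1 \<in> S" using power_in_span[of 0 1 x] unfolding S_def by auto
      fix u v assume uv: "u \<in> S" "v \<in> S"
      then show "u * v \<in> S" using mult unfolding S_def by blast
      obtain n m where "\<forall>k\<ge>n. u \<in> span_powers R x k" "\<forall>k\<ge>m. v \<in> span_powers R x k"
        using mem uv by metis
      then have "u + (- 1) * v \<in> span_powers R x (max n m)"
        by (intro span_add span_scale minus_R) auto
      then show "u - v \<in> S" unfolding S_def by auto
    qed
    moreover have "R \<subseteq> S"
    proof
      fix r assume "r \<in> R"
      then show "r \<in> S" using span_scale[OF power_in_span[of 0 1 x]] unfolding S_def by fastforce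
    qed
    ultimately have "S = R" by (rule maximal)
    moreover have "x \<in> S" using power_in_span[of 1 2 x] unfolding S_def by auto
    ultimately show False using assms by simp
  qed
  then show ?thesis using that unfolding S_def by blast
qed

text \<open>So p lies in the Jacobson radical of \<open>R\<close>. Let y = 1 - p b. If 1/y were not
  in \<open>R\<close>, then 1/p would lie in R[1/y], and clearing denominators gives y^n = p g. But
  y^n also has the form 1 - p c, whence 1 = p (g + c) and 1/p would be in \<open>R\<close>.\<close>

lemma unit_1_minus_p:
  assumes b: "b \<in> R"
  shows "1 - of_nat p * b \<noteq> 0" "inverse (1 - of_nat p * b) \<in> R"
proof -
  let ?y = "1 - of_nat p * b"
  have key: False if "1 = of_nat p * c" "c \<in> R" for c
  proof -
    have "inverse (of_nat p) = c" using that p_pos by (simp add: field_simps)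
    then show False using that inverse_p_notin by simp
  qed
  show nz: "?y \<noteq> 0" using key[OF _ b] by auto
  show "inverse ?y \<in> R"
  proof (rule ccontr)
    assume "inverse ?y \<notin> R"
    then obtain n where "inverse (of_nat p) \<in> span_powers R (inverse ?y) n" by (rule adjoin)
    then obtain a where a: "inverse (of_nat p) = (\<Sum>i<n. a i * inverse ?y ^ i)" "\<forall>i. a i \<in> R"
      unfolding span_powers_def by blast
    have yR: "?y \<in> R" by (intro diff_R mult_R of_nat_R b) simp
    define g where "g = (\<Sum>i<n. a i * ?y ^ (n - i))"
    have g: "g \<in> R" unfolding g_def using a yR by (intro sum_R mult_R power_R) auto
    have "?y ^ n * inverse (of_nat p) = (\<Sum>i<n. ?y ^ n * (a i * inverse ?y ^ i))"
      by (simp only: a sum_distrib_left)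
    also have "\<dots> = g"
      unfolding g_def
    proof (rule sum.cong[OF refl])
      fix i assume "i \<in> {..<n}"
      then have "?y ^ n = ?y ^ (n - i) * ?y ^ i" by (simp flip: power_add)
      then show "?y ^ n * (a i * inverse ?y ^ i) = a i * ?y ^ (n - i)"
        using nz by (simp add: field_simps)
    qed
    finally have yn: "?y ^ n = of_nat p * g" using p_pos by (simp add: field_simps)
    have "\<exists>c\<in>R. ?y ^ k = 1 - of_nat p * c" for k
    proof (induction k)
      case 0
      show ?case by (rule bexI[of _ 0]) auto
    next
      case (Suc k)
      then obtain c where c: "c \<in> R" "?y ^ k = 1 - of_nat p * c" by blast
      have "?y ^ Suc k = ?y ^ k - of_nat p * (b * ?y ^ k)" by (simp add: algebra_simps)
      also have "\<dots> = (1 - of_nat p * c) - of_nat p * (b * ?y ^ k)"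
        by (rule arg_cong2[of _ _ _ _ "(-)", OF c(2) refl])
      also have "\<dots> = 1 - of_nat p * (c + b * ?y ^ k)"
        by (simp only: distrib_left diff_diff_add)
      finally have "?y ^ Suc k = 1 - of_nat p * (c + b * ?y ^ k)" .
      moreover have "c + b * ?y ^ k \<in> R" using b c yR by (intro add_R mult_R power_R)
      ultimately show ?case by blast
    qed
    then obtain c where "c \<in> R" "?y ^ n = 1 - of_nat p * c" by blast
    then show False using key[of "g + c"] yn g by (simp add: algebra_simps add_R)
  qed
qed

text \<open>The reduction step of Chevalley's extension theorem. Multiplied by x^m, the relation in
  1/x reads (1 - p b_0) x^m = p v with v of degree below m; its left factor is a unit, so x^m / p,
  and then x^n / p, is a combination of lower powers. The top term of the relation in x is a x^n =
  (p a) (x^n / p) and can be replaced.\<close>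

lemma span_reduce:
  assumes x: "x \<noteq> 0" and n: "inverse (of_nat p) \<in> span_powers R x (Suc n)"
    and m: "inverse (of_nat p) \<in> span_powers R (inverse x) (Suc m)" and "m \<le> n"
  shows "inverse (of_nat p) \<in> span_powers R x n"
proof -
  have p0: "of_nat p \<noteq> (0 :: complex)" using p_pos by simp
  from m obtain b where b: "inverse (of_nat p) = (\<Sum>i<Suc m. b i * inverse x ^ i)" "\<forall>i. b i \<in> R"
    unfolding span_powers_def by blast
  define v where "v = (\<Sum>i<m. b (m - i) * x ^ i)"
  have v: "v \<in> span_powers R x m"
    using b(2) unfolding v_def span_powers_def by (intro CollectI exI[of _ "\<lambda>i. b (m - i)"]) auto
  have "x ^ m * inverse (of_nat p) = (\<Sum>i<Suc m. b i * x ^ (m - i))"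
    unfolding b sum_distrib_left
  proof (rule sum.cong[OF refl])
    fix i assume "i \<in> {..<Suc m}"
    then have "x ^ m = x ^ (m - i) * x ^ i" by (simp flip: power_add)
    then show "x ^ m * (b i * inverse x ^ i) = b i * x ^ (m - i)" using x by (simp add: field_simps)
  qed
  also have "\<dots> = (\<Sum>i<Suc m. b (m - i) * x ^ (m - (m - i)))"
    using sum.nat_diff_reindex[of "\<lambda>i. b i * x ^ (m - i)" "Suc m"] by simp
  also have "\<dots> = v + b 0 * x ^ m" unfolding v_def by simp
  finally have "x ^ m = of_nat p * (v + b 0 * x ^ m)" using p0 by (simp add: field_simps)
  then have eq: "(1 - of_nat p * b 0) * x ^ m = of_nat p * v" by (simp add: algebra_simps)
  note u = unit_1_minus_p[of "b 0"]
  have "x ^ m = of_nat p * (inverse (1 - of_nat p * b 0) * v)"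
    using eq u(1) b(2) by (simp add: field_simps)
  then have "x ^ m * inverse (of_nat p) = inverse (1 - of_nat p * b 0) * v" using p0 by simp
  then have "x ^ m * inverse (of_nat p) \<in> span_powers R x m"
    using span_scale[OF v u(2)] b(2) by simp
  then have "x ^ (n - m) * (x ^ m * inverse (of_nat p)) \<in> span_powers R x n"
    using span_shift[of _ x m "n - m"] \<open>m \<le> n\<close> by force
  moreover have "x ^ (n - m) * (x ^ m * inverse (of_nat p)) = x ^ n * inverse (of_nat p)"
    using \<open>m \<le> n\<close> by (simp flip: power_add mult.assoc)
  ultimately have xn: "x ^ n * inverse (of_nat p) \<in> span_powers R x n" by simp
  obtain a w where aw: "a \<in> R" "w \<in> span_powers R x n" "inverse (of_nat p) = a * x ^ n + w"
    using span_top[OF n] by blast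
  have "(of_nat p * a) * (x ^ n * inverse (of_nat p)) + w \<in> span_powers R x n"
    by (intro span_add span_scale xn aw mult_R of_nat_R)
  moreover have "(of_nat p * a) * (x ^ n * inverse (of_nat p)) + w = inverse (of_nat p)"
    using p0 by (subst aw(3)) simp
  ultimately show ?thesis by (simp only:)
qed

text \<open>If neither \<open>x\<close> nor its inverse were in \<open>R\<close>, both would have
  relations for 1/p of least length; \<open>span_reduce\<close> shortens the longer one.\<close>

lemma total: "x \<in> R \<or> inverse x \<in> R"
proof (rule ccontr)
  assume contra: "\<not> ?thesis"
  have base: "inverse (of_nat p) \<notin> span_powers R y 0" for y
    using p_pos by (simp add: span_powers_def)
  define N where "N y = (LEAST n. inverse (of_nat p) \<in> span_powers R y n)" for y
  have N: "inverse (of_nat p) \<in> span_powers R y (N y)" "N y > 0"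
    "\<And>n. inverse (of_nat p) \<in> span_powers R y n \<Longrightarrow> N y \<le> n" if y: "y \<notin> R" for y
  proof -
    obtain n where "inverse (of_nat p) \<in> span_powers R y n" by (rule adjoin[OF y])
    then show "inverse (of_nat p) \<in> span_powers R y (N y)" unfolding N_def by (rule LeastI)
    then show "N y > 0" using base[of y] by (metis gr0I)
    show "N y \<le> n" if "inverse (of_nat p) \<in> span_powers R y n" for n
      unfolding N_def using that by (rule Least_le)
  qed
  have le: False if x: "x \<noteq> 0" "x \<notin> R" "inverse x \<notin> R" "N (inverse x) \<le> N x" for x
  proof -
    obtain n m where nm: "N x = Suc n" "N (inverse x) = Suc m"
      using N(2)[OF x(2)] N(2)[OF x(3)] by (auto simp: gr0_conv_Suc)
    then have "inverse (of_nat p) \<in> span_powers R x n"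
      using span_reduce[of x n m] N(1)[OF x(2)] N(1)[OF x(3)] x by simp
    then show False using N(3)[OF x(2), of n] nm by simp
  qed
  have "x \<noteq> 0" using contra by auto
  then show False using le[of x] le[of "inverse x"] contra linear[of "N x" "N (inverse x)"] by auto
qed

lemma root_closed:
  assumes "z ^ n \<in> R" "n > 0" shows "z \<in> R"
proof (rule ccontr)
  assume "z \<notin> R"
  then have "z \<noteq> 0" "inverse z \<in> R" using total by auto
  then have "z ^ n * inverse z ^ (n - 1) \<in> R" by (intro mult_R power_R assms)
  moreover have "z ^ n = z * z ^ (n - 1)" using assms(2) by (cases n) auto
  ultimately show False using \<open>z \<noteq> 0\<close> \<open>z \<notin> R\<close> by (simp add: field_simps)
qed

text \<open>Bezout gives a u = 1 - p b, a unit of \<open>R\<close>. Hence \<open>R\<close> contains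
  the localization of the integers at p.\<close>

lemma inverse_of_int_R:
  assumes "\<not> int p dvd u"
  shows "inverse (of_int u) \<in> R"
proof -
  have "coprime u (int p)"
    using assms prime_p prime_imp_coprime[of "int p" u] by (simp add: coprime_commute)
  then obtain a b where ab: "a * u + b * int p = 1"
    using bezout_int[of u "int p"] by (auto simp: coprime_iff_gcd_eq_1)
  have "of_int a * of_int u = 1 - of_nat p * (of_int b :: complex)"
    using arg_cong[OF ab, of "of_int :: int \<Rightarrow> complex"] by (simp add: algebra_simps)
  then have u: "of_int a * of_int u \<noteq> (0 :: complex)" "inverse (of_int a * of_int u) \<in> R"
    using unit_1_minus_p[OF of_int_R[of b]] by simp_all
  then have "inverse (of_int u) = of_int a * inverse (of_int a * of_int u :: complex)"
    by (simp add: field_simps)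
  then show ?thesis using u mult_R[OF of_int_R u(2)] by (simp only:)
qed

lemma int_decomp:
  assumes "c \<noteq> 0"
  obtains k u where "c = int p ^ k * u" "\<not> int p dvd u" "k = multiplicity (int p) c"
proof -
  have "\<not> is_unit (int p)" using p_gt_1 by simp
  then obtain u where "c = int p ^ multiplicity (int p) c * u" "\<not> int p dvd u"
    using multiplicity_decompose'[OF assms] by blast
  then show ?thesis using that by blast
qed

text \<open>This is what makes the valuation real-valued on algebraic numbers. If \<open>x\<close>
  is not in \<open>R\<close>, then 1/x is, and dividing an integral equation for \<open>x\<close> by
  x^(m-1) shows c x in \<open>R\<close> for its leading coefficient c; the part of c prime to p is a
  unit.\<close>

lemma p_power_mult_R:
  assumes "algebraic x"
  obtains k where "of_nat p ^ k * x \<in> R"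
proof (cases "x \<in> R")
  case True
  then show ?thesis using that[of 0] by simp
next
  case False
  then have x: "x \<noteq> 0" "inverse x \<in> R" using total by auto
  obtain P where P: "P \<noteq> 0" "poly (cpoly P) x = 0" using algebraicE'[OF assms] by blast
  define m where "m = degree P"
  define c where "c = lead_coeff P"
  have c: "c \<noteq> 0" using P by (simp add: c_def)
  have m: "m > 0"
  proof (rule ccontr)
    assume "\<not> m > 0"
    then have "degree P = 0" using m_def by simp
    then obtain e where "P = [:e:]" using degree_eq_zeroE by blast
    then show False using P by (simp add: map_poly_pCons)
  qed
  have "0 = (\<Sum>i\<le>m. of_int (coeff P i) * x ^ i)"
    using P by (simp add: poly_altdef coeff_map_poly m_def)
  also have "\<dots> = of_int c * x ^ m + (\<Sum>i<m. of_int (coeff P i) * x ^ i)"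
    by (simp add: c_def m_def flip: lessThan_Suc_atMost)
  finally have "of_int c * x ^ m = - (\<Sum>i<m. of_int (coeff P i) * x ^ i)"
    by (simp add: eq_neg_iff_add_eq_0)
  then have "of_int c * x = - (\<Sum>i<m. of_int (coeff P i) * x ^ i) * inverse x ^ (m - 1)"
    using x m by (cases m) (auto simp: field_simps)
  also have "\<dots> = - (\<Sum>i<m. of_int (coeff P i) * inverse x ^ (m - 1 - i))"
    unfolding minus_mult_left[symmetric] sum_distrib_right
  proof (intro arg_cong[of _ _ uminus] sum.cong[OF refl])
    fix i assume "i \<in> {..<m}"
    then have "m - 1 = i + (m - 1 - i)" by simp
    then have "inverse x ^ (m - 1) = inverse x ^ i * inverse x ^ (m - 1 - i)" by (metis power_add)
    then show "of_int (coeff P i) * x ^ i * inverse x ^ (m - 1) = of_int (coeff P i) * inverse x ^ (m - 1 - i)"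
      using x by (simp add: power_mult_distrib[symmetric] mult_ac)
  qed
  also have "\<dots> \<in> R" using x by (intro minus_R sum_R mult_R power_R of_int_R)
  finally have cx: "of_int c * x \<in> R" .
  obtain k u where ku: "c = int p ^ k * u" "\<not> int p dvd u" using int_decomp[OF c] by metis
  then have "u \<noteq> 0" using c by auto
  then have "of_nat p ^ k * x = inverse (of_int u) * (of_int c * x)" by (simp add: ku)
  also have "\<dots> \<in> R" by (rule mult_R[OF inverse_of_int_R[OF ku(2)] cx])
  finally show ?thesis using that by blast
qed

lemma p_powi_R_iff: "of_nat p powi k \<in> R \<longleftrightarrow> k \<ge> 0"
proof
  assume *: "of_nat p powi k \<in> R"
  show "k \<ge> 0"
  proof (rule ccontr)
    assume "\<not> k \<ge> 0"
    then have "of_nat p powi k * of_nat p ^ nat (- k - 1) = (of_nat p powi (-1) :: complex)"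
      using p_pos by (simp flip: power_int_of_nat power_int_add)
    moreover have "of_nat p powi k * of_nat p ^ nat (- k - 1) \<in> R"
      by (intro mult_R power_R of_nat_R *)
    ultimately show False using inverse_p_notin by (simp add: power_int_minus)
  qed
next
  assume "k \<ge> 0"
  then show "of_nat p powi k \<in> R" by (simp add: power_int_def power_R of_nat_R)
qed

section \<open>The real exponent of the valuation\<close>

definition radii :: "complex \<Rightarrow> real set" where
  "radii x = {real_of_int a / real n | a n. n > 0 \<and> x ^ n * of_nat p powi a \<in> R}"

text \<open>The exponent of the absolute value: \<open>x ^ n * p powi a\<close> should be integral iff
  \<open>\<bar>x\<bar> ^ n \<le> p powi a\<close>, so \<open>log p \<bar>x\<bar>\<close> is the infimum of the ratios \<open>a / n\<close>.\<close>
definition lval :: "complex \<Rightarrow> real" where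
  "lval x = Inf (radii x)"

lemma radiiE:
  assumes "r \<in> radii x"
  obtains a n where "r = real_of_int a / real n" "n > 0" "x ^ n * of_nat p powi a \<in> R"
  using assms unfolding radii_def by blast

context
  fixes x :: complex
  assumes x: "algebraic x" "x \<noteq> 0"
begin

lemma radii_nonempty: "radii x \<noteq> {}"
proof -
  obtain k where "of_nat p ^ k * x \<in> R" using p_power_mult_R x by blast
  then have "real_of_int (int k) / real 1 \<in> radii x" unfolding radii_def
    by (intro CollectI exI[of _ "int k"] exI[of _ 1]) (auto simp: mult.commute)
  then show ?thesis by blast
qed

text \<open>If p^k / x is in \<open>R\<close>, then x^n p^a in \<open>R\<close> implies k n + a >=
  0, that is a/n >= -k.\<close>

lemma radii_bdd: "bdd_below (radii x)"
proof -
  obtain k where k: "of_nat p ^ k * inverse x \<in> R" using p_power_mult_R x algebraic_inverse by blast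
  show ?thesis
  proof (rule bdd_belowI)
    fix r assume "r \<in> radii x"
    then obtain a n where r: "r = real_of_int a / real n" "n > 0" "x ^ n * of_nat p powi a \<in> R"
      unfolding radii_def by blast
    have "(of_nat p ^ k * inverse x) ^ n * (x ^ n * of_nat p powi a) \<in> R"
      by (intro mult_R power_R r k)
    also have "(of_nat p ^ k * inverse x) ^ n * (x ^ n * of_nat p powi a) = of_nat p powi (int (k * n) + a)"
    proof -
      have "(of_nat p ^ k * inverse x) ^ n * x ^ n = of_nat p ^ (k * n)"
        using x by (simp add: power_mult mult.assoc flip: power_mult_distrib)
      moreover have "of_nat p powi (int (k * n) + a) = of_nat p ^ (k * n) * (of_nat p powi a :: complex)"
        using p_pos by (subst power_int_add) (simp, simp only: power_int_of_nat)
      ultimately show ?thesis by (simp only: flip: mult.assoc)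
    qed
    finally have "int (k * n) + a \<ge> 0" by (simp only: p_powi_R_iff)
    then have "real k * real n + real_of_int a \<ge> 0"
      by (metis of_int_0_le_iff of_int_add of_int_of_nat_eq of_nat_mult)
    then show "- real k \<le> r" using r(2) unfolding r(1) by (simp add: le_divide_eq)
  qed
qed

lemma lval_le: "n > 0 \<Longrightarrow> x ^ n * of_nat p powi a \<in> R \<Longrightarrow> lval x \<le> real_of_int a / real n"
  unfolding lval_def by (rule cInf_lower[OF _ radii_bdd]) (auto simp: radii_def)

text \<open>Some b/m below a/n is admissible. The m-th power of x^n p^a is the n-th power of x^m p^b
  times a nonnegative power of p, and \<open>R\<close> is closed under roots.\<close>

lemma lval_less:
  assumes "n > 0" "lval x < real_of_int a / real n"
  shows "x ^ n * of_nat p powi a \<in> R"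
proof -
  obtain r where "r \<in> radii x" "r < real_of_int a / real n"
    using assms(2) radii_bdd radii_nonempty unfolding lval_def by (meson cInf_less_iff)
  then obtain b m where bm: "real_of_int b / real m < real_of_int a / real n" "m > 0"
    "x ^ m * of_nat p powi b \<in> R"
    unfolding radii_def by blast
  have "real_of_int (b * int n) < real_of_int (a * int m)"
    using bm assms by (simp add: field_simps)
  then have le: "a * int m - b * int n \<ge> 0" by linarith
  have "(x ^ n * of_nat p powi a) ^ m = (x ^ m * of_nat p powi b) ^ n * of_nat p powi (a * int m - b * int n)"
    using p_pos by (simp add: power_mult_distrib power_int_diff power_int_mult mult_ac flip: power_mult)
  also have "\<dots> \<in> R" using le by (intro mult_R power_R bm) (simp add: p_powi_R_iff)
  finally show ?thesis using root_closed bm by blast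
qed

lemma lval_floor:
  assumes "n > 0" "lval x \<le> t"
  shows "x ^ n * of_nat p powi (\<lfloor>real n * t\<rfloor> + 1) \<in> R"
proof (rule lval_less[OF assms(1)])
  have "real n * lval x \<le> real n * t" using assms by simp
  \<comment> \<open>The \<open>+ 1\<close> makes the inequality strict, as \<open>lval_less\<close>
    requires.\<close>
  then have "real n * lval x < real_of_int (\<lfloor>real n * t\<rfloor> + 1)" by linarith
  then show "lval x < real_of_int (\<lfloor>real n * t\<rfloor> + 1) / real n" using assms by (simp add: field_simps)
qed

end

lemma real_le_by_inverse_nat: "(\<And>n::nat. n > 0 \<Longrightarrow> a \<le> b + c / real n) \<Longrightarrow> a \<le> (b::real)"
proof (rule LIMSEQ_le_const)
  show "(\<lambda>n. b + c / real n) \<longlonglongrightarrow> b"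
    using tendsto_add[OF tendsto_const lim_const_over_n, of b c] by simp
qed (auto intro: exI[of _ 1])

lemma mult_power_powi:
  fixes x y z :: complex
  shows "z \<noteq> 0 \<Longrightarrow> (x ^ n * z powi a) * (y ^ n * z powi b) = (x * y) ^ n * z powi (a + b)"
  by (simp add: power_int_add power_mult_distrib)

lemma lval_mult_le:
  assumes "algebraic x" "x \<noteq> 0" "algebraic y" "y \<noteq> 0"
  shows "lval (x * y) \<le> lval x + lval y"
proof (rule real_le_by_inverse_nat[where c = 2])
  fix n :: nat assume n: "n > 0"
  let ?a = "\<lfloor>real n * lval x\<rfloor> + 1" and ?b = "\<lfloor>real n * lval y\<rfloor> + 1"
  have "(x ^ n * of_nat p powi ?a) * (y ^ n * of_nat p powi ?b) \<in> R"
    by (intro mult_R lval_floor assms n order_refl)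
  moreover have "(x ^ n * of_nat p powi ?a) * (y ^ n * of_nat p powi ?b) = (x * y) ^ n * of_nat p powi (?a + ?b)"
    using p_pos by (intro mult_power_powi) simp
  ultimately have mem: "(x * y) ^ n * of_nat p powi (?a + ?b) \<in> R" by (simp only:)
  have "lval (x * y) \<le> real_of_int (?a + ?b) / real n"
    by (rule lval_le[OF algebraic_mult[OF assms(1,3)] _ n mem]) (use assms in simp)
  then show "lval (x * y) \<le> lval x + lval y + 2 / real n"
    by (rule order_trans[OF _ floor_plus_1_add_div_le[OF n]])
qed

text \<open>Just below the infimum x^n p^a is not in \<open>R\<close>, so its inverse is; the
  ceiling minus 1 is the largest integer strictly below.\<close>

lemma lval_inverse_le:
  assumes "algebraic x" "x \<noteq> 0"
  shows "lval (inverse x) \<le> - lval x"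
proof (rule real_le_by_inverse_nat[where c = 1])
  fix n :: nat assume n: "n > 0"
  let ?a = "\<lceil>real n * lval x\<rceil> - 1"
  have "real_of_int ?a < real n * lval x" by linarith
  then have "real_of_int ?a / real n < lval x" using n by (simp add: field_simps)
  then have "x ^ n * of_nat p powi ?a \<notin> R" using lval_le[OF assms n] by force
  then have "inverse (x ^ n * of_nat p powi ?a) \<in> R" using total by blast
  then have mem: "inverse x ^ n * of_nat p powi (- ?a) \<in> R"
    by (simp only: inverse_mult_distrib power_inverse power_int_minus)
  have "lval (inverse x) \<le> real_of_int (- ?a) / real n"
    by (rule lval_le[OF algebraic_inverse[OF assms(1)] _ n mem]) (use assms in simp)
  then show "lval (inverse x) \<le> - lval x + 1 / real n"
    by (rule order_trans[OF _ minus_ceiling_minus_1_div_le[OF n]])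
qed

text \<open>The missing inequality is subadditivity applied to x = (x y) (1/y).\<close>

lemma lval_mult:
  assumes "algebraic x" "x \<noteq> 0" "algebraic y" "y \<noteq> 0"
  shows "lval (x * y) = lval x + lval y"
proof -
  have "lval x = lval ((x * y) * inverse y)" using assms by (simp add: field_simps)
  also have "\<dots> \<le> lval (x * y) + lval (inverse y)"
    using assms by (intro lval_mult_le algebraic_mult algebraic_inverse) auto
  also have "\<dots> \<le> lval (x * y) - lval y" using lval_inverse_le assms by fastforce
  finally show ?thesis using lval_mult_le[OF assms] by simp
qed

lemma lval_add:
  assumes "algebraic x" "x \<noteq> 0" "algebraic y" "y \<noteq> 0" "x + y \<noteq> 0"
  shows "lval (x + y) \<le> max (lval x) (lval y)"
proof (rule real_le_by_inverse_nat[where c = 1])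
  fix n :: nat assume n: "n > 0"
  let ?a = "\<lfloor>real n * max (lval x) (lval y)\<rfloor> + 1"
  have xy: "x ^ n * of_nat p powi ?a \<in> R" "y ^ n * of_nat p powi ?a \<in> R"
    by (rule lval_floor; use assms n in simp)+
  have mem: "(x + y) ^ n * of_nat p powi ?a \<in> R"
  \<comment> \<open>One of the two quotients is in \<open>R\<close>; the sum is then the
    corresponding summand times an element of \<open>R\<close>.\<close>
  proof (cases "y / x \<in> R")
    case True
    have "(x + y) ^ n * of_nat p powi ?a = (1 + y / x) ^ n * (x ^ n * of_nat p powi ?a)"
      using assms by (simp add: algebra_simps flip: power_mult_distrib)
    also have "\<dots> \<in> R" by (intro mult_R power_R add_R True xy) simp
    finally show ?thesis .
  next
    case False
    then have "x / y \<in> R" using total[of "y / x"] by simp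
    have "(x + y) ^ n * of_nat p powi ?a = (1 + x / y) ^ n * (y ^ n * of_nat p powi ?a)"
      using assms by (simp add: algebra_simps flip: power_mult_distrib)
    also have "\<dots> \<in> R" by (intro mult_R power_R add_R \<open>x / y \<in> R\<close> xy) simp
    finally show ?thesis .
  qed
  have "lval (x + y) \<le> real_of_int ?a / real n"
    by (rule lval_le[OF algebraic_add[OF assms(1,3)] assms(5) n mem])
  then show "lval (x + y) \<le> max (lval x) (lval y) + 1 / real n"
    by (rule order_trans[OF _ floor_plus_1_div_le[OF n]])
qed

lemma lval_R: "algebraic x \<Longrightarrow> x \<noteq> 0 \<Longrightarrow> x \<in> R \<Longrightarrow> lval x \<le> 0"
  using lval_le[of x 1 0] by simp

lemma lval_1: "lval 1 = 0"
  using lval_mult[of 1 1] by simp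

lemma lval_unit:
  assumes "\<not> int p dvd u"
  shows "lval (of_int u) = 0"
proof -
  have u: "u \<noteq> 0" using assms by auto
  have "lval (of_int u) \<le> 0" using u by (intro lval_R of_int_R) auto
  moreover have "lval (inverse (of_int u)) \<le> 0"
    using u assms by (intro lval_R inverse_of_int_R algebraic_inverse) auto
  moreover have "lval (of_int u) + lval (inverse (of_int u)) = 0"
    using lval_mult[of "of_int u" "inverse (of_int u)"] u lval_1 algebraic_inverse[of "of_int u"] by simp
  ultimately show ?thesis by linarith
qed

lemma lval_p: "lval (of_nat p) = - 1"
proof (rule antisym)
  show "lval (of_nat p) \<le> - 1"
    using lval_le[of "of_nat p" 1 "-1"] p_pos by (simp add: power_int_minus)
  have "- 1 \<le> r" if r0: "r \<in> radii (of_nat p)" for r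
  proof -
    obtain a n where r: "r = real_of_int a / real n" "n > 0" "of_nat p ^ n * of_nat p powi a \<in> R"
      by (rule radiiE[OF r0])
    then have "of_nat p powi (int n + a) \<in> R" using p_pos by (simp add: power_int_add)
    then have "int n + a \<ge> 0" by (simp only: p_powi_R_iff)
    then have "real n + real_of_int a \<ge> 0" by linarith
    then show ?thesis using r(2) unfolding r(1) by (simp add: le_divide_eq)
  qed
  then show "- 1 \<le> lval (of_nat p)"
    unfolding lval_def using p_pos by (intro cInf_greatest radii_nonempty) auto
qed

lemma lval_of_int:
  assumes "c \<noteq> 0"
  shows "lval (of_int c) = - real (multiplicity (int p) c)"
proof -
  obtain k u where ku: "c = int p ^ k * u" "\<not> int p dvd u" "k = multiplicity (int p) c"
    using int_decomp[OF assms] by metis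
  have "lval (of_nat p ^ j) = - real j" for j
  proof (induction j)
    case 0
    show ?case by (simp add: lval_1)
  next
    case (Suc j)
    have "lval (of_nat p * of_nat p ^ j) = lval (of_nat p) + lval (of_nat p ^ j)"
      using p_pos by (intro lval_mult algebraic_power) auto
    then show ?case using Suc lval_p by simp
  qed
  moreover have "u \<noteq> 0" using ku assms by auto
  then have "lval (of_nat p ^ k * of_int u) = lval (of_nat p ^ k) + lval (of_int u)"
    using p_pos by (intro lval_mult algebraic_power) auto
  ultimately have "lval (of_nat p ^ k * of_int u) = - real k" using lval_unit[OF ku(2)] by simp
  moreover have "of_int c = (of_nat p ^ k * of_int u :: complex)" by (subst ku(1)) simp
  ultimately show ?thesis using ku(3) by (simp only:)
qed

end

text \<open>The axioms are restricted to algebraic numbers, where the exponent is known to be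
  finite. The last clause fixes the normalization on which the product formula depends.\<close>

definition padic_abs :: "nat \<Rightarrow> (complex \<Rightarrow> real) \<Rightarrow> bool" where
  "padic_abs p N \<longleftrightarrow> N 0 = 0 \<and>
     (\<forall>x. algebraic x \<longrightarrow> x \<noteq> 0 \<longrightarrow> N x > 0) \<and>
     (\<forall>x y. algebraic x \<longrightarrow> algebraic y \<longrightarrow> N (x * y) = N x * N y) \<and>
     (\<forall>x y. algebraic x \<longrightarrow> algebraic y \<longrightarrow> N (x + y) \<le> max (N x) (N y)) \<and>
     (\<forall>c. c \<noteq> 0 \<longrightarrow> N (of_int c) = real p powr (- real (multiplicity (int p) c)))"

lemma (in maximal_subring) padic_abs_lval:
  "padic_abs p (\<lambda>x. if x = 0 then 0 else real p powr lval x)"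
  unfolding padic_abs_def
proof (intro conjI allI impI)
  fix x y :: complex
  assume xy: "algebraic x" "algebraic y"
  show "(if x * y = 0 then 0 else real p powr lval (x * y)) =
        (if x = 0 then 0 else real p powr lval x) * (if y = 0 then 0 else real p powr lval y)"
    using xy by (simp add: lval_mult powr_add)
  show "(if x + y = 0 then 0 else real p powr lval (x + y))
     \<le> max (if x = 0 then 0 else real p powr lval x) (if y = 0 then 0 else real p powr lval y)"
    using lval_add[OF xy(1) _ xy(2)] p_gt_1 by (auto simp: max_def split: if_splits)
qed (use p_pos lval_of_int in auto)

text \<open>Zorn's lemma, starting from the ring of integers.\<close>

lemma padic_abs_exists:
  assumes "prime p"
  shows "\<exists>N. padic_abs p N"
proof -
  let ?A = "{R. subring_avoiding (inverse (of_nat p)) R}"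
  have p: "p > 1" using assms prime_gt_1_nat by blast
  have "\<exists>M\<in>?A. \<forall>X\<in>?A. M \<subseteq> X \<longrightarrow> X = M"
  proof (rule subset_Zorn_nonempty)
    have "inverse (of_nat p) \<notin> (\<int> :: complex set)"
    proof
      assume "inverse (of_nat p) \<in> (\<int> :: complex set)"
      then obtain k where "inverse (of_nat p) = (of_int k :: complex)" by (auto elim: Ints_cases)
      then have "(of_int (int p * k) :: complex) = of_int 1" using p by (simp add: field_simps)
      then have "int p * k = 1" by (simp only: of_int_eq_iff)
      then show False using p zmult_eq_1_iff by force
    qed
    then have "(\<int> :: complex set) \<in> ?A" by (simp add: subring_avoiding_def)
    then show "?A \<noteq> {}" by blast
  next
    fix C assume C: "C \<noteq> {}" "subset.chain ?A C"
    have ex: "\<exists>R\<in>C. x \<in> R \<and> y \<in> R" if "x \<in> \<Union>C" "y \<in> \<Union>C" for x y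
      using that C(2) unfolding subset.chain_def by blast
    have sub: "subring_avoiding (inverse (of_nat p)) R" if "R \<in> C" for R
      using that C(2) unfolding subset.chain_def by blast
    have "subring_avoiding (inverse (of_nat p)) (\<Union>C)"
      unfolding subring_avoiding_def
    proof (intro conjI ballI)
      show "1 \<in> \<Union>C" using C sub unfolding subring_avoiding_def by blast
      show "inverse (of_nat p) \<notin> \<Union>C" using sub unfolding subring_avoiding_def by blast
      fix x y assume "x \<in> \<Union>C" "y \<in> \<Union>C"
      then obtain R where "R \<in> C" "x \<in> R" "y \<in> R" using ex by blast
      then show "x - y \<in> \<Union>C" "x * y \<in> \<Union>C" using sub unfolding subring_avoiding_def by blast+
    qed
    then show "\<Union>C \<in> ?A" by simp
  qed
  then obtain R where "subring_avoiding (inverse (of_nat p)) R"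
    "\<And>S. subring_avoiding (inverse (of_nat p)) S \<Longrightarrow> R \<subseteq> S \<Longrightarrow> S = R" by blast
  then interpret maximal_subring p R by unfold_locales (use assms in auto)
  show ?thesis using padic_abs_lval by blast
qed

section \<open>Local growth of orbits\<close>

text \<open>Since d c >= 2 c, the quantity a - c is multiplied by at least d in every step, so the
  errors of all steps together cost only one c.\<close>

lemma exp_growth_lower:
  fixes a :: "nat \<Rightarrow> real"
  assumes "d \<ge> 2" "c \<ge> 0" and step: "\<And>n. real d * a n - c \<le> a (Suc n)"
  shows "real d ^ n * (a 0 - c) + c \<le> a n"
proof (induction n)
  case 0
  then show ?case by simp
next
  case (Suc n)
  have "2 * c \<le> real d * c" using assms by (intro mult_right_mono) auto
  moreover have "real d * (real d ^ n * (a 0 - c) + c) \<le> real d * a n"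
    using Suc by (intro mult_left_mono) auto
  ultimately show ?case using step[of n] by (simp add: algebra_simps)
qed

lemma exp_growth_upper:
  fixes a :: "nat \<Rightarrow> real"
  assumes "d \<ge> 2" "c \<ge> 0" and step: "\<And>n. a (Suc n) \<le> real d * a n + c"
  shows "a n \<le> real d ^ n * (a 0 + c) - c"
  using exp_growth_lower[of d c "\<lambda>n. - a n" n] assms by (simp add: algebra_simps)

text \<open>Tate's telescoping argument: consecutive differences of a_n / d^n are bounded by a
  geometric series.\<close>

lemma exp_growth_convergent:
  fixes a :: "nat \<Rightarrow> real"
  assumes d: "d \<ge> 2" and step: "\<And>n. \<bar>a (Suc n) - real d * a n\<bar> \<le> c"
  shows "convergent (\<lambda>n. a n / real d ^ n)"
proof -
  define b where "b n = a n / real d ^ n" for n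
  have d0: "real d > 0" using d by simp
  have "norm (b (Suc n) - b n) \<le> c * (1 / real d) ^ Suc n" for n
  proof -
    have "b (Suc n) - b n = (a (Suc n) - real d * a n) / real d ^ Suc n"
      using d0 by (simp add: b_def field_simps)
    then show ?thesis using step[of n] d0
      by (simp add: abs_mult power_divide divide_right_mono)
  qed
  moreover have "summable (\<lambda>n. c * (1 / real d) ^ Suc n)"
    using d by (intro summable_mult summable_ignore_initial_segment[where k = 1, simplified] summable_geometric) simp
  ultimately have "summable (\<lambda>n. b (Suc n) - b n)"
    by (meson summable_comparison_test')
  then have "convergent b"
    using summable_iff_convergent[of "\<lambda>n. b (Suc n) - b n"] sum_lessThan_telescope[of b]
    by (simp add: convergent_diff_const_right_iff)
  then show ?thesis unfolding b_def .
qed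

lemma power_Suc_scale:
  assumes "d > 0"
  shows "real d ^ Suc m * (a / real d + b) = real d ^ m * (a + real d * b)"
proof -
  have "real d * (a / real d + b) = a + real d * b" using assms by (simp add: distrib_left)
  then show ?thesis by (simp only: power_Suc2 mult.assoc)
qed

text \<open>\<open>u n\<close> and \<open>w n\<close> stand for the absolute values of the numerator and denominator of the
  \<open>n\<close>-th iterate of \<open>\<alpha>\<close>, with \<open>r = \<bar>\<alpha>\<bar>\<close> and \<open>L = \<bar>\<lambda>\<bar>\<close>.  The constant \<open>\<kappa>\<close> is 1 at an ultrametric place and 2 at an archimedean one.\<close>
locale local_orbit =
  fixes d :: nat and \<kappa> L r :: real and u w :: "nat \<Rightarrow> real"
  assumes d: "d \<ge> 2" and kappa: "\<kappa> \<ge> 1" and L: "L > 0" and r: "r > 0"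
    and init: "u 0 = r" "w 0 = 1"
    and nonneg: "\<And>n. u n \<ge> 0"
    and w_Suc: "\<And>n. w (Suc n) = u n * w n ^ (d - 1)"
    and u_le: "\<And>n. u (Suc n) \<le> \<kappa> * max (u n ^ d) (L * w n ^ d)"
    and u_dom: "\<And>n. \<kappa> * (L * w n ^ d) < u n ^ d \<Longrightarrow> u n ^ d \<le> \<kappa> * u (Suc n)"
    and w_dom: "\<And>n. \<kappa> * u n ^ d < L * w n ^ d \<Longrightarrow> L * w n ^ d \<le> \<kappa> * u (Suc n)"
begin

definition "M n = max (u n) (w n)"
text \<open>In the coordinate scaled by \<open>s\<close> both terms of \<open>z ^ d + \<lambda>\<close> have equal weight; this makes
  \<open>\<Psi>\<close> grow like a \<open>d\<close>-th power up to a constant that does not depend on the iterate.\<close>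
definition "s = L powr (1 / real d)"
definition "\<Psi> n = max (u n) (s * w n)"

lemma w_nonneg: "w n \<ge> 0"
  by (induction n) (simp_all add: init w_Suc nonneg)

lemma s_pos: "s > 0" using L by (simp add: s_def)

lemma s_power: "s ^ d = L"
  using L d by (simp add: s_def powr_powr flip: powr_realpow)

lemma ln_s: "ln s = ln L / real d"
  using L by (simp add: s_def ln_powr)

lemma sw_power: "L * w n ^ d = (s * w n) ^ d"
  by (simp add: power_mult_distrib s_power)

lemma sw_Suc: "s ^ (d - 2) * (s * w (Suc n)) = u n * (s * w n) ^ (d - 1)"
proof -
  have "d - 1 = Suc (d - 2)" using d by simp
  then show ?thesis by (simp add: w_Suc power_mult_distrib mult_ac)
qed

lemma Psi_nonneg: "\<Psi> n \<ge> 0" by (simp add: \<Psi>_def nonneg le_max_iff_disj)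

text \<open>If one of u^d and (s w)^d exceeds the other by more than the factor \<kappa>, there is
  no cancellation and \<open>u (Suc n)\<close> is large. Otherwise both are comparable, and the
  denominator u w^(d-1) is large; rescaling it costs the factor s^(d-2), which is the origin of
  \<open>C\<close>.\<close>

lemma Psi_lower:
  defines "C \<equiv> max 1 (s ^ (d - 2))"
  shows "\<Psi> n ^ d \<le> \<kappa> * C * \<Psi> (Suc n)"
proof -
  let ?v = "s * w n"
  have v: "?v \<ge> 0" using s_pos w_nonneg by simp
  have C: "C \<ge> 1" by (simp add: C_def)
  have dS: "x ^ d = x * x ^ (d - 1)" for x :: real using d by (cases d) auto
  have u_case: "\<kappa> * u (Suc n) \<le> \<kappa> * C * \<Psi> (Suc n)"
  proof -
    have "u (Suc n) \<le> C * u (Suc n)" using C nonneg[of "Suc n"] by (simp add: mult_le_cancel_right1)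
    also have "\<dots> \<le> C * \<Psi> (Suc n)" using C by (simp add: \<Psi>_def)
    finally show ?thesis using kappa by (simp add: mult_left_mono mult.assoc)
  qed
  have w_case: "\<kappa> * (u n * ?v ^ (d - 1)) \<le> \<kappa> * C * \<Psi> (Suc n)"
  proof -
    have "u n * ?v ^ (d - 1) \<le> C * (s * w (Suc n))"
      unfolding sw_Suc[symmetric] C_def using s_pos w_nonneg[of "Suc n"] by (intro mult_right_mono) auto
    also have "\<dots> \<le> C * \<Psi> (Suc n)" using C by (simp add: \<Psi>_def)
    finally show ?thesis using kappa by (simp add: mult_left_mono mult.assoc)
  qed
  show ?thesis
  proof (cases "?v \<le> u n")
    case True
    then have Psi: "\<Psi> n = u n" by (simp add: \<Psi>_def)
    show ?thesis
    proof (cases "\<kappa> * (L * w n ^ d) < u n ^ d")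
      case True
      then show ?thesis using u_dom u_case Psi by fastforce
    next
      case False
      then have le: "u n ^ d \<le> \<kappa> * ?v ^ d" by (simp add: sw_power)
      have "u n ^ (d - 1) \<le> \<kappa> * ?v ^ (d - 1)"
      proof (cases "?v = 0")
        case True
        then have "?v ^ d = 0" using d zero_power[of d, where 'a = real] by simp
        then have "u n ^ d \<le> 0" using le by (metis mult_zero_right)
        then have "u n = 0" using nonneg[of n] by (auto simp: power_le_zero_eq)
        then have "u n ^ (d - 1) = 0" using d by simp
        then show ?thesis using kappa v by (simp only:) simp
      next
        case False
        have "u n ^ (d - 1) * ?v \<le> u n ^ d"
          using mult_left_mono[OF \<open>?v \<le> u n\<close> zero_le_power[OF nonneg[of n], of "d - 1"]]
          by (simp add: dS[of "u n"] mult.commute)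
        also have "\<dots> \<le> \<kappa> * ?v ^ (d - 1) * ?v" using le unfolding dS[of ?v] by (simp only: mult_ac)
        finally show ?thesis using False v by (simp add: mult_le_cancel_right)
      qed
      then have "u n * u n ^ (d - 1) \<le> u n * (\<kappa> * ?v ^ (d - 1))"
        using nonneg by (intro mult_left_mono)
      then show ?thesis using w_case unfolding Psi dS[of "u n"] by (simp add: mult_ac)
    qed
  next
    case False
    then have Psi: "\<Psi> n = ?v" by (simp add: \<Psi>_def)
    have vpos: "?v > 0" using False nonneg[of n] by linarith
    show ?thesis
    proof (cases "\<kappa> * u n ^ d < L * w n ^ d")
      case True
      then show ?thesis using w_dom u_case Psi sw_power by fastforce
    next
      case False
      then have le: "?v ^ d \<le> \<kappa> * u n ^ d" by (simp add: sw_power)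
      have "u n \<noteq> 0"
      proof
        assume "u n = 0"
        then have "\<kappa> * u n ^ d = 0" using d by simp
        then show False using le zero_less_power[OF vpos, of d] by linarith
      qed
      then have upos: "u n > 0" using nonneg[of n] by simp
      have "?v * u n ^ (d - 1) \<le> ?v * ?v ^ (d - 1)"
        using v \<open>\<not> ?v \<le> u n\<close> upos by (intro mult_left_mono power_mono) auto
      also have "\<dots> \<le> \<kappa> * u n * u n ^ (d - 1)" using le
        unfolding dS[of ?v] dS[of "u n"] by (simp only: mult_ac)
      finally have "?v \<le> \<kappa> * u n" using upos by (simp add: mult_le_cancel_right)
      then have "?v * ?v ^ (d - 1) \<le> \<kappa> * u n * ?v ^ (d - 1)"
        using v by (intro mult_right_mono) auto
      then show ?thesis using w_case unfolding Psi dS[of ?v] by (simp add: mult_ac)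
    qed
  qed
qed

lemma Psi_pos: "\<Psi> n > 0"
proof (induction n)
  case 0
  show ?case using r by (simp add: \<Psi>_def init less_max_iff_disj)
next
  case (Suc n)
  have "0 < \<Psi> n ^ d" using Suc by simp
  also note Psi_lower[of n]
  finally show ?case using Psi_nonneg[of "Suc n"] by (cases "\<Psi> (Suc n) = 0") auto
qed

lemma M_pos: "M n > 0"
proof -
  have "u n > 0 \<or> s * w n > 0" using Psi_pos[of n] by (simp add: \<Psi>_def less_max_iff_disj)
  then show ?thesis using s_pos by (auto simp: M_def less_max_iff_disj zero_less_mult_iff)
qed

lemma ln_Psi_lower:
  "real d * ln (\<Psi> n) - (ln \<kappa> + ln (max 1 (s ^ (d - 2)))) \<le> ln (\<Psi> (Suc n))"
proof -
  have "ln (\<Psi> n ^ d) \<le> ln (\<kappa> * max 1 (s ^ (d - 2)) * \<Psi> (Suc n))"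
    using Psi_lower[of n] Psi_pos by (intro ln_mono) auto
  then show ?thesis using Psi_pos[of n] Psi_pos[of "Suc n"] kappa
    by (simp add: ln_realpow ln_mult_pos less_max_iff_disj)
qed

text \<open>Serves only convergence, so the constant may depend on L; the explicit upper bound
  \<open>g_le\<close> uses another majorant.\<close>

lemma ln_Psi_upper:
  "\<exists>c. \<forall>n. ln (\<Psi> (Suc n)) \<le> real d * ln (\<Psi> n) + c"
proof -
  define C where "C = max \<kappa> (inverse (s ^ (d - 2)))"
  have C: "C > 0" using kappa by (simp add: C_def less_max_iff_disj)
  have "\<Psi> (Suc n) \<le> C * \<Psi> n ^ d" for n
  proof -
    have d1: "\<Psi> n ^ d = \<Psi> n * \<Psi> n ^ (d - 1)" using d by (cases d) auto
    have "u (Suc n) \<le> \<kappa> * max (u n ^ d) ((s * w n) ^ d)" using u_le[of n] by (simp add: sw_power)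
    also have "\<dots> \<le> \<kappa> * \<Psi> n ^ d"
      using kappa nonneg[of n] s_pos w_nonneg[of n] by (intro mult_left_mono max.boundedI power_mono) (auto simp: \<Psi>_def)
    also have "\<dots> \<le> C * \<Psi> n ^ d" using Psi_nonneg by (intro mult_right_mono) (auto simp: C_def)
    finally have 1: "u (Suc n) \<le> C * \<Psi> n ^ d" .
    have "s * w (Suc n) = inverse (s ^ (d - 2)) * (u n * (s * w n) ^ (d - 1))"
      unfolding sw_Suc[symmetric] using s_pos by simp
    also have "\<dots> \<le> inverse (s ^ (d - 2)) * (\<Psi> n * \<Psi> n ^ (d - 1))"
      using nonneg[of n] s_pos w_nonneg[of n] Psi_nonneg[of n]
      by (intro mult_left_mono mult_mono power_mono) (auto simp: \<Psi>_def)
    also have "\<dots> \<le> C * \<Psi> n ^ d" unfolding d1[symmetric] using Psi_nonneg by (intro mult_right_mono) (auto simp: C_def)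
    finally show ?thesis using 1 by (simp add: \<Psi>_def)
  qed
  then have ln_le: "ln (\<Psi> (Suc n)) \<le> ln (C * \<Psi> n ^ d)" for n
    using Psi_pos by (intro ln_mono) auto
  have "ln (\<Psi> (Suc n)) \<le> real d * ln (\<Psi> n) + ln C" for n
    using ln_le[of n] Psi_pos[of n] C by (simp add: ln_realpow ln_mult_pos add.commute)
  then show ?thesis by blast
qed

text \<open>The bound does not depend on \<open>n\<close>, so division by d^n makes the change of
  norm invisible in the limit.\<close>

lemma ln_M_minus_ln_Psi: "\<bar>ln (M n) - ln (\<Psi> n)\<bar> \<le> \<bar>ln s\<bar>"
proof -
  have w: "w n \<ge> 0" by (rule w_nonneg)
  have "\<Psi> n \<le> max 1 s * M n"
  proof -
    have "u n \<le> max 1 s * u n" using nonneg[of n] by (simp add: mult_le_cancel_right1)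
    moreover have "max 1 s * u n \<le> max 1 s * M n" "max 1 s * w n \<le> max 1 s * M n"
      by (intro mult_left_mono; simp add: M_def)+
    moreover have "s * w n \<le> max 1 s * w n" using w by (intro mult_right_mono) auto
    ultimately show ?thesis by (simp add: \<Psi>_def)
  qed
  then have "ln (\<Psi> n) \<le> ln (max 1 s * M n)" using Psi_pos by (intro ln_mono) auto
  then have 1: "ln (\<Psi> n) \<le> ln (max 1 s) + ln (M n)" using M_pos[of n] by (simp add: ln_mult_pos less_max_iff_disj)
  have "min 1 s * M n \<le> \<Psi> n"
  proof -
    have "min 1 s * u n \<le> u n" using nonneg[of n] by (simp add: mult_le_cancel_right2)
    moreover have "min 1 s * w n \<le> s * w n" using w by (intro mult_right_mono) auto
    moreover have "min 1 s * M n = max (min 1 s * u n) (min 1 s * w n)"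
      using s_pos by (simp add: M_def max_mult_distrib_left)
    ultimately show ?thesis by (simp only: \<Psi>_def) (rule max.mono)
  qed
  then have "ln (min 1 s * M n) \<le> ln (\<Psi> n)" using M_pos s_pos by (intro ln_mono) auto
  then have 2: "ln (min 1 s) + ln (M n) \<le> ln (\<Psi> n)" using M_pos[of n] s_pos by (simp add: ln_mult_pos)
  have "ln (max 1 s) \<le> \<bar>ln s\<bar>" "- \<bar>ln s\<bar> \<le> ln (min 1 s)"
    by (auto simp: max_def min_def)
  then show ?thesis using 1 2 by linarith
qed

lemma convergent_ln_M: "convergent (\<lambda>n. ln (M n) / real d ^ n)"
proof -
  obtain c where c: "\<And>n. ln (\<Psi> (Suc n)) \<le> real d * ln (\<Psi> n) + c" using ln_Psi_upper by blast
  let ?c = "ln \<kappa> + ln (max 1 (s ^ (d - 2)))"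
  have "convergent (\<lambda>n. ln (\<Psi> n) / real d ^ n)"
  proof (rule exp_growth_convergent[OF d])
    fix n show "\<bar>ln (\<Psi> (Suc n)) - real d * ln (\<Psi> n)\<bar> \<le> max c ?c"
      using c[of n] ln_Psi_lower[of n] by linarith
  qed
  moreover have "(\<lambda>n. ln (M n) / real d ^ n - ln (\<Psi> n) / real d ^ n) \<longlonglongrightarrow> 0"
  proof (rule tendsto_0_le)
    show "\<forall>\<^sub>F n in sequentially. norm (ln (M n) / real d ^ n - ln (\<Psi> n) / real d ^ n)
      \<le> norm (\<bar>ln s\<bar> / real d ^ n) * 1"
    proof (intro always_eventually allI)
      fix n
      have "ln (M n) / real d ^ n - ln (\<Psi> n) / real d ^ n = (ln (M n) - ln (\<Psi> n)) / real d ^ n"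
        by (simp add: diff_divide_distrib)
      then show "norm (ln (M n) / real d ^ n - ln (\<Psi> n) / real d ^ n) \<le> norm (\<bar>ln s\<bar> / real d ^ n) * 1"
        using ln_M_minus_ln_Psi[of n] by (simp add: divide_right_mono)
    qed
    show "(\<lambda>n. \<bar>ln s\<bar> / real d ^ n) \<longlonglongrightarrow> 0"
      using d by (intro LIMSEQ_divide_realpow_zero) simp
  qed
  ultimately show ?thesis
    using convergent_add[of "\<lambda>n. ln (M n) / real d ^ n - ln (\<Psi> n) / real d ^ n" "\<lambda>n. ln (\<Psi> n) / real d ^ n"]
    by (auto simp: convergent_def)
qed

section \<open>Explicit bounds for the local limit\<close>

definition "g = lim (\<lambda>n. ln (M n) / real d ^ n)"

lemma g_limit: "(\<lambda>n. ln (M n) / real d ^ n) \<longlonglongrightarrow> g"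
  using convergent_ln_M by (simp add: g_def convergent_LIMSEQ_iff)

lemma g_lower:
  assumes "\<And>n. n \<ge> k \<Longrightarrow> real d ^ n * a - b \<le> ln (M n)"
  shows "a \<le> g"
proof (rule LIMSEQ_le[OF _ g_limit])
  show "(\<lambda>n. a - b / real d ^ n) \<longlonglongrightarrow> a"
    using tendsto_diff[OF tendsto_const LIMSEQ_divide_realpow_zero[of "real d" b], of a] d by simp
  show "\<exists>N. \<forall>n\<ge>N. a - b / real d ^ n \<le> ln (M n) / real d ^ n"
    using assms d by (intro exI[of _ k]) (auto simp: field_simps)
qed

lemma g_upper:
  assumes "\<And>n. n \<ge> k \<Longrightarrow> ln (M n) \<le> real d ^ n * a"
  shows "g \<le> a"
proof (rule LIMSEQ_le_const2[OF g_limit])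
  show "\<exists>N. \<forall>n\<ge>N. ln (M n) / real d ^ n \<le> a"
    using assms d by (intro exI[of _ k]) (auto simp: field_simps)
qed

text \<open>With the weight max(1, L) on the denominator, the majorant \<Phi> satisfies \<Phi>(n+1)
  <= \<kappa> \<Phi>(n)^d without any loss in L. The estimate starts at n = 1: the value at n = 0
  already contains the factor max(1, L), and starting there would give log max(1, L) without the
  division by d.\<close>

lemma g_le: "g \<le> ln (max 1 L) / real d + ln \<kappa> + ln (max 1 r)"
proof -
  define L' where "L' = max 1 L"
  have L': "L' \<ge> 1" "L' \<ge> L" by (auto simp: L'_def)
  define \<Phi> where "\<Phi> n = max (u n) (L' * w n)" for n
  have Phi_nonneg: "\<Phi> n \<ge> 0" for n using nonneg[of n] by (simp add: \<Phi>_def le_max_iff_disj)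
  have M_le: "M n \<le> \<Phi> n" for n
  proof -
    have "w n \<le> L' * w n" using w_nonneg[of n] L' by (simp add: mult_le_cancel_right1)
    then show ?thesis by (auto simp: M_def \<Phi>_def)
  qed
  have Phi_pos: "\<Phi> n > 0" for n using M_pos[of n] M_le[of n] by linarith
  have step: "\<Phi> (Suc n) \<le> \<kappa> * \<Phi> n ^ d" for n
  proof -
    have d1: "\<Phi> n ^ d = \<Phi> n * \<Phi> n ^ (d - 1)" using d by (cases d) auto
    have pw: "L' \<le> L' ^ k" if "k \<ge> 1" for k
      using L' that power_increasing[of 1 k L'] by simp
    have "L * w n ^ d \<le> L' ^ d * w n ^ d"
      using pw[of d] L' d w_nonneg[of n] by (intro mult_right_mono) auto
    also have "\<dots> \<le> \<Phi> n ^ d" unfolding power_mult_distrib[symmetric]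
      using w_nonneg[of n] L' by (intro power_mono) (auto simp: \<Phi>_def)
    finally have "max (u n ^ d) (L * w n ^ d) \<le> \<Phi> n ^ d"
      using nonneg[of n] by (auto intro!: power_mono simp: \<Phi>_def)
    then have 1: "u (Suc n) \<le> \<kappa> * \<Phi> n ^ d"
      using u_le[of n] kappa by (meson mult_left_mono order_trans zero_le_one)
    have "L' * w (Suc n) = u n * (L' * w n ^ (d - 1))" by (simp add: w_Suc)
    also have "\<dots> \<le> u n * (L' ^ (d - 1) * w n ^ (d - 1))"
      using pw[of "d - 1"] d nonneg[of n] w_nonneg[of n] by (intro mult_left_mono mult_right_mono) auto
    also have "\<dots> \<le> \<Phi> n * \<Phi> n ^ (d - 1)" unfolding power_mult_distrib[symmetric]
      using nonneg[of n] w_nonneg[of n] L' Phi_nonneg[of n] by (intro mult_mono power_mono) (auto simp: \<Phi>_def)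
    also have "\<dots> \<le> \<kappa> * \<Phi> n ^ d" unfolding d1[symmetric]
      using kappa Phi_nonneg[of n] by (simp add: mult_le_cancel_right1)
    finally show ?thesis using 1 by (simp add: \<Phi>_def)
  qed
  have ln_le: "ln (\<Phi> (Suc n)) \<le> ln (\<kappa> * \<Phi> n ^ d)" for n
    using step[of n] Phi_pos by (intro ln_mono) auto
  have ln_step: "ln (\<Phi> (Suc n)) \<le> real d * ln (\<Phi> n) + ln \<kappa>" for n
    using ln_le[of n] Phi_pos[of n] kappa by (simp add: ln_realpow ln_mult_pos add.commute)
  have base: "ln (\<Phi> 1) \<le> ln L' + real d * ln (max 1 r) + ln \<kappa>"
  proof -
    have r1: "max 1 r ^ k \<ge> 1" for k by (intro one_le_power) simp
    have "max 1 r ^ d \<ge> max 1 r" using power_increasing[of 1 d "max 1 r"] d by simp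
    then have rle: "r \<le> max 1 r ^ d" by linarith
    have "max (r ^ d) L \<le> L' * max 1 r ^ d"
    proof -
      have "r ^ d \<le> 1 * max 1 r ^ d" using r by (simp add: power_mono)
      also have "\<dots> \<le> L' * max 1 r ^ d" using L' by (intro mult_right_mono) auto
      finally have 1: "r ^ d \<le> L' * max 1 r ^ d" .
      have "L * 1 \<le> L' * max 1 r ^ d" using L' L r1 by (intro mult_mono) auto
      with 1 show ?thesis by simp
    qed
    then have "u 1 \<le> \<kappa> * (L' * max 1 r ^ d)"
      using order_trans[OF u_le[of 0] mult_left_mono[of _ _ \<kappa>]] kappa by (simp add: init)
    moreover have "L' * w 1 \<le> \<kappa> * (L' * max 1 r ^ d)"
    proof -
      have "L' * w 1 = 1 * (L' * r)" using w_Suc[of 0] by (simp add: init)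
      also have "\<dots> \<le> \<kappa> * (L' * max 1 r ^ d)"
        using L' kappa rle r by (intro mult_mono mult_left_mono) auto
      finally show ?thesis .
    qed
    ultimately have "ln (\<Phi> 1) \<le> ln (\<kappa> * (L' * max 1 r ^ d))"
      using Phi_pos by (intro ln_mono) (auto simp: \<Phi>_def)
    then show ?thesis using kappa L' by (simp add: ln_mult_pos ln_realpow less_max_iff_disj)
  qed
  have bound: "ln (M n) \<le> real d ^ n * (ln L' / real d + ln \<kappa> + ln (max 1 r))" if n: "n \<ge> 1" for n
  proof -
    obtain m where m: "n = Suc m" using n by (cases n) auto
    have "ln (M n) \<le> ln (\<Phi> (Suc m))" unfolding m using M_pos M_le by (intro ln_mono) auto
    moreover have "ln (\<Phi> (Suc m)) \<le> real d ^ m * (ln (\<Phi> 1) + ln \<kappa>) - ln \<kappa>"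
      using exp_growth_upper[of d "ln \<kappa>" "\<lambda>n. ln (\<Phi> (Suc n))" m] d kappa ln_step by simp
    moreover have "ln \<kappa> \<ge> 0" using kappa by simp
    moreover have "real d ^ m * (ln (\<Phi> 1) + ln \<kappa>)
        \<le> real d ^ m * (ln L' + real d * ln (max 1 r) + real d * ln \<kappa>)"
    proof -
      have "2 * ln \<kappa> \<le> real d * ln \<kappa>" using d kappa by (intro mult_right_mono) auto
      then have "ln (\<Phi> 1) + ln \<kappa> \<le> ln L' + real d * ln (max 1 r) + real d * ln \<kappa>"
        using base by linarith
      then show ?thesis by (rule mult_left_mono) simp
    qed
    moreover have "real d ^ n * (ln L' / real d + (ln \<kappa> + ln (max 1 r)))
        = real d ^ m * (ln L' + real d * (ln \<kappa> + ln (max 1 r)))"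
      unfolding m by (rule power_Suc_scale) (use d in simp)
    then have "real d ^ n * (ln L' / real d + ln \<kappa> + ln (max 1 r))
        = real d ^ m * (ln L' + real d * ln (max 1 r) + real d * ln \<kappa>)"
      by (simp only: distrib_left ac_simps)
    ultimately show ?thesis by linarith
  qed
  show ?thesis using g_upper[of 1, OF bound] by (simp add: L'_def)
qed

lemma ln_Psi_exp_lower:
  "real d ^ n * (ln (\<Psi> 0) - (ln \<kappa> + ln (max 1 (s ^ (d - 2))))) \<le> ln (\<Psi> n)"
proof -
  let ?c = "ln \<kappa> + ln (max 1 (s ^ (d - 2)))"
  have c: "?c \<ge> 0" using kappa by simp
  show ?thesis
    using exp_growth_lower[OF d c, of "\<lambda>n. ln (\<Psi> n)" n] ln_Psi_lower c by simp
qed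

lemma g_lower_Psi: "ln (\<Psi> 0) - (ln \<kappa> + ln (max 1 (s ^ (d - 2)))) \<le> g"
  by (rule g_lower[of 0 _ "\<bar>ln s\<bar>"])
     (use ln_Psi_exp_lower ln_M_minus_ln_Psi in \<open>smt (verit)\<close>)

lemma g_ge_small:
  assumes "L \<le> 1"
  shows "ln r - ln \<kappa> \<le> g"
proof -
  have "s \<le> 1" using assms L d by (simp add: s_def powr_le1)
  then have "max 1 (s ^ (d - 2)) = 1" using s_pos by (intro max.absorb1 power_le_one) auto
  moreover have "ln r \<le> ln (\<Psi> 0)" using r by (intro ln_mono) (auto simp: \<Psi>_def init)
  ultimately show ?thesis using g_lower_Psi by simp
qed

text \<open>The start \<Psi>(0) >= s gives the main term and the factor s^(d-2) the loss. The loss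
  is zero for d = 2 and otherwise acceptable as long as log L is bounded in terms of |log
  r|.\<close>

lemma g_ge_moderate:
  assumes "L \<ge> 1"
  shows "ln L / real d - ln \<kappa> - real (d - 2) * (ln L / real d) \<le> g"
proof -
  have "s \<ge> 1" using assms by (simp add: s_def ge_one_powr_ge_zero)
  then have "max 1 (s ^ (d - 2)) = s ^ (d - 2)" by (simp add: max_def)
  moreover have "ln s \<le> ln (\<Psi> 0)" using s_pos by (intro ln_mono) (auto simp: \<Psi>_def init)
  ultimately show ?thesis using g_lower_Psi s_pos by (simp add: ln_realpow flip: ln_s)
qed

text \<open>For large \<open>L\<close> and \<open>d \<ge> 3\<close> the orbit lies in the basin of infinity from the first iterate on.\<close>
lemma g_ge_large:
  assumes "d \<ge> 3" and large: "L > \<kappa>\<^sup>2 * R ^ d" and R: "R \<ge> 1" "R \<ge> r"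
  shows "ln L / real d - ln \<kappa> \<le> g"
proof -
  \<comment> \<open>\<open>T\<close> is the ratio u/w guaranteed at the first iterate, where u >=
    L/\<kappa> and w = r.\<close>
  define T where "T = L / (\<kappa> * r)"
  have Rd: "R ^ d \<ge> R" using power_increasing[of 1 d R] R d by simp
  have k2: "\<kappa>\<^sup>2 \<ge> \<kappa>" using kappa by (simp add: power2_eq_square)
  have "\<kappa>\<^sup>2 * r \<le> \<kappa>\<^sup>2 * R ^ d" using Rd R by (intro mult_left_mono) auto
  then have "\<kappa>\<^sup>2 * r \<le> L" using large by linarith
  then have T_ge: "T \<ge> \<kappa>"
    using r kappa by (simp add: T_def field_simps power2_eq_square)
  have u1: "u 1 \<ge> L / \<kappa>"
  proof -
    have "\<kappa> * r ^ d \<le> \<kappa>\<^sup>2 * R ^ d" using k2 kappa r R by (intro mult_mono power_mono) auto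
    then show ?thesis using w_dom[of 0] large kappa by (simp add: init field_simps)
  qed
  have L1: "L \<ge> 1"
  proof -
    have "1 * 1 \<le> \<kappa>\<^sup>2 * R ^ d" using kappa R by (intro mult_mono one_le_power) auto
    then show ?thesis using large by simp
  qed
  \<comment> \<open>This makes \<open>u_dom\<close> applicable whenever u >= T w. It amounts to
    L^(d-1) > \<kappa>^(d+1) r^d, which follows from the size of L because d + 1 <= 2 (d - 1) for d
    >= 3.\<close>
  have Td: "T ^ d > \<kappa> * L"
  proof -
    have pos: "0 < \<kappa>\<^sup>2 * R ^ d" using kappa R by simp
    have "\<kappa> ^ (d + 1) * r ^ d \<le> (\<kappa>\<^sup>2) ^ (d - 1) * (R ^ d) ^ (d - 1)"
    proof (rule mult_mono)
      show "\<kappa> ^ (d + 1) \<le> (\<kappa>\<^sup>2) ^ (d - 1)" unfolding power_mult[symmetric]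
        using kappa assms(1) by (intro power_increasing) auto
      have "r ^ d \<le> R ^ d" using r R by (intro power_mono) auto
      also have "\<dots> \<le> (R ^ d) ^ (d - 1)" using d R power_increasing[of 1 "d - 1" "R ^ d"] by simp
      finally show "r ^ d \<le> (R ^ d) ^ (d - 1)" .
    qed (use kappa r in auto)
    also have "\<dots> = (\<kappa>\<^sup>2 * R ^ d) ^ (d - 1)" by (simp add: power_mult_distrib)
    also have "\<dots> < L ^ (d - 1)" using large pos d by (intro power_strict_mono) auto
    finally have "L * (\<kappa> ^ (d + 1) * r ^ d) < L * L ^ (d - 1)" using L by simp
    also have "L * L ^ (d - 1) = L ^ d" using d by (cases d) auto
    finally have "(\<kappa> * L) * (\<kappa> * r) ^ d < L ^ d" by (simp add: power_mult_distrib mult_ac)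
    then show ?thesis using kappa r by (simp add: T_def power_divide pos_less_divide_eq)
  qed
  have T_pos: "T > 0" using T_ge kappa by linarith
  have inv: "u (Suc n) > 0 \<and> T * w (Suc n) \<le> u (Suc n) \<and> u (Suc n) ^ d \<le> \<kappa> * u (Suc (Suc n))" for n
  proof -
    have dom: "u m ^ d \<le> \<kappa> * u (Suc m)" if "u m > 0" "T * w m \<le> u m" for m
    proof (rule u_dom)
      have le: "T ^ d * w m ^ d \<le> u m ^ d"
        using that T_pos w_nonneg[of m] power_mono[of "T * w m" "u m" d] by (simp add: power_mult_distrib)
      show "\<kappa> * (L * w m ^ d) < u m ^ d"
      proof (cases "w m = 0")
        case True
        then have "w m ^ d = 0" using d by simp
        then have "\<kappa> * (L * w m ^ d) = 0" by (simp only: mult_zero_right)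
        then show ?thesis using that by (simp only:) simp
      next
        case False
        then have "\<kappa> * L * w m ^ d < T ^ d * w m ^ d" using Td w_nonneg[of m] by simp
        then show ?thesis using le by (simp add: mult_ac)
      qed
    qed
    show ?thesis
    proof (induction n)
      case 0
      have "T * w 1 = L / \<kappa>" using r w_Suc[of 0] by (simp add: init T_def)
      moreover have "L / \<kappa> > 0" using L kappa by simp
      ultimately have "u 1 > 0" "T * w 1 \<le> u 1" using u1 by linarith+
      then show ?case using dom[of 1] by simp
    next
      case (Suc n)
      let ?m = "Suc n"
      have um: "u ?m > 0" "T * w ?m \<le> u ?m" "u ?m ^ d \<le> \<kappa> * u (Suc ?m)" using Suc by auto
      have pos: "u (Suc ?m) > 0"
      proof -
        have "0 < \<kappa> * u (Suc ?m)" using zero_less_power[OF um(1), of d] um(3) by linarith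
        then show ?thesis using kappa by (simp add: zero_less_mult_iff)
      qed
      have d2: "d - 1 = Suc (d - 2)" "d = Suc (d - 1)" using d by auto
      \<comment> \<open>Again d >= 3: the spare factor T^(d-2) pays for the \<kappa> lost in one
        step, so the ratio stays at least \<open>T\<close>.\<close>
      have Tp: "\<kappa> \<le> T ^ (d - 2)"
      proof -
        have "T ^ 1 \<le> T ^ (d - 2)" using T_ge kappa assms(1) by (intro power_increasing) linarith+
        then show ?thesis using T_ge by simp
      qed
      have "\<kappa> * (T * w (Suc ?m)) \<le> T ^ (d - 2) * (T * w (Suc ?m))"
        using Tp T_pos w_nonneg[of "Suc ?m"] by (intro mult_right_mono) auto
      also have "\<dots> = u ?m * (T * w ?m) ^ (d - 1)"
        unfolding w_Suc[of ?m] power_mult_distrib d2(1) by (simp add: mult_ac)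
      also have "\<dots> \<le> u ?m * u ?m ^ (d - 1)"
        using um T_pos w_nonneg[of ?m] by (intro mult_left_mono power_mono) auto
      also have "\<dots> = u ?m ^ d" using d by (cases d) auto
      also have "\<dots> \<le> \<kappa> * u (Suc ?m)" by (rule um)
      finally have "T * w (Suc ?m) \<le> u (Suc ?m)" using kappa by simp
      then show ?case using pos dom[of "Suc ?m"] by blast
    qed
  qed
  have ln_step: "real d * ln (u (Suc n)) - ln \<kappa> \<le> ln (u (Suc (Suc n)))" for n
  proof -
    have "ln (u (Suc n) ^ d) \<le> ln (\<kappa> * u (Suc (Suc n)))"
      using inv[of n] by (intro ln_mono) auto
    then show ?thesis using inv[of n] inv[of "Suc n"] kappa by (simp add: ln_realpow ln_mult_pos)
  qed
  have bound: "real d ^ n * (ln L / real d - ln \<kappa>) - 0 \<le> ln (M n)" if n: "n \<ge> 1" for n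
  proof -
    obtain m where m: "n = Suc m" using n by (cases n) auto
    have "ln (L / \<kappa>) \<le> ln (u 1)" using u1 L kappa by (intro ln_mono) auto
    then have b: "ln L - ln \<kappa> \<le> ln (u 1)" using L kappa by (simp add: ln_div)
    have "2 * ln \<kappa> \<le> real d * ln \<kappa>" using d kappa by (intro mult_right_mono) auto
    then have "ln L - real d * ln \<kappa> \<le> ln (u 1) - ln \<kappa>" using b by linarith
    then have "real d ^ m * (ln L - real d * ln \<kappa>) \<le> real d ^ m * (ln (u 1) - ln \<kappa>)"
      by (rule mult_left_mono) simp
    moreover have "real d ^ m * (ln (u 1) - ln \<kappa>) + ln \<kappa> \<le> ln (u (Suc m))"
      using exp_growth_lower[of d "ln \<kappa>" "\<lambda>n. ln (u (Suc n))" m] d kappa ln_step by simp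
    moreover have "ln \<kappa> \<ge> 0" using kappa by simp
    moreover have "ln (u (Suc m)) \<le> ln (M n)" using inv[of m] by (intro ln_mono) (auto simp: m M_def)
    moreover have "real d ^ n * (ln L / real d - ln \<kappa>) = real d ^ m * (ln L - real d * ln \<kappa>)"
      using power_Suc_scale[of d m "ln L" "- ln \<kappa>"] d by (simp add: m)
    ultimately show ?thesis by linarith
  qed
  show ?thesis by (rule g_lower[of 1, OF bound])
qed

text \<open>For L > 1 the threshold is \<kappa>^2 R^d with R = max(r, 1/r). Above it and for d >= 3
  the basin estimate applies. Below it log L <= 2 log \<kappa> + d |log r|, which bounds the loss in
  \<open>g_ge_moderate\<close>; together with the one log \<kappa> lost there this gives the stated
  error.\<close>

theorem g_bound: "\<bar>g - ln (max 1 L) / real d\<bar> \<le> 3 * ln \<kappa> + real d * \<bar>ln r\<bar>"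
proof -
  have lnk: "ln \<kappa> \<ge> 0" using kappa by simp
  have d1: "\<bar>ln r\<bar> \<le> real d * \<bar>ln r\<bar>" using d by (simp add: mult_le_cancel_right1)
  have "ln (max 1 r) \<le> \<bar>ln r\<bar>" by (auto simp: max_def)
  then have up: "g - ln (max 1 L) / real d \<le> 3 * ln \<kappa> + real d * \<bar>ln r\<bar>"
    using g_le d1 lnk by linarith
  have "ln (max 1 L) / real d - g \<le> 3 * ln \<kappa> + real d * \<bar>ln r\<bar>"
  proof (cases "L \<le> 1")
    case True
    then have "ln (max 1 L) = 0" by (simp add: max_def)
    then show ?thesis using g_ge_small[OF True] d1 lnk by auto
  next
    case False
    define R where "R = max r (inverse r)"
    have R: "R \<ge> 1" "R \<ge> r" "ln R = \<bar>ln r\<bar>"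
    proof -
      show "R \<ge> r" by (simp add: R_def)
      show "R \<ge> 1" using r by (cases "r \<ge> 1") (auto simp: R_def le_max_iff_disj one_le_inverse_iff)
      show "ln R = \<bar>ln r\<bar>"
      proof (cases "r \<ge> 1")
        case True
        then have "inverse r \<le> r" using inverse_le_1_iff[of r] by linarith
        then show ?thesis using True by (simp add: R_def max_def)
      next
        case False
        then have "inverse r \<ge> 1" using r by (simp add: one_le_inverse_iff)
        then have "R = inverse r" using False by (simp add: R_def max_def)
        then show ?thesis using False r by (simp add: ln_inverse)
      qed
    qed
    have L': "max 1 L = L" using False by simp
    show ?thesis
    proof (cases "d \<ge> 3 \<and> L > \<kappa>\<^sup>2 * R ^ d")
      case True
      have "real d * \<bar>ln r\<bar> \<ge> 0" by simp
      then show ?thesis using g_ge_large[of R] True R lnk unfolding L' by linarith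
    next
      case small: False
      have "real (d - 2) * (ln L / real d) \<le> 2 * ln \<kappa> + real d * \<bar>ln r\<bar>"
      proof (cases "d = 2")
        case True
        then show ?thesis using lnk by simp
      next
        case False
        then have "L \<le> \<kappa>\<^sup>2 * R ^ d" using small d by linarith
        then have "ln L \<le> ln (\<kappa>\<^sup>2 * R ^ d)" using L by (intro ln_mono) auto
        then have lnL: "ln L \<le> 2 * ln \<kappa> + real d * \<bar>ln r\<bar>"
          using kappa R by (simp add: ln_mult_pos ln_realpow)
        have "real (d - 2) * (ln L / real d) \<le> real d * (ln L / real d)"
          using \<open>\<not> L \<le> 1\<close> by (intro mult_right_mono) auto
        then show ?thesis using lnL d by simp
      qed
      then show ?thesis using g_ge_moderate False unfolding L' by linarith
    qed
  qed
  with up show ?thesis by linarith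
qed

text \<open>Good reduction: when \<alpha> and \<lambda> are units at an ultrametric place, the upper
  and lower growth estimates both have constant 1. This is what makes the set of contributing places
  independent of the iterate.\<close>

lemma M_eq_1:
  assumes "\<kappa> = 1" "L = 1" "r = 1"
  shows "M n = 1"
proof -
  have s: "s = 1" using s_def assms(2) by simp
  then have Psi: "\<Psi> = M" by (simp add: \<Psi>_def M_def fun_eq_iff)
  show ?thesis
  proof (induction n)
    case 0
    show ?case by (simp add: M_def init assms)
  next
    case (Suc n)
    have le: "0 \<le> u n" "u n \<le> 1" "0 \<le> w n" "w n \<le> 1"
      using Suc nonneg[of n] w_nonneg[of n] by (auto simp: M_def max_def split: if_splits)
    have "1 \<le> M (Suc n)" using Psi_lower[of n] Suc unfolding Psi s by (simp add: assms)
    moreover have "max (u n ^ d) (L * w n ^ d) \<le> 1" using le by (simp add: assms power_le_one)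
    then have "u (Suc n) \<le> 1" using u_le[of n] unfolding assms(1) by linarith
    moreover have "w (Suc n) \<le> 1" unfolding w_Suc using le by (intro mult_le_one power_le_one) auto
    ultimately show ?case by (simp add: M_def)
  qed
qed

end

section \<open>Heights as sums over places\<close>

definition pabs :: "nat \<Rightarrow> complex \<Rightarrow> real" where
  "pabs p = (SOME N. padic_abs p N)"

text \<open>The index 0 denotes the archimedean place.  One extension of each absolute value is fixed, and
  the other places above it are accounted for by letting the argument run through its conjugates.\<close>
definition loc :: "nat \<Rightarrow> complex \<Rightarrow> real" where
  "loc v x = (if v = 0 then cmod x else pabs v x)"

definition kap :: "nat \<Rightarrow> real" where
  "kap v = (if v = 0 then 2 else 1)"

definition place :: "nat \<Rightarrow> bool" where
  "place v \<longleftrightarrow> v = 0 \<or> prime v"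

lemma padic_abs_pabs: "prime p \<Longrightarrow> padic_abs p (pabs p)"
  unfolding pabs_def using padic_abs_exists by (rule someI_ex)

lemma loc_prime: "prime p \<Longrightarrow> loc p = pabs p"
  using prime_gt_0_nat by (auto simp: loc_def fun_eq_iff)

lemma kap_ge_1: "kap v \<ge> 1" by (simp add: kap_def)

context
  fixes v assumes v: "place v"
begin

lemma loc_0 [simp]: "loc v 0 = 0"
  and loc_pos: "algebraic x \<Longrightarrow> x \<noteq> 0 \<Longrightarrow> loc v x > 0"
  and loc_mult: "algebraic x \<Longrightarrow> algebraic y \<Longrightarrow> loc v (x * y) = loc v x * loc v y"
  using v padic_abs_pabs[of v] by (auto simp: place_def loc_def padic_abs_def norm_mult)

lemma loc_add:
  assumes "algebraic x" "algebraic y"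
  shows "loc v (x + y) \<le> kap v * max (loc v x) (loc v y)"
proof (cases "v = 0")
  case True
  have "cmod (x + y) \<le> cmod x + cmod y" by (rule norm_triangle_ineq)
  also have "\<dots> \<le> 2 * max (cmod x) (cmod y)" by simp
  finally show ?thesis using True by (simp add: loc_def kap_def)
next
  case False
  then show ?thesis
    using v padic_abs_pabs[of v] assms by (simp add: place_def loc_def kap_def padic_abs_def)
qed

lemma loc_nonneg: "algebraic x \<Longrightarrow> loc v x \<ge> 0"
  using loc_pos[of x] by (cases "x = 0") auto

lemma loc_1 [simp]: "loc v 1 = 1"
  using loc_mult[of 1 1] loc_pos[of 1] by simp

lemma loc_minus: "algebraic x \<Longrightarrow> loc v (- x) = loc v x"
proof -
  assume x: "algebraic x"
  have m1: "algebraic (- 1 :: complex)" by simp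
  have "loc v (- 1) * loc v (- 1) = 1" using loc_mult[OF m1 m1] by simp
  then have "loc v (- 1) = 1" using loc_pos[OF m1] by (simp add: square_eq_1_iff)
  then show ?thesis using loc_mult[OF m1 x] by simp
qed

lemma loc_power: "algebraic x \<Longrightarrow> loc v (x ^ n) = loc v x ^ n"
  by (induction n) (simp_all add: loc_mult algebraic_power)

lemma loc_prod: "finite A \<Longrightarrow> (\<And>i. i \<in> A \<Longrightarrow> algebraic (f i)) \<Longrightarrow>
    algebraic (\<Prod>i\<in>A. f i) \<and> loc v (\<Prod>i\<in>A. f i) = (\<Prod>i\<in>A. loc v (f i))"
  by (induction A rule: finite_induct) (auto simp: loc_mult algebraic_mult)

text \<open>Apply the triangle inequality to x = (x + y) + (-y); the hypothesis excludes that y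
  attains the maximum. It supplies \<open>u_dom\<close> and \<open>w_dom\<close> of the local
  orbits.\<close>

lemma loc_dominant:
  assumes "algebraic x" "algebraic y" "kap v * loc v y < loc v x"
  shows "loc v x \<le> kap v * loc v (x + y)"
proof -
  have "loc v ((x + y) + (- y)) \<le> kap v * max (loc v (x + y)) (loc v (- y))"
    using assms by (intro loc_add algebraic_add) auto
  then have "loc v x \<le> max (kap v * loc v (x + y)) (kap v * loc v y)"
    using kap_ge_1[of v] assms(2) by (simp add: loc_minus max_mult_distrib_left)
  then show ?thesis using assms(3) by linarith
qed

end

section \<open>Ultrametric places and Gauss norms\<close>

lemma loc_of_int:
  assumes "prime p" "c \<noteq> 0"
  shows "loc p (of_int c) = real p powr (- real (multiplicity (int p) c))"
  using assms padic_abs_pabs[of p] by (simp add: loc_prime padic_abs_def)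

lemma loc_of_int_le_1: "prime p \<Longrightarrow> loc p (of_int c) \<le> 1"
  using loc_0[of p] prime_ge_1_nat[of p] powr_mono[of "- real (multiplicity (int p) c)" 0 "real p"]
  by (cases "c = 0") (auto simp: loc_of_int place_def)

lemma loc_of_int_eq_1: "prime p \<Longrightarrow> \<not> int p dvd c \<Longrightarrow> loc p (of_int c) = 1"
  using prime_gt_0_nat[of p]
  by (cases "c = 0") (auto simp: loc_of_int not_dvd_imp_multiplicity_0)

lemma loc_ultrametric:
  assumes "prime p" "algebraic x" "algebraic y"
  shows "loc p (x + y) \<le> max (loc p x) (loc p y)"
  using loc_add[of p x y] assms prime_gt_0_nat[of p] by (simp add: place_def kap_def)

lemma loc_ultrametric_eq:
  assumes "prime p" "algebraic x" "algebraic y" "loc p y < loc p x"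
  shows "loc p (x + y) = loc p x" "loc p (y + x) = loc p x"
proof -
  show "loc p (x + y) = loc p x"
    using loc_ultrametric[OF assms(1-3)] loc_dominant[of p x y] assms prime_gt_0_nat[of p]
    by (simp add: place_def kap_def)
  then show "loc p (y + x) = loc p x" by (simp add: add.commute)
qed

text \<open>A relation in place of a maximum, so that the bound and an index attaining it are
  directly at hand.\<close>

definition gauss_norm :: "nat \<Rightarrow> complex poly \<Rightarrow> real \<Rightarrow> bool" where
  "gauss_norm p f m \<longleftrightarrow> (\<forall>k. loc p (coeff f k) \<le> m) \<and> (\<exists>k. loc p (coeff f k) = m)"

lemma gauss_norm_unique: "gauss_norm p f m \<Longrightarrow> gauss_norm p f m' \<Longrightarrow> m = m'"
  unfolding gauss_norm_def by (metis order_antisym)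

text \<open>Some coefficient of the product has a strictly dominant summand. If |y| <= 1, take the
  last index attaining \<open>m\<close>, one place up in the product; if |y| > 1, take the first
  such index, where the summand with the factor y dominates.\<close>

lemma gauss_norm_linear_mult:
  assumes p: "prime p" and f: "\<And>k. algebraic (coeff f k)" and y: "algebraic y"
    and m: "gauss_norm p f m" "m > 0"
  shows "gauss_norm p ([:- y, 1:] * f) (m * max 1 (loc p y))"
proof -
  have pl: "place p" using p by (simp add: place_def)
  note [simp] = loc_0[OF pl] and mult = loc_mult[OF pl] and minus = loc_minus[OF pl]
  define g where "g = [:- y, 1:] * f"
  have g0: "coeff g 0 = - (y * coeff f 0)" by (simp add: g_def)
  have gS: "coeff g (Suc k) = coeff f k + - (y * coeff f (Suc k))" for k by (simp add: g_def)
  have y0: "loc p y \<ge> 0" by (rule loc_nonneg[OF pl y])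
  have le: "loc p (coeff f k) \<le> m" for k using m by (simp add: gauss_norm_def)
  have f0: "loc p (coeff f k) \<ge> 0" for k by (rule loc_nonneg[OF pl f])
  have yf_alg: "algebraic (- (y * coeff f k))" for k using algebraic_mult[OF y f] by simp
  have yf: "loc p (- (y * coeff f k)) = loc p y * loc p (coeff f k)" for k
    by (simp add: minus[OF algebraic_mult[OF y f]] mult y f)
  have yf_le: "loc p y * loc p (coeff f k) \<le> m * max 1 (loc p y)" for k
    using le[of k] y0 f0[of k] m by (subst mult.commute, intro mult_mono) auto
  have f_le: "loc p (coeff f k) \<le> m * max 1 (loc p y)" for k
    using mult_mono[OF le[of k], of 1 "max 1 (loc p y)"] m by simp
  have upper: "loc p (coeff g k) \<le> m * max 1 (loc p y)" for k
  proof (cases k)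
    case 0
    then show ?thesis using yf_le by (simp only: g0 yf)
  next
    case (Suc j)
    then show ?thesis
      using loc_ultrametric[OF p f[of j] yf_alg[of "Suc j"]] yf_le[of "Suc j"] f_le[of j]
      unfolding Suc gS yf by linarith
  qed
  have "\<exists>k. loc p (coeff g k) = m * max 1 (loc p y)"
  proof (cases "loc p y \<le> 1")
    case True
    define K where "K = {k. loc p (coeff f k) = m}"
    have "K \<subseteq> {..degree f}"
    proof
      fix k assume "k \<in> K"
      then have "coeff f k \<noteq> 0" using m by (auto simp: K_def)
      then show "k \<in> {..degree f}" by (simp add: le_degree)
    qed
    then have fin: "finite K" by (rule finite_subset) simp
    have "K \<noteq> {}" using m by (auto simp: gauss_norm_def K_def)
    define k where "k = Max K"
    have k: "loc p (coeff f k) = m" using Max_in[OF fin \<open>K \<noteq> {}\<close>] by (simp add: k_def K_def)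
    have "Suc k \<notin> K" using Max_ge[OF fin, of "Suc k"] by (auto simp: k_def)
    then have "loc p (coeff f (Suc k)) < m" using le[of "Suc k"] by (simp add: K_def)
    then have "loc p y * loc p (coeff f (Suc k)) < m"
      using True mult_right_mono[OF True f0[of "Suc k"]] by simp
    then have "loc p (coeff g (Suc k)) = m"
      using loc_ultrametric_eq(1)[OF p f[of k] yf_alg[of "Suc k"]] unfolding gS yf k by simp
    then show ?thesis using True by (auto simp: max_def)
  next
    case False
    define k where "k = (LEAST k. loc p (coeff f k) = m)"
    have k: "loc p (coeff f k) = m"
      unfolding k_def by (rule LeastI_ex[of "\<lambda>k. loc p (coeff f k) = m"])
        (use m in \<open>simp add: gauss_norm_def\<close>)
    have "loc p (coeff g k) = loc p y * m"
    proof (cases k)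
      case 0
      show ?thesis using k unfolding 0 g0 yf by simp
    next
      case (Suc j)
      then have "loc p (coeff f j) \<noteq> m" using not_less_Least[of j "\<lambda>k. loc p (coeff f k) = m"] by (simp add: k_def)
      then have "loc p (coeff f j) < m" using le[of j] by simp
      also have "m < loc p y * m" using False m by simp
      finally have "loc p (coeff f j) < loc p (- (y * coeff f (Suc j)))" using k unfolding Suc yf by simp
      from loc_ultrametric_eq(2)[OF p yf_alg f this] show ?thesis using k unfolding Suc gS yf by simp
    qed
    then show ?thesis using False by (auto simp: max_def mult.commute)
  qed
  then show ?thesis using upper unfolding gauss_norm_def g_def by blast
qed

lemma gauss_norm_split:
  assumes p: "prime p" and a: "algebraic a" "a \<noteq> 0" and Z: "finite Z" "\<And>y. y \<in> Z \<Longrightarrow> algebraic y"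
  shows "(\<forall>k. algebraic (coeff (smult a (\<Prod>y\<in>Z. [:- y, 1:])) k)) \<and>
    gauss_norm p (smult a (\<Prod>y\<in>Z. [:- y, 1:])) (loc p a * (\<Prod>y\<in>Z. max 1 (loc p y)))"
  using Z
proof (induction Z rule: finite_induct)
  case empty
  have "loc p (coeff [:a:] k) \<le> loc p a" for k
    using loc_0[of p] loc_pos[of p a] a p by (cases k) (auto simp: place_def)
  moreover have "loc p (coeff [:a:] 0) = loc p a" by simp
  ultimately have "gauss_norm p [:a:] (loc p a)" unfolding gauss_norm_def by blast
  moreover have "algebraic (coeff [:a:] k)" for k using a by (cases k) auto
  ultimately show ?case by simp
next
  case (insert y Z)
  let ?f = "smult a (\<Prod>y\<in>Z. [:- y, 1:])" and ?m = "loc p a * (\<Prod>y\<in>Z. max 1 (loc p y))"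
  have IH: "\<And>k. algebraic (coeff ?f k)" "gauss_norm p ?f ?m" using insert by auto
  have y: "algebraic y" using insert by auto
  have "?m > 0" using loc_pos[of p a] a p by (intro mult_pos_pos prod_pos) (auto simp: place_def less_max_iff_disj)
  from gauss_norm_linear_mult[OF p IH(1) y IH(2) this]
  have "gauss_norm p ([:- y, 1:] * ?f) (?m * max 1 (loc p y))" .
  moreover have "[:- y, 1:] * ?f = smult a (\<Prod>y\<in>insert y Z. [:- y, 1:])"
    using insert by (simp add: mult_smult_right)
  moreover have "?m * max 1 (loc p y) = loc p a * (\<Prod>y\<in>insert y Z. max 1 (loc p y))"
    using insert by (simp add: mult_ac)
  moreover have "algebraic (coeff ([:- y, 1:] * ?f) k)" for k
  proof (cases k)
    case 0
    then show ?thesis using algebraic_mult[OF y IH(1)[of 0]] by (simp add: mult_ac)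
  next
    case (Suc j)
    have "algebraic (coeff ?f j + - (y * coeff ?f (Suc j)))"
      by (intro algebraic_add algebraic_minus algebraic_mult IH y)
    moreover have "coeff ([:- y, 1:] * ?f) k = coeff ?f j + - (y * coeff ?f (Suc j))"
      by (simp add: Suc algebra_simps)
    ultimately show ?thesis by (simp only:)
  qed
  ultimately show ?case by (simp only:) simp
qed

text \<open>The Gauss norm of the minimal polynomial is computed twice: from its linear factors it
  is the left-hand side, and by primitivity it is 1.\<close>

lemma gauss_lemma:
  assumes p: "prime p" and x: "algebraic x"
  shows "loc p (of_int (lead_coeff (min_int_poly x))) * (\<Prod>y\<in>conjs x. max 1 (loc p y)) = 1"
proof -
  let ?P = "min_int_poly x"
  note m = min_int_poly[OF x]
  have "?P \<noteq> 0" using m by auto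
  then have "gauss_norm p (cpoly ?P) (loc p (of_int (lead_coeff ?P)) * (\<Prod>y\<in>conjs x. max 1 (loc p y)))"
    using gauss_norm_split[OF p _ _ finite_conjs[OF x] algebraic_conjs[OF x], of "of_int (lead_coeff ?P)"]
    by (simp flip: min_int_poly_conjs[OF x])
  \<comment> \<open>A prime dividing all coefficients would be a nontrivial factor of an irreducible
    polynomial of positive degree.\<close>
  moreover have "\<exists>k. \<not> int p dvd coeff ?P k"
  proof (rule ccontr)
    assume "\<not> ?thesis"
    then have "[:int p:] dvd ?P" by (simp add: const_poly_dvd_iff)
    then obtain Q where Q: "?P = [:int p:] * Q" by blast
    have "\<not> is_unit [:int p:]" using p by (auto simp: is_unit_const_poly_iff prime_nat_iff)
    then have "is_unit Q" using irreducibleD[OF m(1) Q] by blast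
    then have "degree Q = 0" by (auto simp: is_unit_poly_iff)
    then show False using m(2) Q p by (simp add: prime_gt_0_nat)
  qed
  then have "gauss_norm p (cpoly ?P) 1"
    unfolding gauss_norm_def using p by (auto simp: coeff_map_poly loc_of_int_le_1 intro: loc_of_int_eq_1)
  ultimately show ?thesis by (rule gauss_norm_unique)
qed

section \<open>Product formula and heights over finite sets of primes\<close>

lemma product_formula_int:
  assumes "c \<noteq> 0" "finite S" "\<And>p. p \<in> S \<Longrightarrow> prime p" "\<And>p. prime p \<Longrightarrow> int p dvd c \<Longrightarrow> p \<in> S"
  shows "(\<Sum>v\<in>insert 0 S. ln (loc v (of_int c))) = 0"
proof -
  have S0: "0 \<notin> S" using assms(3)[of 0] by auto
  have pS: "p > 0" if "p \<in> S" for p using assms(3)[OF that] prime_gt_0_nat by blast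
  have sub: "prime_factors c \<subseteq> int ` S"
  proof
    fix q assume "q \<in> prime_factors c"
    then have q: "prime q" "q dvd c" by auto
    then have "q \<ge> 0" using prime_ge_0_int by blast
    then obtain p where p: "q = int p" by (rule nonneg_int_cases)
    then have "prime p" using q by simp
    then show "q \<in> int ` S" using assms(4)[of p] q p by blast
  qed
  have "real_of_int \<bar>c\<bar> = real_of_int (\<Prod>q\<in>prime_factors c. q ^ multiplicity q c)"
    using prod_prime_factors[OF assms(1)] by simp
  also have "(\<Prod>q\<in>prime_factors c. q ^ multiplicity q c) = (\<Prod>q\<in>int ` S. q ^ multiplicity q c)"
  proof (rule prod.mono_neutral_left)
    show "\<forall>q\<in>int ` S - prime_factors c. q ^ multiplicity q c = 1"
    proof clarify
      fix p assume p: "p \<in> S" "int p \<notin> prime_factors c"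
      then have "\<not> int p dvd c" using assms(1,3) by (auto simp: in_prime_factors_iff)
      then show "int p ^ multiplicity (int p) c = 1" by (simp add: not_dvd_imp_multiplicity_0)
    qed
  qed (use sub assms in auto)
  also have "\<dots> = (\<Prod>p\<in>S. int p ^ multiplicity (int p) c)"
    by (simp add: prod.reindex inj_on_def)
  finally have "ln (real_of_int \<bar>c\<bar>) = ln (\<Prod>p\<in>S. real p ^ multiplicity (int p) c)" by simp
  also have "\<dots> = (\<Sum>p\<in>S. ln (real p ^ multiplicity (int p) c))"
    using pS by (intro ln_prod) (auto simp: assms)
  also have "\<dots> = (\<Sum>p\<in>S. real (multiplicity (int p) c) * ln (real p))"
    using pS by (intro sum.cong) (auto simp: ln_realpow)
  also have "\<dots> = (\<Sum>p\<in>S. - ln (loc p (of_int c)))"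
    using pS assms by (intro sum.cong) (auto simp: loc_of_int ln_powr)
  finally show ?thesis using assms(2) S0 by (simp add: loc_def[of 0] sum_negf)
qed

text \<open>Away from these primes a nonzero \<open>x\<close> and all its conjugates are units. The
  constant coefficient is consulted only when nonzero, which keeps the set finite for
  \<open>x = 0\<close>.\<close>

definition bad_primes :: "complex \<Rightarrow> nat set" where
  "bad_primes x = {p. prime p \<and> (int p dvd lead_coeff (min_int_poly x) \<or>
     coeff (min_int_poly x) 0 \<noteq> 0 \<and> int p dvd coeff (min_int_poly x) 0)}"

definition prime_set :: "nat set \<Rightarrow> bool" where
  "prime_set S \<longleftrightarrow> finite S \<and> (\<forall>p\<in>S. prime p)"

lemma prime_set_Un: "prime_set A \<Longrightarrow> prime_set B \<Longrightarrow> prime_set (A \<union> B)"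
  by (auto simp: prime_set_def)

lemma prime_setD:
  assumes "prime_set S"
  shows "finite S" "0 \<notin> S" "p \<in> S \<Longrightarrow> prime p" "v \<in> insert 0 S \<Longrightarrow> place v"
  using assms by (auto simp: prime_set_def place_def)

lemma finite_prime_divisors_int:
  assumes "c \<noteq> 0" shows "finite {p. prime p \<and> int p dvd c}"
proof (rule finite_subset)
  show "{p. prime p \<and> int p dvd c} \<subseteq> {..nat \<bar>c\<bar>}"
  proof
    fix p assume "p \<in> {p. prime p \<and> int p dvd c}"
    then have "int p dvd c" by simp
    then have "int p \<le> \<bar>c\<bar>" using dvd_imp_le_int[OF assms] by force
    then show "p \<in> {..nat \<bar>c\<bar>}" by simp
  qed
qed simp

lemma prime_set_bad_primes:
  assumes "algebraic x" shows "prime_set (bad_primes x)"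
proof -
  have "min_int_poly x \<noteq> 0" using min_int_poly[OF assms] by auto
  then have "finite ({p. prime p \<and> int p dvd lead_coeff (min_int_poly x)} \<union>
     (if coeff (min_int_poly x) 0 = 0 then {} else {p. prime p \<and> int p dvd coeff (min_int_poly x) 0}))"
    using finite_prime_divisors_int by simp
  then have "finite (bad_primes x)"
    by (rule finite_subset[rotated]) (auto simp: bad_primes_def)
  then show ?thesis by (simp add: prime_set_def bad_primes_def)
qed

text \<open>The product formula turns log |a| for the leading coefficient a into minus the sum of
  its p-adic logarithms, and Gauss's lemma turns each of these into a sum over conjugates.\<close>

lemma weil_height_places:
  assumes x: "algebraic x" and S: "prime_set S" "bad_primes x \<subseteq> S"
  shows "real (degree (min_int_poly x)) * weil_height x
    = (\<Sum>y\<in>conjs x. \<Sum>v\<in>insert 0 S. ln (max 1 (loc v y)))"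
proof -
  let ?P = "min_int_poly x"
  let ?a = "lead_coeff ?P"
  note m = min_int_poly[OF x]
  have a: "?a \<noteq> 0" using m by auto
  note S' = prime_setD[OF S(1)]
  have gauss: "(\<Sum>y\<in>conjs x. ln (max 1 (loc p y))) = - ln (loc p (of_int ?a))" if p: "p \<in> S" for p
  proof -
    have "loc p (of_int ?a) > 0" using a S' p by (intro loc_pos) (auto simp: place_def)
    moreover have "(\<Prod>y\<in>conjs x. max 1 (loc p y)) > 0" by (intro prod_pos) (simp add: less_max_iff_disj)
    ultimately have "ln (loc p (of_int ?a)) + ln (\<Prod>y\<in>conjs x. max 1 (loc p y)) = 0"
      using gauss_lemma[OF S'(3)[OF p] x] by (metis ln_mult_pos ln_one)
    moreover have "ln (\<Prod>y\<in>conjs x. max 1 (loc p y)) = (\<Sum>y\<in>conjs x. ln (max 1 (loc p y)))"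
      using finite_conjs[OF x] by (intro ln_prod) (auto simp: max_def)
    ultimately show ?thesis by linarith
  qed
  have "(\<Sum>v\<in>insert 0 S. ln (loc v (of_int ?a))) = 0"
    using S S' by (intro product_formula_int a) (auto simp: bad_primes_def)
  then have arch: "ln \<bar>real_of_int ?a\<bar> = - (\<Sum>p\<in>S. ln (loc p (of_int ?a)))"
    using S' by (simp add: loc_def[of 0])
  have "(\<Sum>y\<in>conjs x. \<Sum>v\<in>insert 0 S. ln (max 1 (loc v y)))
      = (\<Sum>v\<in>insert 0 S. \<Sum>y\<in>conjs x. ln (max 1 (loc v y)))" by (rule sum.swap)
  also have "\<dots> = (\<Sum>y\<in>conjs x. ln (max 1 (cmod y))) + ln \<bar>real_of_int ?a\<bar>"
    using S' by (simp add: loc_def[of 0] gauss arch sum_negf)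
  also have "\<dots> = real (degree ?P) * weil_height x"
    using m(2) by (simp add: weil_height_def Let_def conjs_def)
  finally show ?thesis by simp
qed

lemma zero_notin_conjs: "algebraic x \<Longrightarrow> x \<noteq> 0 \<Longrightarrow> 0 \<notin> conjs x"
  using conjs_transfer'[of x "[:0, 1:]" 0 x] conjs_self by auto

text \<open>The minimal polynomial in split form, evaluated at 0; signs disappear under the absolute
  value.\<close>

lemma norm_eq:
  assumes "algebraic x" "x \<noteq> 0" "place v"
  shows "loc v (of_int (lead_coeff (min_int_poly x))) * (\<Prod>y\<in>conjs x. loc v y)
       = loc v (of_int (coeff (min_int_poly x) 0))" "coeff (min_int_poly x) 0 \<noteq> 0"
proof -
  let ?P = "min_int_poly x"
  have "poly (cpoly ?P) 0 \<noteq> 0" using zero_notin_conjs[OF assms(1,2)] by (simp add: conjs_def)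
  then show c0: "coeff ?P 0 \<noteq> 0" by (simp add: poly_0_coeff_0 coeff_map_poly)
  have "(of_int (coeff ?P 0) :: complex) = poly (cpoly ?P) 0"
    by (simp add: poly_0_coeff_0 coeff_map_poly)
  also have "\<dots> = of_int (lead_coeff ?P) * (\<Prod>y\<in>conjs x. - y)"
    by (subst min_int_poly_conjs[OF assms(1)]) (simp add: poly_prod)
  finally have *: "(of_int (coeff ?P 0) :: complex) = of_int (lead_coeff ?P) * (\<Prod>y\<in>conjs x. - y)" .
  have **: "algebraic (\<Prod>y\<in>conjs x. - y) \<and> loc v (\<Prod>y\<in>conjs x. - y) = (\<Prod>y\<in>conjs x. loc v (- y))"
    using finite_conjs algebraic_conjs assms by (intro loc_prod) auto
  show "loc v (of_int (lead_coeff ?P)) * (\<Prod>y\<in>conjs x. loc v y) = loc v (of_int (coeff ?P 0))"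
    unfolding * using ** algebraic_conjs[OF assms(1)] assms(3) by (simp add: loc_mult loc_minus)
qed

text \<open>The norm of \<open>x\<close> is, up to sign, a quotient of two integers, so the product
  formula for integers applies to both.\<close>

lemma product_formula:
  assumes x: "algebraic x" "x \<noteq> 0" and S: "prime_set S" "bad_primes x \<subseteq> S"
  shows "(\<Sum>y\<in>conjs x. \<Sum>v\<in>insert 0 S. ln (loc v y)) = 0"
proof -
  let ?P = "min_int_poly x"
  note S' = prime_setD[OF S(1)]
  have a: "lead_coeff ?P \<noteq> 0" using min_int_poly[OF x(1)] by auto
  have "(\<Sum>y\<in>conjs x. ln (loc v y)) = ln (loc v (of_int (coeff ?P 0))) - ln (loc v (of_int (lead_coeff ?P)))"
    if v: "v \<in> insert 0 S" for v
  proof -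
    have pl: "place v" using S'(4) v by blast
    have pos: "loc v y > 0" if "y \<in> conjs x" for y
      using loc_pos[OF pl algebraic_conjs[OF x(1) that]] zero_notin_conjs[OF x] that by metis
    have "ln (loc v (of_int (coeff ?P 0))) = ln (loc v (of_int (lead_coeff ?P)) * (\<Prod>y\<in>conjs x. loc v y))"
      using norm_eq[OF x pl] by simp
    also have "\<dots> = ln (loc v (of_int (lead_coeff ?P))) + ln (\<Prod>y\<in>conjs x. loc v y)"
      using pos a by (intro ln_mult_pos prod_pos loc_pos[OF pl, of "of_int _"]) auto
    also have "ln (\<Prod>y\<in>conjs x. loc v y) = (\<Sum>y\<in>conjs x. ln (loc v y))"
      using finite_conjs[OF x(1)] pos by (intro ln_prod) force+
    finally show ?thesis by simp
  qed
  then have "(\<Sum>v\<in>insert 0 S. \<Sum>y\<in>conjs x. ln (loc v y))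
     = (\<Sum>v\<in>insert 0 S. ln (loc v (of_int (coeff ?P 0)))) - (\<Sum>v\<in>insert 0 S. ln (loc v (of_int (lead_coeff ?P))))"
    by (simp only: sum_subtractf[symmetric] cong: sum.cong)
  also have "(\<Sum>v\<in>insert 0 S. ln (loc v (of_int (coeff ?P 0)))) = 0"
    using S S' norm_eq(2)[OF x, of 0] by (intro product_formula_int) (auto simp: bad_primes_def place_def)
  also have "(\<Sum>v\<in>insert 0 S. ln (loc v (of_int (lead_coeff ?P)))) = 0"
    using S S' a by (intro product_formula_int) (auto simp: bad_primes_def)
  finally show ?thesis by (subst sum.swap) simp
qed

text \<open>With a unit as leading coefficient, Gauss's lemma leaves no conjugate of absolute value
  above 1; as the product of all of them is 1, none is below 1 either.\<close>

lemma loc_eq_1_of_good: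
  assumes x: "algebraic x" "x \<noteq> 0" and p: "prime p" "p \<notin> bad_primes x" and y: "y \<in> conjs x"
  shows "loc p y = 1"
proof -
  have pl: "place p" using p by (simp add: place_def)
  have fin: "finite (conjs x)" by (rule finite_conjs[OF x(1)])
  have pos: "loc p z > 0" if "z \<in> conjs x" for z
    using loc_pos[OF pl algebraic_conjs[OF x(1) that]] zero_notin_conjs[OF x] that by metis
  have unit: "loc p (of_int (lead_coeff (min_int_poly x))) = 1" "loc p (of_int (coeff (min_int_poly x) 0)) = 1"
    using p norm_eq(2)[OF x pl] by (auto intro!: loc_of_int_eq_1 simp: bad_primes_def)
  have le: "loc p z \<le> 1" if z: "z \<in> conjs x" for z
  proof -
    have "max 1 (loc p z) * 1 \<le> max 1 (loc p z) * (\<Prod>y\<in>conjs x - {z}. max 1 (loc p y))"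
      by (intro mult_left_mono prod_ge_1) auto
    also have "\<dots> = (\<Prod>y\<in>conjs x. max 1 (loc p y))" by (rule prod.remove[OF fin z, symmetric])
    also have "\<dots> = 1" using gauss_lemma[OF p(1) x(1)] unit by simp
    finally show ?thesis by simp
  qed
  have "1 = (\<Prod>y\<in>conjs x. loc p y)" using norm_eq(1)[OF x pl] unit by simp
  also have "\<dots> = loc p y * (\<Prod>y\<in>conjs x - {y}. loc p y)" by (rule prod.remove[OF fin y])
  also have "\<dots> \<le> loc p y * 1"
    using pos le y by (intro mult_left_mono prod_le_1) (auto intro: less_imp_le)
  finally show ?thesis using le[OF y] by simp
qed

section \<open>Heights of projective points over the field generated by one \<theta>\<close>

context
  fixes \<theta> :: complex
  assumes \<theta>: "algebraic \<theta>"
begin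

lemma algebraic_poly_conjs: "rat_poly q \<Longrightarrow> t \<in> conjs \<theta> \<Longrightarrow> algebraic (poly q t)"
  by (rule algebraic_poly[OF _ algebraic_conjs[OF \<theta>]])

lemma poly_conjs_nonzero:
  assumes "rat_poly q" "poly q \<theta> \<noteq> 0" "t \<in> conjs \<theta>"
  shows "poly q t \<noteq> 0"
  using conjs_transfer'[OF \<theta> assms(1) _ assms(3) conjs_self[OF \<theta>]] assms(2) by blast

lemma height_over_conjs:
  assumes q: "rat_poly q" and S: "prime_set S" "bad_primes (poly q \<theta>) \<subseteq> S"
  shows "real (card (conjs \<theta>)) * weil_height (poly q \<theta>)
    = (\<Sum>t\<in>conjs \<theta>. \<Sum>v\<in>insert 0 S. ln (max 1 (loc v (poly q t))))"
proof -
  obtain m where m: "\<And>\<phi>. (\<Sum>y\<in>conjs \<theta>. \<phi> (poly q y)) = real m * (\<Sum>y\<in>conjs (poly q \<theta>). \<phi> y)"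
    "card (conjs \<theta>) = m * degree (min_int_poly (poly q \<theta>))"
    using conjs_cover[OF \<theta> q] by blast
  show ?thesis
    using weil_height_places[OF algebraic_poly[OF q \<theta>] S]
    by (simp add: m(1)[of "\<lambda>y. \<Sum>v\<in>insert 0 S. ln (max 1 (loc v y))"] m(2) mult.assoc)
qed

lemma product_formula_over_conjs:
  assumes q: "rat_poly q" "poly q \<theta> \<noteq> 0" and S: "prime_set S" "bad_primes (poly q \<theta>) \<subseteq> S"
  shows "(\<Sum>t\<in>conjs \<theta>. \<Sum>v\<in>insert 0 S. ln (loc v (poly q t))) = 0"
proof -
  obtain m where m: "\<And>\<phi>. (\<Sum>y\<in>conjs \<theta>. \<phi> (poly q y)) = real m * (\<Sum>y\<in>conjs (poly q \<theta>). \<phi> y)"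
    using conjs_cover[OF \<theta> q(1)] by blast
  show ?thesis
    using product_formula[OF algebraic_poly[OF q(1) \<theta>] q(2) S]
    by (simp add: m[of "\<lambda>y. \<Sum>v\<in>insert 0 S. ln (loc v y)"])
qed

definition point :: "complex poly \<Rightarrow> complex poly \<Rightarrow> complex option" where
  "point A B = (if poly B \<theta> = 0 then None else Some (poly A \<theta> / poly B \<theta>))"

text \<open>By the product formula the height does not depend on the homogeneous coordinates. The
  admissible primes \<open>S0\<close> depend on \<open>A\<close> and \<open>B\<close>, and every
  larger set gives the same sum; this allows a common set to be joined to it later.\<close>

lemma height_point:
  assumes A: "rat_poly A" and B: "rat_poly B" and nz: "poly A \<theta> \<noteq> 0 \<or> poly B \<theta> \<noteq> 0"
  obtains S0 where "prime_set S0" "\<And>S. prime_set S \<Longrightarrow> S0 \<subseteq> S \<Longrightarrow>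
    real (card (conjs \<theta>)) * height_P1 (point A B)
      = (\<Sum>t\<in>conjs \<theta>. \<Sum>v\<in>insert 0 S. ln (max (loc v (poly A t)) (loc v (poly B t))))"
proof (cases "poly B \<theta> = 0")
  case True
  then have nzA: "poly A \<theta> \<noteq> 0" using nz by blast
  show ?thesis
  proof (rule that[of "bad_primes (poly A \<theta>)"])
    show "prime_set (bad_primes (poly A \<theta>))"
      by (intro prime_set_bad_primes algebraic_poly A \<theta>)
    fix S assume S: "prime_set S" "bad_primes (poly A \<theta>) \<subseteq> S"
    \<comment> \<open>At infinity the denominator vanishes at all conjugates, and the whole sum is
      the product formula for the numerator.\<close>
    have max_eq: "max (loc v (poly A t)) (loc v (poly B t)) = loc v (poly A t)"
      if "t \<in> conjs \<theta>" "v \<in> insert 0 S" for t v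
    proof -
      have pl: "place v" using that prime_setD(4)[OF S(1)] by blast
      have "poly B t = 0" using conjs_transfer[OF \<theta> B True that(1)] .
      then show ?thesis
        using loc_nonneg[OF pl algebraic_poly_conjs[OF A that(1)]] by (simp add: loc_0[OF pl])
    qed
    have "(\<Sum>t\<in>conjs \<theta>. \<Sum>v\<in>insert 0 S. ln (max (loc v (poly A t)) (loc v (poly B t))))
        = (\<Sum>t\<in>conjs \<theta>. \<Sum>v\<in>insert 0 S. ln (loc v (poly A t)))"
      by (intro sum.cong refl arg_cong[of _ _ ln] max_eq)
    then show "real (card (conjs \<theta>)) * height_P1 (point A B)
      = (\<Sum>t\<in>conjs \<theta>. \<Sum>v\<in>insert 0 S. ln (max (loc v (poly A t)) (loc v (poly B t))))"
      using product_formula_over_conjs[OF A nzA S] True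
      by (simp add: point_def height_P1_def)
  qed
next
  case False
  obtain r where r: "rat_poly r" "poly r (poly B \<theta>) = inverse (poly B \<theta>)"
    using inverse_eq_rat_poly algebraic_poly[OF B \<theta>] by blast
  \<comment> \<open>The quotient is written as a rational polynomial in \<theta>, so that it can be
    evaluated at conjugates and the relation q B = A transferred to them.\<close>
  define q where "q = A * pcompose r B"
  have q: "rat_poly q" unfolding q_def using A B r by blast
  have q\<theta>: "poly q \<theta> = poly A \<theta> / poly B \<theta>" by (simp add: q_def poly_pcompose r divide_inverse)
  have qt: "poly q t * poly B t = poly A t" if "t \<in> conjs \<theta>" for t
  proof -
    have "poly (q * B - A) t = 0"
      by (rule conjs_transfer[OF \<theta> _ _ that]) (use q A B q\<theta> False in auto)
    then show ?thesis by simp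
  qed
  show ?thesis
  proof (rule that[of "bad_primes (poly q \<theta>) \<union> bad_primes (poly B \<theta>)"])
    show "prime_set (bad_primes (poly q \<theta>) \<union> bad_primes (poly B \<theta>))"
      by (intro prime_set_Un prime_set_bad_primes algebraic_poly q B \<theta>)
    fix S assume S: "prime_set S" "bad_primes (poly q \<theta>) \<union> bad_primes (poly B \<theta>) \<subseteq> S"
    have ln_eq: "ln (max 1 (loc v (poly q t))) = ln (max (loc v (poly A t)) (loc v (poly B t))) - ln (loc v (poly B t))"
      if t: "t \<in> conjs \<theta>" and v: "v \<in> insert 0 S" for t v
    proof -
      have pl: "place v" using v prime_setD(4)[OF S(1)] by blast
      have Bt: "loc v (poly B t) > 0"
        using poly_conjs_nonzero[OF B False t] by (intro loc_pos[OF pl] algebraic_poly_conjs[OF B t])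
      have "loc v (poly A t) = loc v (poly q t) * loc v (poly B t)"
        using qt[OF t] loc_mult[OF pl algebraic_poly_conjs[OF q t] algebraic_poly_conjs[OF B t]] by simp
      then have "max (loc v (poly A t)) (loc v (poly B t)) = max 1 (loc v (poly q t)) * loc v (poly B t)"
        using Bt by (simp add: max_mult_distrib_right max.commute)
      then show ?thesis using Bt by (simp add: ln_mult_pos less_max_iff_disj)
    qed
    have "real (card (conjs \<theta>)) * height_P1 (point A B)
        = (\<Sum>t\<in>conjs \<theta>. \<Sum>v\<in>insert 0 S. ln (max 1 (loc v (poly q t))))"
      using height_over_conjs[OF q S(1)] S(2) False by (simp add: point_def height_P1_def q\<theta>)
    also have "\<dots> = (\<Sum>t\<in>conjs \<theta>. \<Sum>v\<in>insert 0 S. ln (max (loc v (poly A t)) (loc v (poly B t))) - ln (loc v (poly B t)))"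
      by (intro sum.cong refl ln_eq)
    also have "\<dots> = (\<Sum>t\<in>conjs \<theta>. \<Sum>v\<in>insert 0 S. ln (max (loc v (poly A t)) (loc v (poly B t))))
        - (\<Sum>t\<in>conjs \<theta>. \<Sum>v\<in>insert 0 S. ln (loc v (poly B t)))"
      by (simp only: sum_subtractf)
    finally show "real (card (conjs \<theta>)) * height_P1 (point A B)
      = (\<Sum>t\<in>conjs \<theta>. \<Sum>v\<in>insert 0 S. ln (max (loc v (poly A t)) (loc v (poly B t))))"
      using product_formula_over_conjs[OF B False S(1)] S(2) by simp
  qed
qed

end

section \<open>Comparison of canonical heights\<close>

lemma weil_height_nonneg:
  assumes "algebraic x" shows "weil_height x \<ge> 0"
proof -
  have "real (degree (min_int_poly x)) * weil_height x \<ge> 0"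
    unfolding weil_height_places[OF assms prime_set_bad_primes[OF assms] order_refl]
    by (intro sum_nonneg) simp
  then show ?thesis using min_int_poly(2)[OF assms] by (simp add: zero_le_mult_iff)
qed

text \<open>Needed for \<lambda> = 0, where the map is a pure power; the exponent 2 also yields h(0)
  = 2 h(0) = 0.\<close>

lemma weil_height_power:
  assumes x: "algebraic x" shows "weil_height (x ^ k) = real k * weil_height x"
proof -
  let ?S = "bad_primes x \<union> bad_primes (x ^ k)"
  have S: "prime_set ?S" by (intro prime_set_Un prime_set_bad_primes algebraic_power x)
  have X: "rat_poly [:0, 1:]" "rat_poly ([:0, 1:] ^ k)" by auto
  have "real (card (conjs x)) * weil_height (x ^ k)
      = (\<Sum>t\<in>conjs x. \<Sum>v\<in>insert 0 ?S. ln (max 1 (loc v (t ^ k))))"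
    using height_over_conjs[OF x X(2) S] by simp
  also have "\<dots> = (\<Sum>t\<in>conjs x. \<Sum>v\<in>insert 0 ?S. real k * ln (max 1 (loc v t)))"
  proof (intro sum.cong refl)
    fix t v assume t: "t \<in> conjs x" and v: "v \<in> insert 0 ?S"
    have pl: "place v" using prime_setD(4)[OF S v] .
    have "loc v t \<ge> 0" by (rule loc_nonneg[OF pl algebraic_conjs[OF x t]])
    then have "max 1 (loc v t ^ k) = max 1 (loc v t) ^ k"
      by (cases "loc v t \<le> 1") (auto simp: max_def power_le_one intro: antisym)
    then show "ln (max 1 (loc v (t ^ k))) = real k * ln (max 1 (loc v t))"
      using loc_power[OF pl algebraic_conjs[OF x t]] by (simp add: ln_realpow less_max_iff_disj)
  qed
  also have "\<dots> = real k * (real (card (conjs x)) * weil_height x)"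
    using height_over_conjs[OF x X(1) S] by (simp add: sum_distrib_left)
  finally show ?thesis using card_conjs_pos[OF x] by simp
qed

lemma weil_height_0: "weil_height 0 = 0"
  using weil_height_power[of 0 2] by simp

section \<open>Degrees on the generic fibre and the degenerate parameters\<close>

lemma prime_elem_X: "prime_elem [:0, 1 :: complex:]"
  by (rule prime_elem_linear_field_poly) simp

text \<open>Coprimality makes \<open>rat_deg\<close> an ordinary degree. A common factor of the new
  pair would divide both P and Q, except possibly for the factor X, which P(0) nonzero
  excludes.\<close>

lemma gen_iterates:
  assumes d: "d \<ge> 2" and a: "a \<noteq> 0"
  defines "PQ \<equiv> \<lambda>n. (gen_step d ^^ n) ([:a:], 1)"
  shows "coprime (fst (PQ n)) (snd (PQ n)) \<and> poly (fst (PQ n)) 0 \<noteq> 0 \<and> snd (PQ n) \<noteq> 0 \<and>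
    (n > 0 \<longrightarrow> degree (fst (PQ n)) = d ^ (n - 1) \<and> degree (snd (PQ n)) < degree (fst (PQ n)))"
proof (induction n)
  case 0
  then show ?case using a by (simp add: PQ_def)
next
  case (Suc n)
  define P where "P = fst (PQ n)"
  define Q where "Q = snd (PQ n)"
  let ?X = "[:0, 1 :: complex:]"
  have PQ_Suc: "fst (PQ (Suc n)) = P ^ d + ?X * Q ^ d" "snd (PQ (Suc n)) = P * Q ^ (d - 1)"
    by (simp_all add: PQ_def P_def Q_def gen_step_def)
  have cop: "coprime P Q" and P0: "poly P 0 \<noteq> 0" and Q0: "Q \<noteq> 0"
    using Suc by (auto simp: P_def Q_def)
  then have Pnz: "P \<noteq> 0" by auto
  have "\<not> ?X dvd P" using P0 by (metis minus_zero poly_eq_0_iff_dvd)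
  then have copX: "coprime ?X P" by (rule prime_elem_imp_coprime[OF prime_elem_X])
  have 1: "coprime (P ^ d + ?X * Q ^ d) P"
  proof (rule coprimeI)
    fix c assume c: "c dvd P ^ d + ?X * Q ^ d" "c dvd P"
    have "c dvd P ^ d" using c d by (metis dvd_power dvd_trans pos2 less_le_trans)
    then have "c dvd ?X * Q ^ d" using c(1) by (simp add: dvd_add_right_iff)
    moreover have "coprime P (?X * Q ^ d)"
      unfolding coprime_mult_right_iff using cop copX by (simp add: coprime_commute)
    ultimately show "is_unit c" using c(2) coprime_common_divisor by blast
  qed
  have 2: "coprime (P ^ d + ?X * Q ^ d) Q"
  proof (rule coprimeI)
    fix c assume c: "c dvd P ^ d + ?X * Q ^ d" "c dvd Q"
    have "c dvd Q ^ d" using c d by (metis dvd_power dvd_trans pos2 less_le_trans)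
    then have "c dvd ?X * Q ^ d" by (rule dvd_mult)
    then have "c dvd P ^ d" using c(1) by (simp add: dvd_add_left_iff)
    moreover have "coprime (P ^ d) Q" using cop by simp
    ultimately show "is_unit c" using c(2) coprime_common_divisor by blast
  qed
  have "coprime (P ^ d + ?X * Q ^ d) (P * Q ^ (d - 1))" using 1 2 by simp
  moreover have "poly (P ^ d + ?X * Q ^ d) 0 \<noteq> 0" using P0 by simp
  moreover have "P * Q ^ (d - 1) \<noteq> 0" using Pnz Q0 by simp
  \<comment> \<open>The first step is special: P and Q are constants and X Q^d supplies the degree.
    Later P^d wins, because 1 + d deg Q < d (deg Q + 1) <= d deg P.\<close>
  moreover have "degree (P ^ d + ?X * Q ^ d) = d ^ n \<and> degree (P * Q ^ (d - 1)) < d ^ n"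
  proof (cases "n = 0")
    case True
    then have PQ0: "P = [:a:]" "Q = 1" by (auto simp: P_def Q_def PQ_def)
    have "degree (P ^ d) = 0" by (simp add: PQ0 poly_const_pow)
    then have "degree (P ^ d + ?X * Q ^ d) = 1"
      using degree_add_eq_right[of "P ^ d" ?X] by (simp add: PQ0)
    then show ?thesis using True by (simp add: PQ0)
  next
    case False
    then have degs: "degree P = d ^ (n - 1)" "degree Q < degree P" using Suc by (auto simp: P_def Q_def)
    have dn: "d * d ^ (n - 1) = d ^ n" using False by (cases n) auto
    have dP: "degree (P ^ d) = d ^ n" using Pnz dn by (simp add: degree_power_eq degs)
    have "degree (?X * Q ^ d) \<le> 1 + d * degree Q"
      using Q0 by (simp add: degree_mult_eq degree_power_eq)
    also have "\<dots> < d * Suc (degree Q)" using d by simp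
    also have "\<dots> \<le> d * degree P" using degs by (intro mult_left_mono) auto
    finally have "degree (?X * Q ^ d) < degree (P ^ d)" unfolding degree_power_eq[OF Pnz] .
    then have "degree (P ^ d + ?X * Q ^ d) = d ^ n" using dP degree_add_eq_left by metis
    moreover have "degree (P * Q ^ (d - 1)) < d ^ n"
    proof -
      have "degree (P * Q ^ (d - 1)) = degree P + (d - 1) * degree Q"
        using Pnz Q0 by (simp add: degree_mult_eq degree_power_eq)
      also have "\<dots> < degree P + (d - 1) * degree P" using degs d by simp
      also have "\<dots> = d * degree P" using d by (cases d) auto
      finally show ?thesis unfolding degs dn .
    qed
    ultimately show ?thesis by blast
  qed
  ultimately show ?case unfolding PQ_Suc by simp
qed

lemma generic_canon_height_nonzero:
  assumes d: "d \<ge> 2" and a: "a \<noteq> 0"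
  shows "generic_canon_height d a = 1 / real d"
proof -
  have "real (rat_deg ((gen_step d ^^ n) ([:a:], 1))) / real d ^ n = 1 / real d" if n: "n > 0" for n
  proof -
    define P where "P = fst ((gen_step d ^^ n) ([:a:], 1))"
    define Q where "Q = snd ((gen_step d ^^ n) ([:a:], 1))"
    have *: "coprime P Q" "degree P = d ^ (n - 1)" "degree Q < degree P"
      using gen_iterates[OF assms, of n] n by (auto simp: P_def Q_def)
    have "gcd P Q = 1" using *(1) by (simp add: coprime_iff_gcd_eq_1)
    then have "rat_deg ((gen_step d ^^ n) ([:a:], 1)) = d ^ (n - 1)"
      using *(2,3) by (simp add: rat_deg_def P_def Q_def)
    moreover have "real d ^ n = real d * real d ^ (n - 1)" using n by (cases n) auto
    ultimately show ?thesis using d by simp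
  qed
  then have "(\<lambda>n. real (rat_deg ((gen_step d ^^ n) ([:a:], 1))) / real d ^ n) \<longlonglongrightarrow> 1 / real d"
    by (intro tendsto_eventually eventually_sequentiallyI[of 1]) simp
  then show ?thesis unfolding generic_canon_height_def by (rule limI)
qed

lemma generic_canon_height_0:
  assumes d: "d \<ge> 2"
  shows "generic_canon_height d 0 = 0"
proof -
  have "snd ((gen_step d ^^ Suc n) ([:0:], 1)) = 0" for n
    using d by (induction n) (auto simp: gen_step_def)
  then have zero: "real (rat_deg ((gen_step d ^^ Suc n) ([:0:], 1))) / real d ^ Suc n = 0" for n
  proof -
    define P where "P = fst ((gen_step d ^^ Suc n) ([:0:], 1))"
    \<comment> \<open>After one step the point is infinity; the gcd with 0 is
      \<open>normalize P\<close>, and P divided by it is a constant.\<close>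
    have "degree (P div normalize P) = 0"
    proof (cases "P = 0")
      case False
      then have "is_unit (P div normalize P)" by simp
      then show ?thesis by (auto simp: is_unit_poly_iff)
    qed simp
    then show ?thesis
      using \<open>snd ((gen_step d ^^ Suc n) ([:0:], 1)) = 0\<close> by (simp add: rat_deg_def P_def del: funpow.simps)
  qed
  have "(\<lambda>n. real (rat_deg ((gen_step d ^^ n) ([:0:], 1))) / real d ^ n) \<longlonglongrightarrow> 0"
    by (rule LIMSEQ_imp_Suc, unfold zero, rule tendsto_const)
  then show ?thesis unfolding generic_canon_height_def by (rule limI)
qed

lemma canon_height_at_0:
  assumes d: "d \<ge> 2"
  shows "canon_height d lam 0 = 0"
proof -
  have "fmap d lam P \<in> {Some 0, None}" if "P \<in> {Some 0, None}" for P
    using that by (auto simp: fmap_def)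
  then have "(fmap d lam ^^ n) (Some 0) \<in> {Some 0, None}" for n
    by (induction n) (simp, simp only: funpow.simps o_apply)
  then have "height_P1 ((fmap d lam ^^ n) (Some 0)) = 0" for n
    by (metis height_P1_def insertE option.simps(4) option.simps(5) singletonD weil_height_0)
  then show ?thesis unfolding canon_height_def by (simp add: limI)
qed

text \<open>The map is z^(d-1), so heights grow like (d-1)^n, which is negligible against
  d^n.\<close>

lemma canon_height_lam_0:
  assumes d: "d \<ge> 2" and a: "algebraic a" "a \<noteq> 0"
  shows "canon_height d 0 a = 0"
proof -
  have iter: "(fmap d 0 ^^ n) (Some a) = Some (a ^ ((d - 1) ^ n))" for n
  proof (induction n)
    case (Suc n)
    have "fmap d 0 (Some z) = Some (z ^ (d - 1))" if "z \<noteq> 0" for z :: complex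
      using that d by (cases d) (auto simp: fmap_def)
    then show ?case using Suc a by (simp add: mult.commute flip: power_mult)
  qed simp
  have "height_P1 ((fmap d 0 ^^ n) (Some a)) / real d ^ n = weil_height a * (real (d - 1) / real d) ^ n" for n
    using a by (simp add: iter height_P1_def weil_height_power power_divide)
  moreover have "(\<lambda>n. weil_height a * (real (d - 1) / real d) ^ n) \<longlonglongrightarrow> weil_height a * 0"
    using d by (intro tendsto_mult tendsto_const LIMSEQ_power_zero) simp
  ultimately show ?thesis unfolding canon_height_def by (simp add: limI)
qed

section \<open>The homogeneous lift and summation over places\<close>

lemma (in local_orbit) limit_bound:
  "\<exists>g. (\<lambda>n. ln (max (u n) (w n)) / real d ^ n) \<longlonglongrightarrow> g \<and>
     \<bar>g - ln (max 1 L) / real d\<bar> \<le> 3 * ln \<kappa> + real d * \<bar>ln r\<bar>"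
  using g_limit g_bound unfolding M_def by blast

text \<open>The coordinates are kept as polynomials in the generator: evaluating them at a conjugate
  gives the orbit of the conjugate pair (\<alpha>, \<lambda>).\<close>

fun lift :: "nat \<Rightarrow> complex poly \<Rightarrow> complex poly \<Rightarrow> nat \<Rightarrow> complex poly \<times> complex poly" where
  "lift d a l 0 = (a, 1)"
| "lift d a l (Suc n) = (let (A, B) = lift d a l n in (A ^ d + l * B ^ d, A * B ^ (d - 1)))"

lemma lift_Suc:
  "fst (lift d a l (Suc n)) = fst (lift d a l n) ^ d + l * snd (lift d a l n) ^ d"
  "snd (lift d a l (Suc n)) = fst (lift d a l n) * snd (lift d a l n) ^ (d - 1)"
  by (simp_all add: case_prod_unfold Let_def)

lemma rat_poly_lift:
  assumes "rat_poly a" "rat_poly l"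
  shows "rat_poly (fst (lift d a l n)) \<and> rat_poly (snd (lift d a l n))"
  using assms by (induction n) (auto simp: case_prod_unfold Let_def)

lemma local_orbit_lift:
  assumes d: "d \<ge> 2" and v: "place v" and t: "algebraic t"
    and a: "rat_poly a" "poly a t \<noteq> 0" and l: "rat_poly l" "poly l t \<noteq> 0"
  shows "local_orbit d (kap v) (loc v (poly l t)) (loc v (poly a t))
     (\<lambda>n. loc v (poly (fst (lift d a l n)) t)) (\<lambda>n. loc v (poly (snd (lift d a l n)) t))"
proof -
  define A where "A n = poly (fst (lift d a l n)) t" for n
  define B where "B n = poly (snd (lift d a l n)) t" for n
  let ?lam = "poly l t"
  have alg: "algebraic (A n)" "algebraic (B n)" "algebraic ?lam" "algebraic (poly a t)" for n
    unfolding A_def B_def using rat_poly_lift[OF a(1) l(1)] a l t by (auto intro: algebraic_poly)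
  have Suc: "A (Suc n) = A n ^ d + ?lam * B n ^ d" "B (Suc n) = A n * B n ^ (d - 1)" for n
    by (simp_all only: A_def B_def lift_Suc poly_add poly_mult poly_power)
  have x: "algebraic (A n ^ d)" "loc v (A n ^ d) = loc v (A n) ^ d"
    "algebraic (?lam * B n ^ d)" "loc v (?lam * B n ^ d) = loc v ?lam * loc v (B n) ^ d" for n
    by (simp_all add: alg algebraic_power algebraic_mult loc_power[OF v] loc_mult[OF v])
  have "local_orbit d (kap v) (loc v ?lam) (loc v (poly a t)) (\<lambda>n. loc v (A n)) (\<lambda>n. loc v (B n))"
  proof
    show "d \<ge> 2" "kap v \<ge> 1" by (fact d, rule kap_ge_1)
    show "loc v ?lam > 0" "loc v (poly a t) > 0" by (rule loc_pos[OF v]; fact alg a l)+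
    show "loc v (A 0) = loc v (poly a t)" "loc v (B 0) = 1" by (simp_all add: A_def B_def loc_1[OF v])
    fix n
    show "loc v (A n) \<ge> 0" by (rule loc_nonneg[OF v alg(1)])
    show "loc v (B (Suc n)) = loc v (A n) * loc v (B n) ^ (d - 1)"
      by (simp only: Suc loc_mult[OF v alg(1) algebraic_power[OF alg(2)]] loc_power[OF v alg(2)])
    show "loc v (A (Suc n)) \<le> kap v * max (loc v (A n) ^ d) (loc v ?lam * loc v (B n) ^ d)"
      using loc_add[OF v x(1,3)] by (simp only: Suc x)
    show "loc v (A n) ^ d \<le> kap v * loc v (A (Suc n))"
      if "kap v * (loc v ?lam * loc v (B n) ^ d) < loc v (A n) ^ d"
      using loc_dominant[OF v x(1,3)] that by (simp only: Suc x)
    show "loc v ?lam * loc v (B n) ^ d \<le> kap v * loc v (A (Suc n))"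
      if "kap v * loc v (A n) ^ d < loc v ?lam * loc v (B n) ^ d"
      using loc_dominant[OF v x(3,1)] that by (simp only: Suc x add.commute)
  qed
  then show ?thesis by (simp only: A_def B_def)
qed

lemma fmap_iterate_lift:
  assumes d: "d \<ge> 2" and \<theta>: "algebraic \<theta>"
    and a: "rat_poly a" "poly a \<theta> \<noteq> 0" and l: "rat_poly l" "poly l \<theta> \<noteq> 0"
  shows "(fmap d (poly l \<theta>) ^^ n) (Some (poly a \<theta>)) = point \<theta> (fst (lift d a l n)) (snd (lift d a l n))"
    and "poly (fst (lift d a l n)) \<theta> \<noteq> 0 \<or> poly (snd (lift d a l n)) \<theta> \<noteq> 0"
proof -
  \<comment> \<open>If the numerator A vanishes, the next one is \<lambda> B^d, nonzero since
    \<lambda> is; if only B vanishes, it is A^d; if neither does, the next denominator is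
    nonzero.\<close>
  have nz: "poly (fst (lift d a l n)) \<theta> \<noteq> 0 \<or> poly (snd (lift d a l n)) \<theta> \<noteq> 0" for n
    using a(2) l(2) d
    by (induction n) (auto simp: lift_Suc power_0_left simp del: lift.simps(2))
  then show "poly (fst (lift d a l n)) \<theta> \<noteq> 0 \<or> poly (snd (lift d a l n)) \<theta> \<noteq> 0" .
  show "(fmap d (poly l \<theta>) ^^ n) (Some (poly a \<theta>)) = point \<theta> (fst (lift d a l n)) (snd (lift d a l n))"
  proof (induction n)
    case 0
    then show ?case by (simp add: point_def[OF \<theta>])
  next
    case (Suc n)
    define A where "A = poly (fst (lift d a l n)) \<theta>"
    define B where "B = poly (snd (lift d a l n)) \<theta>"
    have ev: "poly (fst (lift d a l (Suc n))) \<theta> = A ^ d + poly l \<theta> * B ^ d"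
      "poly (snd (lift d a l (Suc n))) \<theta> = A * B ^ (d - 1)"
      by (simp_all only: A_def B_def lift_Suc poly_add poly_mult poly_power)
    have AB: "A \<noteq> 0 \<or> B \<noteq> 0" using nz[of n] by (simp add: A_def B_def)
    have IH: "(fmap d (poly l \<theta>) ^^ n) (Some (poly a \<theta>)) = (if B = 0 then None else Some (A / B))"
      using Suc by (simp add: point_def[OF \<theta>] A_def B_def)
    have "fmap d (poly l \<theta>) (if B = 0 then None else Some (A / B))
        = (if A * B ^ (d - 1) = 0 then None else Some ((A ^ d + poly l \<theta> * B ^ d) / (A * B ^ (d - 1))))"
    proof (cases "A = 0 \<or> B = 0")
      case True
      then show ?thesis using AB l(2) d by (auto simp: fmap_def)
    next
      case False
      have Bd: "B ^ d = B * B ^ (d - 1)" using d by (cases d) auto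
      have "(X / (B * C) + c) / (A / B) = (X + c * (B * C)) / (A * C)" if "C \<noteq> 0" for X C c
        using that False by (simp add: field_simps)
      from this[of "B ^ (d - 1)" "A ^ d" "poly l \<theta>"] False
      have "((A / B) ^ d + poly l \<theta>) / (A / B) = (A ^ d + poly l \<theta> * B ^ d) / (A * B ^ (d - 1))"
        unfolding power_divide Bd by simp
      then show ?thesis using False by (simp add: fmap_def)
    qed
    then show ?case by (simp add: IH point_def[OF \<theta>] ev del: lift.simps(2))
  qed
qed

lemma canon_height_bound:
  assumes d: "d \<ge> 2" and alpha: "algebraic alpha" "alpha \<noteq> 0" and lam: "algebraic lam" "lam \<noteq> 0"
  shows "\<bar>canon_height d lam alpha - weil_height lam / real d\<bar> \<le> 3 * ln 2 + 2 * real d * weil_height alpha"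
proof -
  obtain \<theta> a l where \<theta>: "algebraic \<theta>" and al: "rat_poly a" "rat_poly l" "alpha = poly a \<theta>" "lam = poly l \<theta>"
    using primitive_element[OF alpha(1) lam(1)] by metis
  define J where "J = conjs \<theta>"
  define D where "D = real (card J)"
  have D: "D > 0" using card_conjs_pos[OF \<theta>] by (simp add: D_def J_def)
  define S where "S = bad_primes alpha \<union> bad_primes lam"
  have S: "prime_set S" unfolding S_def by (intro prime_set_Un prime_set_bad_primes alpha lam)
  define V where "V = insert 0 S"
  have V: "finite V" using prime_setD(1)[OF S] by (simp add: V_def)
  define u where "u t v n = loc v (poly (fst (lift d a l n)) t)" for t v n
  define w where "w t v n = loc v (poly (snd (lift d a l n)) t)" for t v n
  have at: "poly a t \<noteq> 0" and lt: "poly l t \<noteq> 0" and talg: "algebraic t" if "t \<in> J" for t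
    using poly_conjs_nonzero[OF \<theta>] al alpha lam algebraic_conjs[OF \<theta>] that unfolding J_def by blast+
  have orbit: "local_orbit d (kap v) (loc v (poly l t)) (loc v (poly a t)) (u t v) (w t v)"
    if "t \<in> J" "place v" for t v
    unfolding u_def w_def
    by (rule local_orbit_lift[OF d that(2) talg[OF that(1)] al(1) at[OF that(1)] al(2) lt[OF that(1)]])
  have heights: "D * height_P1 ((fmap d lam ^^ n) (Some alpha)) = (\<Sum>t\<in>J. \<Sum>v\<in>V. ln (max (u t v n) (w t v n)))" for n
  proof -
    have A: "rat_poly (fst (lift d a l n))" and B: "rat_poly (snd (lift d a l n))"
      using rat_poly_lift al by auto
    have iter: "(fmap d lam ^^ n) (Some alpha) = point \<theta> (fst (lift d a l n)) (snd (lift d a l n))"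
      and nz: "poly (fst (lift d a l n)) \<theta> \<noteq> 0 \<or> poly (snd (lift d a l n)) \<theta> \<noteq> 0"
      using fmap_iterate_lift[OF d \<theta>] al alpha lam by metis+
    \<comment> \<open>\<open>S0\<close> changes with \<open>n\<close>. It is enlarged by
      \<open>S\<close>, and the primes outside \<open>S\<close> then drop out because \<alpha> and
      \<lambda> have only unit conjugates there.\<close>
    obtain S0 where S0: "prime_set S0" "\<And>S. prime_set S \<Longrightarrow> S0 \<subseteq> S \<Longrightarrow>
      D * height_P1 ((fmap d lam ^^ n) (Some alpha)) = (\<Sum>t\<in>J. \<Sum>v\<in>insert 0 S. ln (max (u t v n) (w t v n)))"
      using height_point[OF \<theta> A B nz] unfolding iter D_def J_def u_def w_def by blast
    let ?S = "S0 \<union> S"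
    have S': "prime_set ?S" by (intro prime_set_Un S0 S)
    have "D * height_P1 ((fmap d lam ^^ n) (Some alpha)) = (\<Sum>t\<in>J. \<Sum>v\<in>insert 0 ?S. ln (max (u t v n) (w t v n)))"
      by (rule S0(2)[OF S']) simp
    also have "\<dots> = (\<Sum>t\<in>J. \<Sum>v\<in>V. ln (max (u t v n) (w t v n)))"
    proof (rule sum.cong[OF refl], rule sum.mono_neutral_right)
      fix t assume t: "t \<in> J"
      show "\<forall>p\<in>insert 0 ?S - V. ln (max (u t p n) (w t p n)) = 0"
      proof
        fix p assume "p \<in> insert 0 ?S - V"
        then have p: "prime p" "p \<notin> S" using prime_setD(3)[OF S'] by (auto simp: V_def)
        then have pl: "place p" "p \<noteq> 0" using prime_gt_0_nat by (auto simp: place_def)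
        have mem: "poly a t \<in> conjs alpha" "poly l t \<in> conjs lam"
          using poly_in_conjs[OF \<theta>] al t J_def by auto
        have "loc p (poly a t) = 1" "loc p (poly l t) = 1"
          using loc_eq_1_of_good[OF alpha p(1) _ mem(1)] loc_eq_1_of_good[OF lam p(1) _ mem(2)] p(2)
          by (auto simp: S_def)
        then interpret local_orbit d 1 1 1 "u t p" "w t p"
          using orbit[OF t pl(1)] pl(2) by (simp add: kap_def)
        show "ln (max (u t p n) (w t p n)) = 0" using M_eq_1[of n] by (simp add: M_def)
      qed
    qed (use prime_setD(1)[OF S'] V_def in auto)
    finally show ?thesis .
  qed
  define lim_at where "lim_at t v g \<longleftrightarrow>
    (\<lambda>n. ln (max (u t v n) (w t v n)) / real d ^ n) \<longlonglongrightarrow> g \<and>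
     \<bar>g - ln (max 1 (loc v (poly l t))) / real d\<bar> \<le> 3 * ln (kap v) + real d * \<bar>ln (loc v (poly a t))\<bar>"
    for t v g
  have lim_at: "\<exists>g. lim_at t v g" if "t \<in> J" "v \<in> V" for t v
    unfolding lim_at_def
    using local_orbit.limit_bound[OF orbit[OF that(1)]] prime_setD(4)[OF S] that(2) unfolding V_def by blast
  define g where "g t v = (SOME g. lim_at t v g)" for t v
  have g: "\<And>t v. t \<in> J \<Longrightarrow> v \<in> V \<Longrightarrow> (\<lambda>n. ln (max (u t v n) (w t v n)) / real d ^ n) \<longlonglongrightarrow> g t v"
    "\<And>t v. t \<in> J \<Longrightarrow> v \<in> V \<Longrightarrow> \<bar>g t v - ln (max 1 (loc v (poly l t))) / real d\<bar>
      \<le> 3 * ln (kap v) + real d * \<bar>ln (loc v (poly a t))\<bar>"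
    using someI_ex[OF lim_at] unfolding g_def lim_at_def by blast+
  have "(\<lambda>n. (\<Sum>t\<in>J. \<Sum>v\<in>V. ln (max (u t v n) (w t v n)) / real d ^ n) / D) \<longlonglongrightarrow> (\<Sum>t\<in>J. \<Sum>v\<in>V. g t v) / D"
    using D by (intro tendsto_divide tendsto_sum g tendsto_const) auto
  moreover have "(\<Sum>t\<in>J. \<Sum>v\<in>V. ln (max (u t v n) (w t v n)) / real d ^ n) / D
      = height_P1 ((fmap d lam ^^ n) (Some alpha)) / real d ^ n" for n
    using D by (simp add: heights[symmetric] flip: sum_divide_distrib)
  ultimately have canon: "canon_height d lam alpha = (\<Sum>t\<in>J. \<Sum>v\<in>V. g t v) / D"
    unfolding canon_height_def by (intro limI) simp
  have h_lam: "D * weil_height lam = (\<Sum>t\<in>J. \<Sum>v\<in>V. ln (max 1 (loc v (poly l t))))"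
    using height_over_conjs[OF \<theta> al(2) S] al(4) by (simp add: D_def J_def V_def S_def)
  have h_alpha: "(\<Sum>t\<in>J. \<Sum>v\<in>V. \<bar>ln (loc v (poly a t))\<bar>) = 2 * (D * weil_height alpha)"
  proof -
    \<comment> \<open>Summed over conjugates and places, the last term vanishes by the product
      formula; this is the origin of the factor 2 in 2 h(\<alpha>).\<close>
    have "\<bar>ln r\<bar> = 2 * ln (max 1 r) - ln r" if "r > 0" for r :: real
      using that by (cases "r \<ge> 1") (auto simp: max_def)
    moreover have "loc v (poly a t) > 0" if "t \<in> J" "v \<in> V" for t v
      using that prime_setD(4)[OF S] at[OF that(1)] algebraic_poly[OF al(1) talg[OF that(1)]]
      by (intro loc_pos) (auto simp: V_def)
    ultimately have "(\<Sum>t\<in>J. \<Sum>v\<in>V. \<bar>ln (loc v (poly a t))\<bar>)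
      = (\<Sum>t\<in>J. \<Sum>v\<in>V. 2 * ln (max 1 (loc v (poly a t))) - ln (loc v (poly a t)))"
      by (intro sum.cong refl) blast
    also have "\<dots> = 2 * (\<Sum>t\<in>J. \<Sum>v\<in>V. ln (max 1 (loc v (poly a t)))) - (\<Sum>t\<in>J. \<Sum>v\<in>V. ln (loc v (poly a t)))"
      by (simp only: sum_subtractf sum_distrib_left)
    also have "(\<Sum>t\<in>J. \<Sum>v\<in>V. ln (max 1 (loc v (poly a t)))) = D * weil_height alpha"
      using height_over_conjs[OF \<theta> al(1) S] al(3) by (simp add: D_def J_def V_def S_def)
    also have "(\<Sum>t\<in>J. \<Sum>v\<in>V. ln (loc v (poly a t))) = 0"
      using product_formula_over_conjs[OF \<theta> al(1) _ S] al(3) alpha by (simp add: J_def V_def S_def)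
    finally show ?thesis by simp
  qed
  have ln_kap: "(\<Sum>v\<in>V. ln (kap v)) = ln 2"
  proof -
    have "(\<Sum>v\<in>S. ln (kap v)) = 0"
      using prime_setD(2)[OF S] by (intro sum.neutral) (metis kap_def ln_one)
    then show ?thesis using prime_setD(1,2)[OF S] by (simp add: V_def kap_def)
  qed
  have "canon_height d lam alpha - weil_height lam / real d
      = (\<Sum>t\<in>J. \<Sum>v\<in>V. g t v - ln (max 1 (loc v (poly l t))) / real d) / D"
  proof -
    have "weil_height lam / real d = (\<Sum>t\<in>J. \<Sum>v\<in>V. ln (max 1 (loc v (poly l t))) / real d) / D"
      using D by (simp add: h_lam[symmetric] flip: sum_divide_distrib)
    then show ?thesis by (simp add: canon sum_subtractf diff_divide_distrib)
  qed
  moreover have "\<bar>\<Sum>t\<in>J. \<Sum>v\<in>V. g t v - ln (max 1 (loc v (poly l t))) / real d\<bar>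
      \<le> (\<Sum>t\<in>J. \<Sum>v\<in>V. 3 * ln (kap v) + real d * \<bar>ln (loc v (poly a t))\<bar>)"
    by (intro order_trans[OF sum_abs] sum_mono order_trans[OF sum_abs] g)
  moreover have "(\<Sum>t\<in>J. \<Sum>v\<in>V. 3 * ln (kap v) + real d * \<bar>ln (loc v (poly a t))\<bar>)
      = D * (3 * ln 2 + 2 * real d * weil_height alpha)"
  proof -
    have "(\<Sum>t\<in>J. \<Sum>v\<in>V. 3 * ln (kap v) + real d * \<bar>ln (loc v (poly a t))\<bar>)
       = (\<Sum>t\<in>J. 3 * (\<Sum>v\<in>V. ln (kap v))) + real d * (\<Sum>t\<in>J. \<Sum>v\<in>V. \<bar>ln (loc v (poly a t))\<bar>)"
      by (simp only: sum.distrib sum_distrib_left)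
    then show ?thesis by (simp add: ln_kap h_alpha D_def algebra_simps)
  qed
  ultimately show ?thesis using D by (simp add: abs_divide pos_divide_le_eq mult.commute)
qed

theorem theorem1p2:
  fixes d :: nat and alpha lam :: complex
  assumes "d \<ge> 2" and "algebraic alpha" and "algebraic lam"
  shows "\<bar>canon_height d lam alpha - generic_canon_height d alpha * weil_height lam\<bar>
           < 3 * real d * (1 + real (num_bad_places alpha) + 2 * weil_height alpha)"
proof -
  have h: "weil_height alpha \<ge> 0" by (rule weil_height_nonneg[OF assms(2)])
  have "\<bar>canon_height d lam alpha - generic_canon_height d alpha * weil_height lam\<bar>
      \<le> 3 * ln 2 + 2 * real d * weil_height alpha"
  proof (cases "alpha = 0")
    \<comment> \<open>The comparison by places needs \<alpha> and \<lambda> nonzero. For \<alpha> =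
      0 both canonical heights vanish, and for \<lambda> = 0 both the canonical height of \<alpha>
      and h(\<lambda>) do.\<close>
    case True
    then show ?thesis
      using assms h by (simp add: canon_height_at_0 generic_canon_height_0)
  next
    case alpha: False
    show ?thesis
    proof (cases "lam = 0")
      case True
      then show ?thesis using assms h alpha by (simp add: canon_height_lam_0 weil_height_0)
    next
      case False
      then show ?thesis
        using canon_height_bound[OF assms(1,2) alpha assms(3)] assms(1) alpha
        by (simp add: generic_canon_height_nonzero)
    qed
  qed
  \<comment> \<open>Strictness rests on ln 2 < 1 and so holds also when h(\<alpha>) = 0.\<close>
  also have "3 * ln 2 + 2 * real d * weil_height alpha < 3 * real d + 6 * real d * weil_height alpha"
  proof -
    have "3 * ln 2 < (3 * real d :: real)" using ln_2_less_1 assms(1) by simp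
    moreover have "real d * weil_height alpha \<ge> 0" using h by simp
    ultimately show ?thesis by linarith
  qed
  also have "\<dots> \<le> 3 * real d * (1 + real (num_bad_places alpha) + 2 * weil_height alpha)"
    by (simp add: algebra_simps)
  finally show ?thesis .
qed

end
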